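(* Let $M$ be an arbitrary connected two-dimensional Riemannian manifold (surface) of constant negative curvature $-1$, and let $\rho$ be the distance function generated by its Riemannian metric. Then the Steiner ratio of $M$ is strictly less than $\sqrt{3}/2$, that is, $m(M,\rho)<\sqrt{3}/2$.
   Context: For a metric space $(X,\rho)$ and a finite nonempty subset $N\subset X$, $\rho(\mathrm{MST}_N)$ denotes the least weight of a spanning tree of the complete graph on $N$, where the edge $xy$ has weight $\rho(x,y)$ and the weight of a graph is the sum of the weights of its edges. Further, $\rho(\mathrm{SMT}_N)=\inf\rho(\mathrm{MST}_{\bar N})$, the infimum being over all finite subsets $\bar N\subset X$ with $\bar N\supset N$ (whether or not it is attained). The Steiner ratio of $(X,\rho)$ (a space with at least two points) is $m(X,\rho)=\inf_N \rho(\mathrm{SMT}_N)/\rho(\mathrm{MST}_N)$, the infimum being over all finite subsets $N\subset X$ with at least two points. For a connected Riemannian manifold, the distance generated by the Riemannian metric is $\rho(x,y)=\inf_\gamma \operatorname{len}(\gamma)$ over piecewise-smooth curves $\gamma$ joining $x$ and $y$. *)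

theory Defs
  imports "HOL-Analysis.Analysis"
begin

section \<open>Smooth maps\<close>

text \<open>\<open>Ck_on k S f\<close> is used only for sets \<open>S\<close> at all of whose points the derivative within
  \<open>S\<close> is unique: open sets, and relatively open subsets of nondegenerate intervals (where the
  derivatives at the endpoints are one-sided).\<close>

primrec Ck_on :: "nat \<Rightarrow> 'a::real_normed_vector set \<Rightarrow> ('a \<Rightarrow> 'b::real_normed_vector) \<Rightarrow> bool" where
  "Ck_on 0 S f \<longleftrightarrow> continuous_on S f"
| "Ck_on (Suc k) S f \<longleftrightarrow>
     f differentiable_on S \<and> (\<forall>v. Ck_on k S (\<lambda>x. frechet_derivative f (at x within S) v))"

definition smooth_on :: "'a::real_normed_vector set \<Rightarrow> ('a \<Rightarrow> 'b::real_normed_vector) \<Rightarrow> bool" where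
  "smooth_on S f \<longleftrightarrow> (\<forall>k. Ck_on k S f)"

section \<open>Smooth manifolds and Riemannian metrics\<close>

text \<open>A chart is a pair of its domain and its coordinate map; the values of the map outside the
  domain are irrelevant.\<close>

type_synonym ('a, 'n) chart = "'a set \<times> ('a \<Rightarrow> real^'n)"

definition chart_on :: "'a topology \<Rightarrow> ('a, 'n::finite) chart \<Rightarrow> bool" where
  "chart_on X = (\<lambda>(U, \<phi>). openin X U \<and> open (\<phi> ` U) \<and>
     homeomorphic_map (subtopology X U) (top_of_set (\<phi> ` U)) \<phi>)"

definition transition :: "('a, 'n::finite) chart \<Rightarrow> ('a, 'n) chart \<Rightarrow> real^'n \<Rightarrow> real^'n" where
  "transition c d = snd d \<circ> inv_into (fst c) (snd c)"

definition smooth_manifold :: "'a topology \<Rightarrow> ('a, 'n::finite) chart set \<Rightarrow> bool" where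
  "smooth_manifold X A \<longleftrightarrow>
     topspace X \<noteq> {} \<and> Hausdorff_space X \<and> second_countable X \<and>
     (\<forall>c\<in>A. chart_on X c) \<and> (\<Union>c\<in>A. fst c) = topspace X \<and>
     (\<forall>c\<in>A. \<forall>d\<in>A. smooth_on (snd c ` (fst c \<inter> fst d)) (transition c d))"

text \<open>A Riemannian metric is given by its component matrices: \<open>g c x\<close> is the matrix
  \<open>(g\<^sub>i\<^sub>j)\<close> in the chart \<open>c\<close> at the point with coordinates \<open>x\<close>. The last conjunct is the
  transformation law of a covariant 2-tensor.\<close>

type_synonym ('a, 'n) metric_components = "('a, 'n) chart \<Rightarrow> real^'n \<Rightarrow> real^'n^'n"

definition riemannian_metric :: "('a, 'n::finite) chart set \<Rightarrow> ('a, 'n) metric_components \<Rightarrow> bool" where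
  "riemannian_metric A g \<longleftrightarrow>
     (\<forall>c\<in>A. smooth_on (snd c ` fst c) (g c) \<and>
        (\<forall>x\<in>snd c ` fst c. transpose (g c x) = g c x \<and> (\<forall>v. v \<noteq> 0 \<longrightarrow> v \<bullet> (g c x *v v) > 0))) \<and>
     (\<forall>c\<in>A. \<forall>d\<in>A. \<forall>p\<in>fst c \<inter> fst d. \<forall>v w.
        (let J = frechet_derivative (transition c d) (at (snd c p))
         in v \<bullet> (g c (snd c p) *v w) = J v \<bullet> (g d (snd d p) *v J w)))"

section \<open>Gaussian curvature\<close>

definition partial_deriv :: "'n::finite \<Rightarrow> (real^'n \<Rightarrow> real) \<Rightarrow> real^'n \<Rightarrow> real" where
  "partial_deriv i f x = frechet_derivative f (at x) (axis i 1)"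

text \<open>\<open>christoffel G k i j\<close> is \<open>\<Gamma>\<^sup>k\<^sub>i\<^sub>j\<close>.\<close>

definition christoffel :: "(real^'n \<Rightarrow> real^'n^'n) \<Rightarrow> 'n \<Rightarrow> 'n \<Rightarrow> 'n::finite \<Rightarrow> real^'n \<Rightarrow> real" where
  "christoffel G k i j x = (1/2) * (\<Sum>l\<in>UNIV. matrix_inv (G x) $ k $ l *
     (partial_deriv i (\<lambda>y. G y $ j $ l) x + partial_deriv j (\<lambda>y. G y $ i $ l) x
      - partial_deriv l (\<lambda>y. G y $ i $ j) x))"

text \<open>\<open>riemann_tensor G l k i j\<close> is \<open>R\<^sup>l\<^sub>k\<^sub>i\<^sub>j\<close>, the \<open>l\<close>-th component of
  \<open>R(\<partial>\<^sub>i, \<partial>\<^sub>j) \<partial>\<^sub>k\<close>, where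
  \<open>R(U, V) W = \<nabla>\<^sub>U \<nabla>\<^sub>V W - \<nabla>\<^sub>V \<nabla>\<^sub>U W - \<nabla>\<^bsub>[U,V]\<^esub> W\<close>.\<close>

definition riemann_tensor ::
    "(real^'n \<Rightarrow> real^'n^'n) \<Rightarrow> 'n \<Rightarrow> 'n \<Rightarrow> 'n \<Rightarrow> 'n::finite \<Rightarrow> real^'n \<Rightarrow> real" where
  "riemann_tensor G l k i j x =
     partial_deriv i (christoffel G l j k) x - partial_deriv j (christoffel G l i k) x
     + (\<Sum>m\<in>UNIV. christoffel G l i m x * christoffel G m j k x
                   - christoffel G l j m x * christoffel G m i k x)"

text \<open>\<open>K = \<langle>R(\<partial>\<^sub>1, \<partial>\<^sub>2) \<partial>\<^sub>2, \<partial>\<^sub>1\<rangle> / det g\<close>, which is positive for round spheres.\<close>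

definition gaussian_curvature :: "(real^2 \<Rightarrow> real^2^2) \<Rightarrow> real^2 \<Rightarrow> real" where
  "gaussian_curvature G x = (\<Sum>l\<in>UNIV. G x $ 1 $ l * riemann_tensor G l 2 1 2 x) / det (G x)"

definition constant_curvature :: "('a, 2) chart set \<Rightarrow> ('a, 2) metric_components \<Rightarrow> real \<Rightarrow> bool" where
  "constant_curvature A g \<kappa> \<longleftrightarrow>
     (\<forall>c\<in>A. \<forall>x\<in>snd c ` fst c. gaussian_curvature (g c) x = \<kappa>)"

section \<open>The distance generated by a Riemannian metric\<close>

definition smooth_curve_on :: "('a, 'n::finite) chart set \<Rightarrow> real \<Rightarrow> real \<Rightarrow> (real \<Rightarrow> 'a) \<Rightarrow> bool" where
  "smooth_curve_on A a b \<gamma> \<longleftrightarrow> (\<forall>(U, \<phi>)\<in>A. smooth_on {t\<in>{a..b}. \<gamma> t \<in> U} (\<phi> \<circ> \<gamma>))"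

text \<open>Curves are parametrised by \<open>[0,1]\<close>.\<close>

definition piecewise_smooth_curve ::
    "'a topology \<Rightarrow> ('a, 'n::finite) chart set \<Rightarrow> (real \<Rightarrow> 'a) \<Rightarrow> bool" where
  "piecewise_smooth_curve X A \<gamma> \<longleftrightarrow> pathin X \<gamma> \<and>
     (\<exists>(n::nat) t. t 0 = 0 \<and> t n = 1 \<and>
        (\<forall>i<n. t i < t (Suc i) \<and> smooth_curve_on A (t i) (t (Suc i)) \<gamma>))"

text \<open>By the transformation law the speed does not depend on the chart. At 0, 1 and the finitely
  many break points of a piecewise smooth curve its value is unspecified; this does not affect
  the integral.\<close>

definition speed ::
    "('a, 'n::finite) chart set \<Rightarrow> ('a, 'n) metric_components \<Rightarrow> (real \<Rightarrow> 'a) \<Rightarrow> real \<Rightarrow> real" where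
  "speed A g \<gamma> t =
     (let c = (SOME c. c \<in> A \<and> \<gamma> t \<in> fst c); v = vector_derivative (snd c \<circ> \<gamma>) (at t)
      in sqrt (v \<bullet> (g c (snd c (\<gamma> t)) *v v)))"

definition curve_length ::
    "('a, 'n::finite) chart set \<Rightarrow> ('a, 'n) metric_components \<Rightarrow> (real \<Rightarrow> 'a) \<Rightarrow> real" where
  "curve_length A g \<gamma> = integral {0..1} (speed A g \<gamma>)"

definition riemannian_dist ::
    "'a topology \<Rightarrow> ('a, 'n::finite) chart set \<Rightarrow> ('a, 'n) metric_components \<Rightarrow> 'a \<Rightarrow> 'a \<Rightarrow> real" where
  "riemannian_dist X A g x y =
     Inf {curve_length A g \<gamma> |\<gamma>. piecewise_smooth_curve X A \<gamma> \<and> \<gamma> 0 = x \<and> \<gamma> 1 = y}"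

section \<open>Spanning trees and the Steiner ratio\<close>

text \<open>A simple graph on a given vertex set is identified with its set of edges, which are
  two-element sets of vertices.\<close>

definition complete_edges :: "'a set \<Rightarrow> 'a set set" where
  "complete_edges N = {{x, y} |x y. x \<in> N \<and> y \<in> N \<and> x \<noteq> y}"

definition graph_connected :: "'a set \<Rightarrow> 'a set set \<Rightarrow> bool" where
  "graph_connected N E \<longleftrightarrow> (\<forall>x\<in>N. \<forall>y\<in>N. (x, y) \<in> {(u, v). {u, v} \<in> E}\<^sup>*)"

definition graph_cycle :: "'a set set \<Rightarrow> 'a list \<Rightarrow> bool" where
  "graph_cycle E vs \<longleftrightarrow> 3 \<le> length vs \<and> distinct vs \<and>
     (\<forall>i<length vs. {vs ! i, vs ! (Suc i mod length vs)} \<in> E)"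

definition is_spanning_tree :: "'a set \<Rightarrow> 'a set set \<Rightarrow> bool" where
  "is_spanning_tree N E \<longleftrightarrow>
     E \<subseteq> complete_edges N \<and> graph_connected N E \<and> (\<nexists>vs. graph_cycle E vs)"

text \<open>Well defined because \<open>d\<close> is symmetric.\<close>

definition edge_weight :: "('a \<Rightarrow> 'a \<Rightarrow> real) \<Rightarrow> 'a set \<Rightarrow> real" where
  "edge_weight d e = (THE r. \<exists>x y. e = {x, y} \<and> r = d x y)"

definition mst_weight :: "('a \<Rightarrow> 'a \<Rightarrow> real) \<Rightarrow> 'a set \<Rightarrow> real" where
  "mst_weight d N = Min {\<Sum>e\<in>E. edge_weight d e |E. is_spanning_tree N E}"

definition smt_weight :: "'a set \<Rightarrow> ('a \<Rightarrow> 'a \<Rightarrow> real) \<Rightarrow> 'a set \<Rightarrow> real" where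
  "smt_weight M d N = Inf {mst_weight d N' |N'. finite N' \<and> N \<subseteq> N' \<and> N' \<subseteq> M}"

definition steiner_ratio :: "'a set \<Rightarrow> ('a \<Rightarrow> 'a \<Rightarrow> real) \<Rightarrow> real" where
  "steiner_ratio M d =
     Inf {smt_weight M d N / mst_weight d N |N. finite N \<and> N \<subseteq> M \<and> 2 \<le> card N}"

end

theory Submission
  imports Defs "HOL-Library.Landau_Symbols"
begin

text \<open>In the hyperbolic plane an equilateral triangle with circumradius \<open>r\<close> has sides
  \<open>\<surd>3 r (1 + r\<^sup>2 / 24 + o(r\<^sup>2))\<close>, so joining the vertices to the centre gives a Steiner tree that
  beats the Euclidean ratio \<open>\<surd>3 / 2\<close>. To see this on the surface it suffices to know the metric up
  to second order at one point: a cubic change of coordinates brings it into the form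
  \<open>dx\<^sup>2 + dy\<^sup>2 + (x dy - y dx)\<^sup>2 / 3 + o(x\<^sup>2 + y\<^sup>2)\<close>, where the coefficient \<open>1 / 3\<close> comes from the
  curvature \<open>-1\<close>. Radial segments bound the distance from the centre to the vertices from above.
  The distance between two vertices is bounded from below by a calibration: in the frame of a side
  the function \<open>x + x y\<^sup>2 / 6\<close> has gradient of norm at most \<open>1 + o(r\<^sup>2)\<close>, and its values at the two
  vertices differ by \<open>\<surd>3 r (1 + r\<^sup>2 / 24)\<close>.\<close>

section \<open>Speed of piecewise smooth curves\<close>

text \<open>The gain over the Euclidean ratio is only of relative order \<open>r^2\<close>, so every
  error has to be made small against \<open>r^2\<close>; this is what fixes second order as the
  precision for the metric. The Steiner ratio is an infimum, so a single triangle of fixed size,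
  chosen small enough for the given surface, already yields the strict inequality. The real obstacle
  is the lower bound for the sides: completeness is not assumed, so shortest curves need not exist,
  and a competing curve may wander anywhere on the surface. Hence an arbitrary piecewise smooth
  curve is treated directly, by integrating the differential of a function along it, and it is
  followed only until it first leaves a compact coordinate ball. Neither an exponential map nor a
  local isometry with the hyperbolic plane is constructed; an explicit cubic polynomial map takes
  their place. The coefficient 1/3 is \<open>-K / 3\<close> for curvature \<open>K = -1\<close>, as
  in the expansion of \<open>dr^2 + sinh(r)^2 dt^2\<close> in polar coordinates.\<close>

lemma smooth_on_differentiable_on: "smooth_on S f \<Longrightarrow> f differentiable_on S"
  unfolding smooth_on_def using Ck_on.simps(2)[of 0 S f] by simp

lemma chart_onD:
  assumes "chart_on X c"
  shows chart_openin: "openin X (fst c)"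
    and chart_open_image: "open (snd c ` fst c)"
    and chart_inj: "inj_on (snd c) (fst c)"
    and chart_continuous: "continuous_map (subtopology X (fst c)) euclidean (snd c)"
    and chart_homeo: "homeomorphic_map (subtopology X (fst c)) (top_of_set (snd c ` fst c)) (snd c)"
proof -
  have o: "openin X (fst c)" and i: "open (snd c ` fst c)"
    and h: "homeomorphic_map (subtopology X (fst c)) (top_of_set (snd c ` fst c)) (snd c)"
    using assms unfolding chart_on_def by (auto split: prod.splits)
  have tp: "topspace (subtopology X (fst c)) = fst c"
    using openin_subset[OF o] by auto
  show "openin X (fst c)" "open (snd c ` fst c)"
    "homeomorphic_map (subtopology X (fst c)) (top_of_set (snd c ` fst c)) (snd c)" by fact+
  show "inj_on (snd c) (fst c)"
    using homeomorphic_imp_injective_map[OF h] tp by simp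
  show "continuous_map (subtopology X (fst c)) euclidean (snd c)"
    using homeomorphic_imp_continuous_map[OF h] continuous_map_in_subtopology by blast
qed

lemma chart_open_subimage:
  assumes c: "chart_on X c" and V: "openin X V"
  shows "open (snd c ` (fst c \<inter> V))"
proof -
  have "openin (subtopology X (fst c)) (fst c \<inter> V)"
    using V by (auto simp: openin_subtopology_Int2)
  then have "openin (top_of_set (snd c ` fst c)) (snd c ` (fst c \<inter> V))"
    using homeomorphic_imp_open_map[OF chart_homeo[OF c]] unfolding open_map_def by blast
  then show ?thesis
    using chart_open_image[OF c] openin_open_trans by blast
qed

lemma chart_inv_continuous:
  assumes c: "chart_on X c"
  shows "continuous_map (top_of_set (snd c ` fst c)) X (inv_into (fst c) (snd c))"
proof -
  obtain h where h: "homeomorphic_maps (subtopology X (fst c)) (top_of_set (snd c ` fst c)) (snd c) h"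
    using chart_homeo[OF c] homeomorphic_map_maps by blast
  have tp: "topspace (subtopology X (fst c)) = fst c"
    using openin_subset[OF chart_openin[OF c]] by auto
  have ch: "continuous_map (top_of_set (snd c ` fst c)) X h"
    using h unfolding homeomorphic_maps_def continuous_map_in_subtopology by blast
  have "h y = inv_into (fst c) (snd c) y" if "y \<in> snd c ` fst c" for y
    using h that tp chart_inj[OF c] unfolding homeomorphic_maps_def by (auto simp: inv_into_f_f)
  then show ?thesis
    using continuous_map_eq[OF ch] by simp
qed

text \<open>Coordinate expressions of a curve are differentiated within the times spent in a chart,
  speeds within a whole parameter interval. These times form a relatively open set, so the two
  notions agree.\<close>

lemma at_within_openin:
  fixes t :: real
  assumes "openin (top_of_set T) S" "t \<in> S"
  shows "at t within S = at t within T"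
proof -
  obtain U where "open U" "S = T \<inter> U"
    using assms(1) by (auto simp: openin_open)
  then show ?thesis
    using assms(2) by (intro at_within_nhd[of t U]) auto
qed

lemma partition_cover:
  fixes t :: "nat \<Rightarrow> real"
  assumes "\<forall>i<n. t i < t (Suc i)" "s \<in> {t 0..t n}" "s \<notin> t ` {..n}"
  shows "\<exists>i<n. s \<in> {t i<..<t (Suc i)}"
  using assms
proof (induction n)
  case (Suc n)
  show ?case
  proof (cases "s \<le> t n")
    case True
    then have "\<exists>i<n. s \<in> {t i<..<t (Suc i)}"
      using Suc.prems by (intro Suc.IH) auto
    then show ?thesis using less_SucI by blast
  next
    case False
    moreover have "s \<noteq> t (Suc n)" using Suc.prems(3) by auto
    ultimately show ?thesis using Suc.prems by (intro exI[of _ n]) auto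
  qed
qed auto

lemma partition_mono:
  fixes t :: "nat \<Rightarrow> real"
  assumes "\<forall>i<n. t i < t (Suc i)" "i \<le> j" "j \<le> n"
  shows "t i \<le> t j"
  using assms(2,3)
proof (induction j rule: dec_induct)
  case (step m)
  then show ?case using assms(1) by (smt (verit) Suc_le_eq less_or_eq_imp_le)
qed auto

locale riemannian =
  fixes X :: "'a topology" and A :: "('a, 'n::finite) chart set" and g :: "('a, 'n) metric_components"
  assumes manifold: "smooth_manifold X A" and metric: "riemannian_metric A g"
begin

text \<open>The length of the tangent vector at \<open>p\<close> with coordinates \<open>v\<close>
  in \<open>c\<close>. By \<open>metric_norm_transition\<close> it does not depend on the chart,
  which neutralises the \<open>SOME\<close> in \<open>speed\<close>.\<close>

definition metric_norm :: "('a, 'n) chart \<Rightarrow> 'a \<Rightarrow> real^'n \<Rightarrow> real"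
  where "metric_norm c p v = sqrt (v \<bullet> (g c (snd c p) *v v))"

lemma manifoldD:
  shows "Hausdorff_space X" "topspace X \<noteq> {}" "\<forall>c\<in>A. chart_on X c" "(\<Union>c\<in>A. fst c) = topspace X"
  using manifold unfolding smooth_manifold_def by simp_all

lemma chart: "c \<in> A \<Longrightarrow> chart_on X c"
  using manifoldD(3) by (rule bspec)

lemma chart_ex: "p \<in> topspace X \<Longrightarrow> \<exists>c\<in>A. p \<in> fst c"
  unfolding manifoldD(4)[symmetric] by simp

lemma chart_subset: "c \<in> A \<Longrightarrow> fst c \<subseteq> topspace X"
  by (rule openin_subset[OF chart_openin[OF chart]])

lemma transition_differentiable:
  assumes "c \<in> A" "d \<in> A" "p \<in> fst c \<inter> fst d"
  shows "(transition c d has_derivative frechet_derivative (transition c d) (at (snd c p))) (at (snd c p))"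
proof -
  let ?W = "snd c ` (fst c \<inter> fst d)"
  have o: "open ?W"
    using chart_open_subimage chart assms chart_openin by blast
  have "transition c d differentiable_on ?W"
    using manifold assms smooth_on_differentiable_on unfolding smooth_manifold_def by blast
  then have "transition c d differentiable at (snd c p)"
    using o assms(3) unfolding differentiable_on_eq_differentiable_at[OF o] by blast
  then show ?thesis
    using frechet_derivative_works by blast
qed

lemma transition_apply:
  "c \<in> A \<Longrightarrow> p \<in> fst c \<Longrightarrow> transition c d (snd c p) = snd d p"
  unfolding transition_def using chart_inj[OF chart] by (simp add: inv_into_f_f)

lemma metric_norm_transition:
  assumes "c \<in> A" "d \<in> A" "p \<in> fst c \<inter> fst d"
  shows "metric_norm d p (frechet_derivative (transition c d) (at (snd c p)) v) = metric_norm c p v"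
proof -
  have "v \<bullet> (g c (snd c p) *v v) =
      frechet_derivative (transition c d) (at (snd c p)) v \<bullet>
      (g d (snd d p) *v frechet_derivative (transition c d) (at (snd c p)) v)"
    using metric assms unfolding riemannian_metric_def Let_def by blast
  then show ?thesis
    unfolding metric_norm_def by (rule arg_cong[OF sym])
qed

lemma metric_norm_nonneg: "c \<in> A \<Longrightarrow> p \<in> fst c \<Longrightarrow> 0 \<le> metric_norm c p v"
proof -
  assume "c \<in> A" "p \<in> fst c"
  then have "v \<noteq> 0 \<longrightarrow> 0 < v \<bullet> (g c (snd c p) *v v)"
    using metric unfolding riemannian_metric_def by blast
  then show ?thesis
    unfolding metric_norm_def by (cases "v = 0") auto
qed

text \<open>\<open>X\<close> is only a topology, so continuity of a path is first turned into an
  epsilon statement about the parameter; derivatives in two charts can then be compared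
  locally.\<close>

lemma curve_near:
  assumes p: "pathin X \<gamma>" and t: "t \<in> {0..1}" and U: "openin X U" "\<gamma> t \<in> U"
  obtains e where "e > 0" "\<And>s. s \<in> {0..1} \<Longrightarrow> dist s t < e \<Longrightarrow> \<gamma> s \<in> U"
proof -
  have "openin (top_of_set {0..1}) {s \<in> topspace (top_of_set {0..1}). \<gamma> s \<in> U}"
    using p U(1) openin_continuous_map_preimage unfolding pathin_def by blast
  then show ?thesis
    using t U(2) that unfolding openin_euclidean_subtopology_iff by auto
qed

text \<open>The chain rule. The transition map relates the two coordinate expressions only while the
  curve stays in \<open>fst c\<close>, hence \<open>curve_near\<close>.\<close>

lemma deriv_transition:
  assumes p: "pathin X \<gamma>" and cd: "c \<in> A" "d \<in> A" "\<gamma> t \<in> fst c \<inter> fst d"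
    and T: "T \<subseteq> {0..1}" "t \<in> T"
    and v: "(snd c \<circ> \<gamma> has_vector_derivative v) (at t within T)"
  shows "(snd d \<circ> \<gamma> has_vector_derivative
      frechet_derivative (transition c d) (at (snd c (\<gamma> t))) v) (at t within T)"
proof -
  obtain e where e: "e > 0" "\<And>s. s \<in> {0..1} \<Longrightarrow> dist s t < e \<Longrightarrow> \<gamma> s \<in> fst c"
    using curve_near[OF p _ chart_openin[OF chart[OF cd(1)]]] T cd(3) by blast
  have "(transition c d \<circ> (snd c \<circ> \<gamma>) has_vector_derivative
      frechet_derivative (transition c d) (at (snd c (\<gamma> t))) v) (at t within T)"
    by (rule vector_derivative_diff_chain_within[OF v])
      (use transition_differentiable[OF cd] has_derivative_at_withinI in auto)
  then show ?thesis
    by (rule has_vector_derivative_transform_within[OF _ e(1) T(2)])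
      (use e(2) T transition_apply[OF cd(1), of _ d] in auto)
qed

text \<open>Translates the Frechet derivatives of \<open>smooth_on\<close> into vector derivatives
  within \<open>{a..b}\<close>. Being one-sided at \<open>a\<close> and \<open>b\<close>, they are
  continuous up to the end points, which gives integrability of the speed.\<close>

lemma smooth_curve_deriv:
  assumes p: "pathin X \<gamma>" and ab: "a < b" "{a..b} \<subseteq> {0..1}"
    and s: "smooth_curve_on A a b \<gamma>" and c: "c \<in> A"
  defines "S \<equiv> {t\<in>{a..b}. \<gamma> t \<in> fst c}"
  shows "t \<in> S \<Longrightarrow> (snd c \<circ> \<gamma> has_vector_derivative
      vector_derivative (snd c \<circ> \<gamma>) (at t within {a..b})) (at t within {a..b})"
    and "continuous_on S (\<lambda>t. vector_derivative (snd c \<circ> \<gamma>) (at t within {a..b}))"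
    and "continuous_on S (snd c \<circ> \<gamma>)"
    and "openin (top_of_set {a..b}) S"
proof -
  let ?f = "snd c \<circ> \<gamma>"
  have sm: "smooth_on S ?f"
    using s c unfolding smooth_curve_on_def S_def by (cases c) fastforce
  have near: "\<exists>e>0. \<forall>s\<in>{a..b}. dist s t < e \<longrightarrow> s \<in> S" if "t \<in> S" for t
    using curve_near[OF p _ chart_openin[OF chart[OF c]], of t] that ab unfolding S_def
    by (smt (verit) mem_Collect_eq subsetD)
  show oS: "openin (top_of_set {a..b}) S"
    unfolding openin_euclidean_subtopology_iff using near by (auto simp: S_def)
  have atS: "at t within S = at t within {a..b}" if "t \<in> S" for t
    using at_within_openin[OF oS that] .
  have nb: "at t within {a..b} \<noteq> bot" if "t \<in> S" for t
    using that ab unfolding S_def by (simp add: trivial_limit_within islimpt_Icc)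
  have ck: "Ck_on (Suc 0) S ?f"
    using sm unfolding smooth_on_def by blast
  then have diff: "?f differentiable_on S"
    by simp
  then show "continuous_on S ?f"
    by (rule differentiable_imp_continuous_on)
  have hd: "(?f has_vector_derivative frechet_derivative ?f (at t within S) 1) (at t within {a..b})"
    if t: "t \<in> S" for t
  proof -
    have "(?f has_derivative frechet_derivative ?f (at t within S)) (at t within {a..b})"
      using diff t atS[OF t] unfolding differentiable_on_def frechet_derivative_works by metis
    moreover from this have "frechet_derivative ?f (at t within S) x = x *\<^sub>R frechet_derivative ?f (at t within S) 1" for x
      using linear_scale[OF has_derivative_linear[where f' = "frechet_derivative ?f (at t within S)"], of _ _ x 1]
      by (simp del: o_apply)
    ultimately show ?thesis
      unfolding has_vector_derivative_def by (metis (no_types) ext)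
  qed
  have vd: "vector_derivative ?f (at t within {a..b}) = frechet_derivative ?f (at t within S) 1"
    if "t \<in> S" for t
    using vector_derivative_within[OF nb[OF that] hd[OF that]] .
  show "t \<in> S \<Longrightarrow> (?f has_vector_derivative
      vector_derivative ?f (at t within {a..b})) (at t within {a..b})"
    using hd vd by simp
  have "continuous_on S (\<lambda>t. frechet_derivative ?f (at t within S) 1)"
    using ck by simp
  then show "continuous_on S (\<lambda>t. vector_derivative ?f (at t within {a..b}))"
    using vd continuous_on_cong by (metis (mono_tags, lifting))
qed

lemma metric_continuous: "c \<in> A \<Longrightarrow> continuous_on (snd c ` fst c) (g c)"
  using metric differentiable_imp_continuous_on[OF smooth_on_differentiable_on]
  unfolding riemannian_metric_def by blast

text \<open>The chart chosen in \<open>speed\<close> may jump from one \<open>t\<close> to the next.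
  The variant \<open>h\<close> with derivatives within \<open>{a..b}\<close> can be computed in any
  chart (\<open>heq\<close>), so near each \<open>t\<close> a single chart shows its continuity;
  inside the interval \<open>speed\<close> equals \<open>h\<close>.\<close>

lemma speed_piece:
  assumes p: "pathin X \<gamma>" and ab: "a < b" "{a..b} \<subseteq> {0..1}"
    and s: "smooth_curve_on A a b \<gamma>"
  shows "speed A g \<gamma> integrable_on {a..b}"
    and "\<And>t c. t \<in> {a<..<b} \<Longrightarrow> c \<in> A \<Longrightarrow> \<gamma> t \<in> fst c \<Longrightarrow>
      \<exists>v. (snd c \<circ> \<gamma> has_vector_derivative v) (at t) \<and> speed A g \<gamma> t = metric_norm c (\<gamma> t) v"
proof -
  define ch where "ch t = (SOME c. c \<in> A \<and> \<gamma> t \<in> fst c)" for t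
  define h where "h t = metric_norm (ch t) (\<gamma> t) (vector_derivative (snd (ch t) \<circ> \<gamma>) (at t within {a..b}))" for t
  have ch: "ch t \<in> A" "\<gamma> t \<in> fst (ch t)" if "t \<in> {a..b}" for t
  proof -
    have "\<gamma> t \<in> topspace X"
      using p that ab path_start_in_topspace unfolding pathin_def
      by (metis Pi_iff continuous_map_funspace subsetD topspace_euclidean_subtopology)
    then have "\<exists>c. c \<in> A \<and> \<gamma> t \<in> fst c"
      using chart_ex by blast
    from someI_ex[OF this] show "ch t \<in> A" "\<gamma> t \<in> fst (ch t)"
      unfolding ch_def by auto
  qed
  have heq: "h t = metric_norm c (\<gamma> t) (vector_derivative (snd c \<circ> \<gamma>) (at t within {a..b}))"
    if t: "t \<in> {a..b}" and c: "c \<in> A" "\<gamma> t \<in> fst c" for t c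
  proof -
    let ?v = "vector_derivative (snd c \<circ> \<gamma>) (at t within {a..b})"
    have "(snd c \<circ> \<gamma> has_vector_derivative ?v) (at t within {a..b})"
      using smooth_curve_deriv(1)[OF p ab s c(1)] t c by blast
    from deriv_transition[OF p c(1) ch(1)[OF t] _ ab(2) t this]
    have "(snd (ch t) \<circ> \<gamma> has_vector_derivative
        frechet_derivative (transition c (ch t)) (at (snd c (\<gamma> t))) ?v) (at t within {a..b})"
      using c ch[OF t] by blast
    moreover have "at t within {a..b} \<noteq> bot"
      using t ab by (simp add: trivial_limit_within islimpt_Icc)
    ultimately have "vector_derivative (snd (ch t) \<circ> \<gamma>) (at t within {a..b}) =
        frechet_derivative (transition c (ch t)) (at (snd c (\<gamma> t))) ?v"
      using vector_derivative_within by blast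
    then show ?thesis
      unfolding h_def using metric_norm_transition[OF c(1) ch(1)[OF t]] c ch[OF t] by simp
  qed
  have "continuous_on {a..b} h"
    unfolding continuous_on_eq_continuous_within
  proof
    fix t assume t: "t \<in> {a..b}"
    define c where "c = ch t"
    have c: "c \<in> A" "\<gamma> t \<in> fst c" using ch[OF t] unfolding c_def by auto
    let ?S = "{t\<in>{a..b}. \<gamma> t \<in> fst c}"
    note D = smooth_curve_deriv[OF p ab s c(1)]
    have "continuous_on ?S (\<lambda>t. g c (snd c (\<gamma> t)))"
      using continuous_on_compose2[OF metric_continuous[OF c(1)] D(3)] by (auto simp: o_def)
    then have "continuous_on ?S (\<lambda>t. metric_norm c (\<gamma> t) (vector_derivative (snd c \<circ> \<gamma>) (at t within {a..b})))"
      unfolding metric_norm_def matrix_vector_mult_def using D(2)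
      by (intro continuous_intros) (auto simp: o_def)
    then have "continuous_on ?S h"
      using heq c by (metis (mono_tags, lifting) continuous_on_cong mem_Collect_eq)
    then have "continuous (at t within ?S) h"
      using t c continuous_on_eq_continuous_within by blast
    moreover have "at t within ?S = at t within {a..b}"
      using D(4) t c by (metis (no_types, lifting) at_within_openin mem_Collect_eq)
    ultimately show "continuous (at t within {a..b}) h"
      by simp
  qed
  then have hi: "h integrable_on {a..b}"
    by (rule integrable_continuous_real)
  have at: "at t within {a..b} = at t" if "t \<in> {a<..<b}" for t
    using that at_within_Icc_at by auto
  have sp: "speed A g \<gamma> t = h t" if t: "t \<in> {a<..<b}" for t
    unfolding speed_def h_def metric_norm_def Let_def ch_def[symmetric] at[OF t] ..
  show "speed A g \<gamma> integrable_on {a..b}"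
    by (rule integrable_spike_finite[OF _ _ hi, of "{a,b}"]) (use sp in auto)
  show "\<exists>v. (snd c \<circ> \<gamma> has_vector_derivative v) (at t) \<and> speed A g \<gamma> t = metric_norm c (\<gamma> t) v"
    if t: "t \<in> {a<..<b}" and c: "c \<in> A" "\<gamma> t \<in> fst c" for t c
  proof (intro exI conjI)
    have t': "t \<in> {a..b}" using t by simp
    show "(snd c \<circ> \<gamma> has_vector_derivative vector_derivative (snd c \<circ> \<gamma>) (at t)) (at t)"
      using smooth_curve_deriv(1)[OF p ab s c(1), of t] t' c(2) at[OF t] by simp
    show "speed A g \<gamma> t = metric_norm c (\<gamma> t) (vector_derivative (snd c \<circ> \<gamma>) (at t))"
      using heq[OF t' c] sp[OF t] at[OF t] by simp
  qed
qed

lemma speed_piecewise: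
  assumes "piecewise_smooth_curve X A \<gamma>"
  shows "speed A g \<gamma> integrable_on {0..1}"
    and "\<exists>B. finite B \<and> {0,1} \<subseteq> B \<and> (\<forall>t\<in>{0..1} - B. \<forall>c\<in>A. \<gamma> t \<in> fst c \<longrightarrow>
      (\<exists>v. (snd c \<circ> \<gamma> has_vector_derivative v) (at t) \<and> speed A g \<gamma> t = metric_norm c (\<gamma> t) v))"
proof -
  obtain n t where p: "pathin X \<gamma>" and t: "t 0 = (0::real)" "t n = 1"
    "\<forall>i<n. t i < t (Suc i)" and s: "\<And>i. i < n \<Longrightarrow> smooth_curve_on A (t i) (t (Suc i)) \<gamma>"
    using assms unfolding piecewise_smooth_curve_def by blast
  have sub: "{t i..t (Suc i)} \<subseteq> {0..1}" if "i < n" for i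
    using partition_mono[OF t(3), of 0 i] partition_mono[OF t(3), of "Suc i" n] that t by auto
  have "m \<le> n \<Longrightarrow> speed A g \<gamma> integrable_on {0..t m}" for m
  proof (induction m)
    case 0
    then show ?case using integrable_on_refl[of "speed A g \<gamma>" "0::real"] t(1) by simp
  next
    case (Suc m)
    then have "speed A g \<gamma> integrable_on {t m..t (Suc m)}"
      using speed_piece(1)[OF p _ sub s, of m] t(3) by auto
    then show ?case
      using Suc partition_mono[OF t(3), of 0 m] t(1,3)
      by (intro Henstock_Kurzweil_Integration.integrable_combine[of 0 "t m" "t (Suc m)"]) (simp_all add: less_imp_le)
  qed
  from this[OF le_refl] show "speed A g \<gamma> integrable_on {0..1}"
    using t(2) by simp
  have "\<exists>v. (snd c \<circ> \<gamma> has_vector_derivative v) (at u) \<and> speed A g \<gamma> u = metric_norm c (\<gamma> u) v"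
    if u: "u \<in> {0..1} - t ` {..n}" and c: "c \<in> A" "\<gamma> u \<in> fst c" for u c
  proof -
    obtain i where i: "i < n" "u \<in> {t i<..<t (Suc i)}"
      using partition_cover[OF t(3), of u] u t(1,2) by (auto simp del: greaterThanLessThan_iff)
    show ?thesis
      using speed_piece(2)[OF p _ sub[OF i(1)] s[OF i(1)] i(2) c] i(1) t(3) by blast
  qed
  moreover have "{0,1} \<subseteq> t ` {..n}"
    using t(1,2) imageI[of 0 "{..n}" t] imageI[of n "{..n}" t] by simp
  ultimately show "\<exists>B. finite B \<and> {0,1} \<subseteq> B \<and> (\<forall>t\<in>{0..1} - B. \<forall>c\<in>A. \<gamma> t \<in> fst c \<longrightarrow>
      (\<exists>v. (snd c \<circ> \<gamma> has_vector_derivative v) (at t) \<and> speed A g \<gamma> t = metric_norm c (\<gamma> t) v))"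
    by (intro exI[of _ "t ` {..n}"]) auto
qed

end

section \<open>Smooth maps on intervals and reparametrization\<close>

text \<open>The points at which derivatives within \<open>S\<close> are unique. \<open>Ck_on\<close>
  iterates \<open>frechet_derivative\<close>, a choice operator, so the calculus below rests on this
  choice being forced.\<close>

definition no_isolated :: "real set \<Rightarrow> bool"
  where "no_isolated S \<longleftrightarrow> (\<forall>x\<in>S. at x within S \<noteq> bot)"

text \<open>A linear map on the reals is determined by its value at 1, which reduces the claim to
  uniqueness of vector derivatives.\<close>

lemma frechet_derivative_within_eq:
  fixes f :: "real \<Rightarrow> 'b::real_normed_vector"
  assumes "no_isolated S" "x \<in> S" and f: "(f has_derivative f') (at x within S)"
  shows "frechet_derivative f (at x within S) = f'"
proof -
  let ?F = "frechet_derivative f (at x within S)"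
  have F: "(f has_derivative ?F) (at x within S)"
    using f frechet_derivative_works differentiableI by blast
  have lin: "h v = v *\<^sub>R h 1" if "(f has_derivative h) (at x within S)" for h :: "real \<Rightarrow> 'b" and v
    using linear_scale[OF has_derivative_linear[OF that], of v 1] by simp
  have "?F 1 = f' 1"
  proof (rule vector_derivative_unique_within)
    show "at x within S \<noteq> bot" using assms unfolding no_isolated_def by blast
    have "?F = (\<lambda>v. v *\<^sub>R ?F 1)" "f' = (\<lambda>v. v *\<^sub>R f' 1)"
      by (rule ext, rule lin[OF F]) (rule ext, rule lin[OF f])
    then show "(f has_vector_derivative ?F 1) (at x within S)" "(f has_vector_derivative f' 1) (at x within S)"
      unfolding has_vector_derivative_def using F f by (metis, metis)
  qed
  then show ?thesis
    by (intro ext) (metis lin[OF F] lin[OF f])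
qed

lemma Ck_on_cong:
  assumes "\<And>x. x \<in> S \<Longrightarrow> f x = h x"
  shows "Ck_on k S f \<longleftrightarrow> Ck_on k S h"
  using assms
proof (induction k arbitrary: f h)
  case 0
  then show ?case using continuous_on_cong[of S S f h] by simp
next
  case (Suc k)
  have "(f has_derivative f') (at x within S) \<longleftrightarrow> (h has_derivative f') (at x within S)" if "x \<in> S" for x f'
    using that Suc.prems by (metis has_derivative_transform)
  then have "f differentiable_on S \<longleftrightarrow> h differentiable_on S"
      "\<And>x. x \<in> S \<Longrightarrow> frechet_derivative f (at x within S) = frechet_derivative h (at x within S)"
    unfolding differentiable_on_def differentiable_def frechet_derivative_def by simp_all
  moreover from this(2) have "Ck_on k S (\<lambda>x. frechet_derivative f (at x within S) v) \<longleftrightarrow>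
      Ck_on k S (\<lambda>x. frechet_derivative h (at x within S) v)" for v
    by (intro Suc.IH) (rule fun_cong)
  ultimately show ?case
    unfolding Ck_on.simps by (simp only:)
qed

lemma Ck_on_mono: "Ck_on (Suc k) S f \<Longrightarrow> Ck_on k S f"
proof (induction k arbitrary: f)
  case 0
  then show ?case by (simp add: differentiable_imp_continuous_on)
next
  case (Suc k)
  then show ?case by simp
qed

lemma Ck_on_frechet: "Ck_on (Suc k) S f \<Longrightarrow> x \<in> S \<Longrightarrow>
    (f has_derivative frechet_derivative f (at x within S)) (at x within S)"
  unfolding Ck_on.simps differentiable_on_def using frechet_derivative_works by blast

text \<open>Replaces the chosen derivative by an explicit one; the closure rules below are
  inductions through this rule.\<close>

lemma Ck_on_SucI:
  fixes f :: "real \<Rightarrow> 'b::real_normed_vector"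
  assumes "no_isolated S" "\<And>x. x \<in> S \<Longrightarrow> (f has_derivative f' x) (at x within S)"
    and "\<And>v. Ck_on k S (\<lambda>x. f' x v)"
  shows "Ck_on (Suc k) S f"
proof -
  have "frechet_derivative f (at x within S) v = f' x v" if "x \<in> S" for x v
    using frechet_derivative_within_eq[OF assms(1) that assms(2)[OF that]] by simp
  then have "Ck_on k S (\<lambda>x. frechet_derivative f (at x within S) v)" for v
    using assms(3)[of v] Ck_on_cong[of S "\<lambda>x. frechet_derivative f (at x within S) v" "\<lambda>x. f' x v" k] by simp
  then show ?thesis
    using assms(2) by (auto simp: differentiable_on_def differentiable_def)
qed

lemma Ck_on_const:
  assumes "no_isolated S"
  shows "Ck_on k S (\<lambda>x. c)"
proof (induction k arbitrary: c)
  case (Suc k)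
  then show ?case
    by (intro Ck_on_SucI[OF assms has_derivative_const])
qed (simp add: continuous_on_const)

lemma Ck_on_add:
  fixes f h :: "real \<Rightarrow> 'b::real_normed_vector"
  assumes "no_isolated S" "Ck_on k S f" "Ck_on k S h"
  shows "Ck_on k S (\<lambda>x. f x + h x)"
  using assms(2,3)
proof (induction k arbitrary: f h)
  case (Suc k)
  show ?case
    by (rule Ck_on_SucI[OF assms(1) has_derivative_add[OF Ck_on_frechet[OF Suc.prems(1)] Ck_on_frechet[OF Suc.prems(2)]]])
      (use Suc in auto)
qed (auto intro: continuous_intros)

lemma Ck_on_sum:
  fixes f :: "'i \<Rightarrow> real \<Rightarrow> 'b::real_normed_vector"
  assumes "no_isolated S" "\<And>i. i \<in> I \<Longrightarrow> Ck_on k S (f i)"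
  shows "Ck_on k S (\<lambda>x. \<Sum>i\<in>I. f i x)"
  using assms(2)
  by (induction I rule: infinite_finite_induct) (auto intro: Ck_on_add[OF assms(1)] Ck_on_const[OF assms(1)])

lemma Ck_on_scaleR:
  fixes f :: "real \<Rightarrow> real" and h :: "real \<Rightarrow> 'b::real_normed_vector"
  assumes "no_isolated S" "Ck_on k S f" "Ck_on k S h"
  shows "Ck_on k S (\<lambda>x. f x *\<^sub>R h x)"
  using assms(2,3)
proof (induction k arbitrary: f h)
  case (Suc k)
  show ?case
    by (rule Ck_on_SucI[OF assms(1) has_derivative_scaleR[OF Ck_on_frechet[OF Suc.prems(1)] Ck_on_frechet[OF Suc.prems(2)]]])
      (use Suc Ck_on_mono[OF Suc.prems(1)] Ck_on_mono[OF Suc.prems(2)] in \<open>auto intro!: Ck_on_add[OF assms(1)]\<close>)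
qed (auto intro: continuous_intros)

lemma Ck_on_linear:
  fixes f :: "real \<Rightarrow> 'b::real_normed_vector"
  assumes "no_isolated S" "bounded_linear L" "Ck_on k S f"
  shows "Ck_on k S (\<lambda>x. L (f x))"
  using assms(3)
proof (induction k arbitrary: f)
  case 0
  then show ?case using assms(2) by (simp add: bounded_linear.continuous_on)
next
  case (Suc k)
  show ?case
    by (rule Ck_on_SucI[OF assms(1) bounded_linear.has_derivative[OF assms(2) Ck_on_frechet[OF Suc.prems]]])
      (use Suc in auto)
qed

lemma Ck_on_ident: "no_isolated S \<Longrightarrow> Ck_on k S (\<lambda>x. x)"
proof (cases k)
  case (Suc m)
  assume S: "no_isolated S"
  then show ?thesis unfolding Suc
    by (rule Ck_on_SucI[OF _ has_derivative_ident]) (rule Ck_on_const[OF S])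
qed (simp add: continuous_on_id)

text \<open>\<open>Ck_on\<close> controls the derivative of \<open>f\<close> in fixed directions
  only, whereas the chain rule applies it to the moving vector \<open>?D x v\<close>. Expanding that
  vector in a basis leaves products of scalar functions with derivatives in fixed
  directions.\<close>

lemma Ck_on_compose:
  fixes \<sigma> :: "real \<Rightarrow> 'c::euclidean_space" and f :: "'c \<Rightarrow> 'b::real_normed_vector"
  assumes S: "no_isolated S" and "Ck_on k T f" "Ck_on k S \<sigma>" and sub: "\<sigma> ` S \<subseteq> T"
  shows "Ck_on k S (\<lambda>x. f (\<sigma> x))"
  using assms(2,3)
proof (induction k arbitrary: f)
  case 0
  then show ?case using sub continuous_on_compose2 by (metis Ck_on.simps(1))
next
  case (Suc k)
  let ?F = "\<lambda>x. frechet_derivative f (at (\<sigma> x) within T)" and ?D = "\<lambda>x. frechet_derivative \<sigma> (at x within S)"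
  have F: "(f has_derivative ?F x) (at (\<sigma> x) within T)" if "x \<in> S" for x
    using Ck_on_frechet[OF Suc.prems(1)] that sub by blast
  show ?case
  proof (rule Ck_on_SucI[OF S])
    show "((\<lambda>x. f (\<sigma> x)) has_derivative (\<lambda>v. ?F x (?D x v))) (at x within S)" if "x \<in> S" for x
      using has_derivative_in_compose2[of T f "\<lambda>y. frechet_derivative f (at y within T)" \<sigma> S x "?D x"]
        Ck_on_frechet[OF Suc.prems(1)] Ck_on_frechet[OF Suc.prems(2) that] sub that by blast
    have "?F x (?D x v) = (\<Sum>b\<in>Basis. (?D x v \<bullet> b) *\<^sub>R ?F x b)" if "x \<in> S" for x v
    proof -
      have "?F x (?D x v) = ?F x (\<Sum>b\<in>Basis. (?D x v \<bullet> b) *\<^sub>R b)"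
        by (simp add: euclidean_representation)
      then show ?thesis
        using has_derivative_linear[OF F[OF that]] by (simp add: linear_sum linear_cmul)
    qed
    moreover have "Ck_on k S (\<lambda>x. \<Sum>b\<in>Basis. (?D x v \<bullet> b) *\<^sub>R ?F x b)" for v
      using Suc Ck_on_mono[OF Suc.prems(2)]
      by (intro Ck_on_sum[OF S] Ck_on_scaleR[OF S] Ck_on_linear[OF S bounded_linear_inner_left]) auto
    ultimately show "Ck_on k S (\<lambda>x. ?F x (?D x v))" for v
      using Ck_on_cong[of S "\<lambda>x. ?F x (?D x v)" "\<lambda>x. \<Sum>b\<in>Basis. (?D x v \<bullet> b) *\<^sub>R ?F x b" k] by blast
  qed
qed

lemma smooth_on_compose:
  fixes \<sigma> :: "real \<Rightarrow> 'c::euclidean_space" and f :: "'c \<Rightarrow> 'b::real_normed_vector"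
  assumes "no_isolated S" "smooth_on T f" "smooth_on S \<sigma>" "\<sigma> ` S \<subseteq> T"
  shows "smooth_on S (\<lambda>x. f (\<sigma> x))"
  using assms Ck_on_compose unfolding smooth_on_def by blast

lemma smooth_on_cong: "(\<And>x. x \<in> S \<Longrightarrow> f x = h x) \<Longrightarrow> smooth_on S f \<longleftrightarrow> smooth_on S h"
  unfolding smooth_on_def using Ck_on_cong[of S f h] by simp

lemma no_isolated_openin:
  assumes "a < b" "openin (top_of_set {a..b}) S"
  shows "no_isolated S"
  unfolding no_isolated_def
proof
  fix x assume x: "x \<in> S"
  then have "x \<in> {a..b}" using openin_imp_subset[OF assms(2)] by blast
  then show "at x within S \<noteq> bot"
    unfolding at_within_openin[OF assms(2) x] using assms(1) by (simp add: trivial_limit_within islimpt_Icc)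
qed

lemma smooth_on_affine:
  assumes "no_isolated S"
  shows "smooth_on S (\<lambda>t::real. \<alpha> * t + \<beta>)"
  unfolding smooth_on_def
  using Ck_on_add[OF assms Ck_on_scaleR[OF assms Ck_on_const[OF assms] Ck_on_ident[OF assms]] Ck_on_const[OF assms]] by simp

text \<open>The curves written down explicitly are all cubic in coordinates: straight segments, and
  images of radial segments under the cubic map of \<open>normal_coordinates\<close>.\<close>

lemma smooth_on_cubic:
  fixes c\<^sub>0 :: "'b::real_normed_vector"
  assumes "no_isolated S"
  shows "smooth_on S (\<lambda>t::real. c\<^sub>0 + t *\<^sub>R c\<^sub>1 + t\<^sup>2 *\<^sub>R c\<^sub>2 + t^3 *\<^sub>R c\<^sub>3)"
proof -
  note ident = Ck_on_ident[OF assms] and scale = Ck_on_scaleR[OF assms]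
  have "Ck_on k S (\<lambda>t. t\<^sup>2)" for k
    using scale[OF ident ident, of k] by (simp add: power2_eq_square)
  then have "Ck_on k S (\<lambda>t. t^3)" "Ck_on k S (\<lambda>t. t\<^sup>2)" for k
    using scale[OF ident, of k "\<lambda>t. t\<^sup>2"] by (simp_all add: power3_eq_cube power2_eq_square mult.assoc)
  then show ?thesis
    unfolding smooth_on_def by (intro allI Ck_on_add[OF assms] scale ident Ck_on_const[OF assms])
qed

section \<open>Reversal and concatenation of curves\<close>

context riemannian
begin

text \<open>The substitution rule behind both operations: \<open>\<alpha> = -1\<close> reverses a
  curve, \<open>\<alpha> = 2\<close> speeds up the halves of a concatenation.\<close>

lemma smooth_curve_affine:
  assumes p: "pathin X \<gamma>" and a: "\<alpha> \<noteq> 0" "a < b"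
    and ab: "(\<lambda>t. \<alpha> * t + \<beta>) ` {a..b} \<subseteq> {a'..b'}" "{a'..b'} \<subseteq> {0..1}"
    and q: "pathin X \<eta>" "{a..b} \<subseteq> {0..1}"
    and s: "smooth_curve_on A a' b' \<gamma>" and eq: "\<And>t. t \<in> {a..b} \<Longrightarrow> \<eta> t = \<gamma> (\<alpha> * t + \<beta>)"
  shows "smooth_curve_on A a b \<eta>"
  unfolding smooth_curve_on_def
proof clarify
  fix U \<phi> assume c: "(U, \<phi>) \<in> A"
  let ?S = "{t \<in> {a..b}. \<eta> t \<in> U}" and ?T = "{t \<in> {a'..b'}. \<gamma> t \<in> U}"
  have "\<exists>e>0. \<forall>s\<in>{a..b}. dist s t < e \<longrightarrow> s \<in> ?S" if "t \<in> ?S" for t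
    using curve_near[OF q(1) _ chart_openin[OF chart[OF c]], of t] that q(2)
    by (smt (verit) fst_conv mem_Collect_eq subsetD)
  then have "openin (top_of_set {a..b}) ?S"
    unfolding openin_euclidean_subtopology_iff by auto
  then have S: "no_isolated ?S"
    using no_isolated_openin a by blast
  have "smooth_on ?S (\<lambda>t. (\<phi> \<circ> \<gamma>) (\<alpha> * t + \<beta>))"
  proof (rule smooth_on_compose[OF S _ smooth_on_affine[OF S]])
    show "smooth_on ?T (\<phi> \<circ> \<gamma>)"
      using s c unfolding smooth_curve_on_def by blast
    show "(\<lambda>t. \<alpha> * t + \<beta>) ` ?S \<subseteq> ?T"
      using ab eq by fastforce
  qed
  then show "smooth_on ?S (\<phi> \<circ> \<eta>)"
    using smooth_on_cong[of ?S "\<lambda>t. (\<phi> \<circ> \<gamma>) (\<alpha> * t + \<beta>)" "\<phi> \<circ> \<eta>"] eq by simp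
qed

lemma piecewise_smooth_reverse:
  assumes "piecewise_smooth_curve X A \<gamma>"
  shows "piecewise_smooth_curve X A (\<lambda>t. \<gamma> (1 - t))"
proof -
  obtain n t where p: "pathin X \<gamma>" and t: "t 0 = (0::real)" "t n = 1"
    "\<forall>i<n. t i < t (Suc i)" and s: "\<And>i. i < n \<Longrightarrow> smooth_curve_on A (t i) (t (Suc i)) \<gamma>"
    using assms unfolding piecewise_smooth_curve_def by blast
  have q: "pathin X (\<lambda>t. \<gamma> (1 - t))"
    unfolding pathin_def
    by (rule continuous_map_compose[of "top_of_set {0..1}" "top_of_set {0..1}" "\<lambda>t. 1 - t", unfolded o_def])
      (use p in \<open>auto simp: pathin_def intro!: continuous_intros\<close>)
  have sub: "0 \<le> t i" "t (Suc i) \<le> 1" "t i < t (Suc i)" if "i < n" for i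
    using partition_mono[OF t(3), of 0 i] partition_mono[OF t(3), of "Suc i" n] that t by auto
  have "smooth_curve_on A (1 - t (n - i)) (1 - t (n - Suc i)) (\<lambda>t. \<gamma> (1 - t))"
      "1 - t (n - i) < 1 - t (n - Suc i)" if "i < n" for i
  proof -
    \<comment> \<open>The pieces are traversed backwards: piece \<open>i\<close> of the new curve is
      piece \<open>j\<close> of the old one.\<close>
    define j where "j = n - Suc i"
    have j: "n - i = Suc j" "n - Suc i = j" "j < n" using that unfolding j_def by auto
    show "smooth_curve_on A (1 - t (n - i)) (1 - t (n - Suc i)) (\<lambda>t. \<gamma> (1 - t))"
      unfolding j
      by (rule smooth_curve_affine[OF p _ _ _ _ q _ s[OF j(3)], of "-1" _ _ 1]) (use sub[OF j(3)] in auto)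
    show "1 - t (n - i) < 1 - t (n - Suc i)" unfolding j using sub[OF j(3)] by simp
  qed
  then show ?thesis
    unfolding piecewise_smooth_curve_def using q t
    by (intro conjI exI[of _ n] exI[of _ "\<lambda>i. 1 - t (n - i)"]) auto
qed

lemma piecewise_smooth_join:
  assumes "piecewise_smooth_curve X A \<gamma>" "piecewise_smooth_curve X A \<eta>" "\<gamma> 1 = \<eta> 0"
  shows "piecewise_smooth_curve X A (\<lambda>t. if t \<le> 1/2 then \<gamma> (2 * t) else \<eta> (2 * t - 1))"
proof -
  let ?h = "\<lambda>t. if t \<le> 1/2 then \<gamma> (2 * t) else \<eta> (2 * t - 1)"
  obtain n t where p: "pathin X \<gamma>" and t: "t 0 = (0::real)" "t n = 1"
    "\<forall>i<n. t i < t (Suc i)" and s: "\<And>i. i < n \<Longrightarrow> smooth_curve_on A (t i) (t (Suc i)) \<gamma>"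
    using assms(1) unfolding piecewise_smooth_curve_def by blast
  obtain m u where q: "pathin X \<eta>" and u: "u 0 = (0::real)" "u m = 1"
    "\<forall>i<m. u i < u (Suc i)" and s': "\<And>i. i < m \<Longrightarrow> smooth_curve_on A (u i) (u (Suc i)) \<eta>"
    using assms(2) unfolding piecewise_smooth_curve_def by blast
  have h: "pathin X ?h"
    unfolding pathin_def
  proof (rule continuous_map_cases_le)
    show "continuous_map (subtopology (top_of_set {0..1}) {x \<in> topspace (top_of_set {0..1}). x \<le> 1/2}) X (\<lambda>x. \<gamma> (2 * x))"
      by (rule continuous_map_compose[of _ "top_of_set {0..1}" "\<lambda>t. 2 * t" X \<gamma>, unfolded o_def])
        (use p in \<open>auto simp: pathin_def subtopology_subtopology intro!: continuous_intros\<close>)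
    show "continuous_map (subtopology (top_of_set {0..1}) {x \<in> topspace (top_of_set {0..1}). 1/2 \<le> x}) X (\<lambda>x. \<eta> (2 * x - 1))"
      by (rule continuous_map_compose[of _ "top_of_set {0..1}" "\<lambda>t. 2 * t - 1" X \<eta>, unfolded o_def])
        (use q in \<open>auto simp: pathin_def subtopology_subtopology intro!: continuous_intros\<close>)
  qed (use assms(3) in \<open>auto simp: field_simps\<close>)
  have sub: "0 \<le> t i" "t (Suc i) \<le> 1" "t i < t (Suc i)" if "i < n" for i
    using partition_mono[OF t(3), of 0 i] partition_mono[OF t(3), of "Suc i" n] that t by auto
  have sub': "0 \<le> u i" "u (Suc i) \<le> 1" "u i < u (Suc i)" if "i < m" for i
    using partition_mono[OF u(3), of 0 i] partition_mono[OF u(3), of "Suc i" m] that u by auto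
  \<comment> \<open>Both branches give 1/2 at \<open>i = n\<close>, because \<open>t n = 1\<close>
    and \<open>u 0 = 0\<close>.\<close>
  define w where "w i = (if i \<le> n then t i / 2 else (u (i - n) + 1) / 2)" for i
  have "w i < w (Suc i) \<and> smooth_curve_on A (w i) (w (Suc i)) ?h" if i: "i < n + m" for i
  proof (cases "i < n")
    case True
    then have w: "w i = t i / 2" "w (Suc i) = t (Suc i) / 2" unfolding w_def by auto
    show ?thesis
      unfolding w using sub[OF True]
      by (intro conjI, simp) (rule smooth_curve_affine[OF p _ _ _ _ h _ s[OF True], of 2 _ _ 0], auto)
  next
    case False
    define j where "j = i - n"
    have j: "j < m" "i = n + j" using False i unfolding j_def by auto
    have w: "w i = (u j + 1) / 2" "w (Suc i) = (u (Suc j) + 1) / 2"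
      unfolding w_def j(2) using t(2) u(1) by auto
    \<comment> \<open>At 1/2 the definition takes the branch of \<gamma>; the junction condition
      makes the formula with \<eta> valid on the closed second half.\<close>
    have hq: "?h x = \<eta> (2 * x + - 1)" if "x \<ge> 1/2" for x
    proof (cases "x = 1/2")
      case True
      show ?thesis unfolding True using assms(3) by simp
    qed (use that in auto)
    show ?thesis
      unfolding w using sub'[OF j(1)]
      by (intro conjI, simp) (rule smooth_curve_affine[OF q _ _ _ _ h _ s'[OF j(1)] hq], auto)
  qed
  moreover have "w 0 = 0" "w (n + m) = 1"
    unfolding w_def using t u by (auto intro!: gr0I)
  ultimately show ?thesis
    unfolding piecewise_smooth_curve_def using h by (intro conjI exI[of _ "n + m"] exI[of _ w]) auto
qed

end

section \<open>The Riemannian distance\<close>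

context riemannian
begin

lemma speed_off_finite:
  assumes "piecewise_smooth_curve X A \<gamma>"
  obtains B where "finite B" "0 \<in> B" "1 \<in> B"
    "\<And>t c. t \<in> {0..1} - B \<Longrightarrow> c \<in> A \<Longrightarrow> \<gamma> t \<in> fst c \<Longrightarrow>
      \<exists>v. (snd c \<circ> \<gamma> has_vector_derivative v) (at t) \<and> speed A g \<gamma> t = metric_norm c (\<gamma> t) v"
proof -
  obtain B where B: "finite B \<and> {0,1} \<subseteq> B \<and> (\<forall>t\<in>{0..1} - B. \<forall>c\<in>A. \<gamma> t \<in> fst c \<longrightarrow>
      (\<exists>v. (snd c \<circ> \<gamma> has_vector_derivative v) (at t) \<and> speed A g \<gamma> t = metric_norm c (\<gamma> t) v))"
    using speed_piecewise(2)[OF assms] by (rule exE)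
  show ?thesis
    by (rule that[of B]) (use B in simp_all)
qed

lemma pathin_topspace: "pathin X \<gamma> \<Longrightarrow> t \<in> {0..1} \<Longrightarrow> \<gamma> t \<in> topspace X"
  unfolding pathin_def using continuous_map_image_subset_topspace[of "top_of_set {0..1}" X \<gamma>] by auto

lemma speed_nonneg:
  assumes "\<gamma> t \<in> topspace X"
  shows "0 \<le> speed A g \<gamma> t"
proof -
  let ?c = "SOME c. c \<in> A \<and> \<gamma> t \<in> fst c"
  have "?c \<in> A \<and> \<gamma> t \<in> fst ?c"
    by (rule someI_ex) (use chart_ex[OF assms] in blast)
  then show ?thesis
    using metric_norm_nonneg unfolding speed_def Let_def metric_norm_def by blast
qed

lemma curve_length_nonneg: "pathin X \<gamma> \<Longrightarrow> 0 \<le> curve_length A g \<gamma>"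
  unfolding curve_length_def using speed_nonneg pathin_topspace
  by (cases "speed A g \<gamma> integrable_on {0..1}") (auto simp: not_integrable_integral intro: integral_nonneg)

text \<open>Reversal negates the velocity, and the metric is even in it. The speeds are compared
  only off a finite set, which the integral ignores.\<close>

lemma curve_length_reverse:
  assumes \<gamma>: "piecewise_smooth_curve X A \<gamma>"
  shows "curve_length A g (\<lambda>t. \<gamma> (1 - t)) = curve_length A g \<gamma>"
proof -
  let ?\<eta> = "\<lambda>t. \<gamma> (1 - t)"
  have \<eta>: "piecewise_smooth_curve X A ?\<eta>"
    by (rule piecewise_smooth_reverse[OF \<gamma>])
  obtain B where B: "finite B" "\<And>t c. t \<in> {0..1} - B \<Longrightarrow> c \<in> A \<Longrightarrow> \<gamma> t \<in> fst c \<Longrightarrow>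
      \<exists>v. (snd c \<circ> \<gamma> has_vector_derivative v) (at t) \<and> speed A g \<gamma> t = metric_norm c (\<gamma> t) v"
    by (rule speed_off_finite[OF \<gamma>]) metis
  obtain C where C: "finite C" "\<And>t c. t \<in> {0..1} - C \<Longrightarrow> c \<in> A \<Longrightarrow> ?\<eta> t \<in> fst c \<Longrightarrow>
      \<exists>v. (snd c \<circ> ?\<eta> has_vector_derivative v) (at t) \<and> speed A g ?\<eta> t = metric_norm c (?\<eta> t) v"
    by (rule speed_off_finite[OF \<eta>]) metis
  have eq: "speed A g ?\<eta> t = speed A g \<gamma> (1 - t)" if t: "t \<in> {0..1} - (C \<union> (\<lambda>t. 1 - t) ` B)" for t
  proof -
    have t': "t \<in> {0..1} - C" "1 - t \<in> {0..1} - B"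
      using t by (auto simp: image_iff)
    have "\<gamma> (1 - t) \<in> topspace X"
      using t' \<gamma> pathin_topspace unfolding piecewise_smooth_curve_def by blast
    then obtain c where c: "c \<in> A" "\<gamma> (1 - t) \<in> fst c"
      using chart_ex by blast
    obtain v where v: "(snd c \<circ> \<gamma> has_vector_derivative v) (at (1 - t))" "speed A g \<gamma> (1 - t) = metric_norm c (\<gamma> (1 - t)) v"
      using B(2)[OF t'(2) c] by blast
    obtain w where w: "(snd c \<circ> ?\<eta> has_vector_derivative w) (at t)" "speed A g ?\<eta> t = metric_norm c (?\<eta> t) w"
      using C(2)[OF t'(1) c] by blast
    have "((\<lambda>t. 1 - t) has_vector_derivative -1) (at t)"
      by (auto intro!: derivative_eq_intros)
    then have "((snd c \<circ> \<gamma>) \<circ> (\<lambda>t. 1 - t) has_vector_derivative -1 *\<^sub>R v) (at t)"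
      using v(1) by (rule vector_diff_chain_at)
    then have "w = - v"
      using w(1) vector_derivative_unique_at by (fastforce simp: o_def)
    then show ?thesis
      unfolding v(2) w(2) metric_norm_def by (simp add: linear_neg[OF matrix_vector_mul_linear])
  qed
  have "(speed A g \<gamma> has_integral curve_length A g \<gamma>) {0..1}"
    unfolding curve_length_def using speed_piecewise(1)[OF \<gamma>] by (rule integrable_integral)
  from has_integral_affinity[OF this[folded cbox_interval], of "-1" 1]
  have "((\<lambda>t. speed A g \<gamma> (1 - t)) has_integral curve_length A g \<gamma>) ((\<lambda>x. 1 - x) ` {0..1})"
    by (simp add: image_affinity_atLeastAtMost)
  then have "((\<lambda>t. speed A g \<gamma> (1 - t)) has_integral curve_length A g \<gamma>) {0..1}"
    by (simp add: image_diff_atLeastAtMost)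
  then have "(speed A g ?\<eta> has_integral curve_length A g \<gamma>) {0..1}"
    by (rule has_integral_spike_finite[of "C \<union> (\<lambda>t. 1 - t) ` B", rotated 2]) (use eq B(1) C(1) in auto)
  then show ?thesis
    unfolding curve_length_def[of _ _ ?\<eta>] by (rule integral_unique)
qed

abbreviation d :: "'a \<Rightarrow> 'a \<Rightarrow> real"
  where "d \<equiv> riemannian_dist X A g"

text \<open>Holds for arbitrary \<open>x\<close> and \<open>y\<close>, joined by a curve or not,
  because reversal makes the two sets of lengths equal. The weight of an unordered edge relies on
  this symmetry.\<close>

lemma dist_sym: "d x y = d y x"
proof -
  have "{curve_length A g \<gamma> |\<gamma>. piecewise_smooth_curve X A \<gamma> \<and> \<gamma> 0 = x \<and> \<gamma> 1 = y} \<subseteq>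
      {curve_length A g \<gamma> |\<gamma>. piecewise_smooth_curve X A \<gamma> \<and> \<gamma> 0 = y \<and> \<gamma> 1 = x}" for x y
  proof clarify
    fix \<gamma> assume "piecewise_smooth_curve X A \<gamma>"
    then show "\<exists>\<gamma>'. curve_length A g \<gamma> = curve_length A g \<gamma>' \<and> piecewise_smooth_curve X A \<gamma>' \<and>
        \<gamma>' 0 = \<gamma> 1 \<and> \<gamma>' 1 = \<gamma> 0"
      by (intro exI[of _ "\<lambda>t. \<gamma> (1 - t)"]) (simp add: curve_length_reverse piecewise_smooth_reverse)
  qed
  then show ?thesis
    unfolding riemannian_dist_def by (metis (no_types, lifting) subset_antisym)
qed

lemma dist_le_length:
  assumes "piecewise_smooth_curve X A \<gamma>"
  shows "d (\<gamma> 0) (\<gamma> 1) \<le> curve_length A g \<gamma>"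
  unfolding riemannian_dist_def
proof (rule cInf_lower)
  show "bdd_below {curve_length A g \<gamma>' |\<gamma>'. piecewise_smooth_curve X A \<gamma>' \<and> \<gamma>' 0 = \<gamma> 0 \<and> \<gamma>' 1 = \<gamma> 1}"
    using curve_length_nonneg unfolding piecewise_smooth_curve_def by (intro bdd_belowI[of _ 0]) auto
qed (use assms in blast)

text \<open>\<open>smooth_curve_on\<close> demands smoothness in every chart of the atlas, so the
  coordinate curve is composed with all transition maps out of \<open>c\<close>.\<close>

lemma chart_curve:
  assumes c: "c \<in> A" and \<sigma>: "smooth_on {0..1} \<sigma>" "\<sigma> ` {0..1} \<subseteq> snd c ` fst c"
  defines "\<gamma> \<equiv> inv_into (fst c) (snd c) \<circ> \<sigma>"
  shows "piecewise_smooth_curve X A \<gamma>"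
    and "\<And>t. t \<in> {0..1} \<Longrightarrow> \<gamma> t \<in> fst c \<and> snd c (\<gamma> t) = \<sigma> t"
proof -
  have in_c: "\<gamma> t \<in> fst c \<and> snd c (\<gamma> t) = \<sigma> t" if "t \<in> {0..1}" for t
    using \<sigma>(2) that unfolding \<gamma>_def by (metis comp_apply f_inv_into_f imageI inv_into_into subsetD)
  then show "\<And>t. t \<in> {0..1} \<Longrightarrow> \<gamma> t \<in> fst c \<and> snd c (\<gamma> t) = \<sigma> t" .
  have "continuous_on {0..1} \<sigma>"
    using smooth_on_differentiable_on[OF \<sigma>(1)] by (rule differentiable_imp_continuous_on)
  then have "continuous_map (top_of_set {0..1}) (top_of_set (snd c ` fst c)) \<sigma>"
    using \<sigma>(2) by (simp add: continuous_map_in_subtopology image_subset_iff_funcset)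
  then have p: "pathin X \<gamma>"
    unfolding pathin_def \<gamma>_def using chart_inv_continuous[OF chart[OF c]] continuous_map_compose by blast
  have "smooth_curve_on A 0 1 \<gamma>"
    unfolding smooth_curve_on_def
  proof clarify
    fix U \<phi> assume e: "(U, \<phi>) \<in> A"
    let ?S = "{t \<in> {0..1}. \<gamma> t \<in> U}"
    have "openin (top_of_set {0..1}) {t \<in> topspace (top_of_set {0..1}). \<gamma> t \<in> U}"
      using p chart_openin[OF chart[OF e]] openin_continuous_map_preimage unfolding pathin_def by fastforce
    then have S: "no_isolated ?S"
      using no_isolated_openin[of 0 1] by simp
    have "smooth_on ?S (\<lambda>t. transition c (U, \<phi>) (\<sigma> t))"
    proof (rule smooth_on_compose[OF S, where f = "transition c (U, \<phi>)" and \<sigma> = \<sigma>])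
      show "smooth_on (snd c ` (fst c \<inter> U)) (transition c (U, \<phi>))"
        using manifold c e unfolding smooth_manifold_def by fastforce
      show "\<sigma> ` ?S \<subseteq> snd c ` (fst c \<inter> U)"
      proof
        fix y assume "y \<in> \<sigma> ` ?S"
        then obtain t where "t \<in> ?S" "y = \<sigma> t" by blast
        then show "y \<in> snd c ` (fst c \<inter> U)"
          using in_c[of t] by (intro image_eqI[of _ _ "\<gamma> t"]) auto
      qed
      \<comment> \<open>\<open>smooth_on\<close> differentiates within its set, so even restricting
        it to \<open>?S\<close> counts as a composition, namely with the identity.\<close>
      show "smooth_on ?S \<sigma>"
        by (rule smooth_on_compose[OF S \<sigma>(1), where \<sigma> = "\<lambda>t. t"])
          (use Ck_on_ident[OF S] in \<open>auto simp: smooth_on_def\<close>)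
    qed
    moreover have "transition c (U, \<phi>) (\<sigma> t) = (\<phi> \<circ> \<gamma>) t" if "t \<in> ?S" for t
      using transition_apply[OF c, of "\<gamma> t" "(U, \<phi>)"] in_c that by simp
    ultimately show "smooth_on ?S (\<phi> \<circ> \<gamma>)"
      using smooth_on_cong[of ?S "\<lambda>t. transition c (U, \<phi>) (\<sigma> t)" "\<phi> \<circ> \<gamma>"] by (simp only:)
  qed
  then show "piecewise_smooth_curve X A \<gamma>"
    unfolding piecewise_smooth_curve_def using p
    by (intro conjI exI[of _ 1] exI[of _ "real"]) auto
qed

lemma dist_le_chart:
  assumes c: "c \<in> A" and \<sigma>: "smooth_on {0..1} \<sigma>" "\<sigma> ` {0..1} \<subseteq> snd c ` fst c"
    and D: "\<And>t. t \<in> {0<..<1} \<Longrightarrow> (\<sigma> has_vector_derivative \<sigma>' t) (at t)"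
    and C: "\<And>t. t \<in> {0<..<1} \<Longrightarrow> sqrt (\<sigma>' t \<bullet> (g c (\<sigma> t) *v \<sigma>' t)) \<le> C"
  shows "d (inv_into (fst c) (snd c) (\<sigma> 0)) (inv_into (fst c) (snd c) (\<sigma> 1)) \<le> C"
proof -
  let ?\<gamma> = "inv_into (fst c) (snd c) \<circ> \<sigma>"
  note P = chart_curve[OF c \<sigma>]
  obtain B where B: "finite B" "0 \<in> B" "1 \<in> B" "\<And>t c. t \<in> {0..1} - B \<Longrightarrow> c \<in> A \<Longrightarrow> ?\<gamma> t \<in> fst c \<Longrightarrow>
      \<exists>v. (snd c \<circ> ?\<gamma> has_vector_derivative v) (at t) \<and> speed A g ?\<gamma> t = metric_norm c (?\<gamma> t) v"
    by (rule speed_off_finite[OF P(1)]) metis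
  have sp: "speed A g ?\<gamma> t \<le> C" if t: "t \<in> {0..1} - B" for t
  proof -
    have t01: "t \<in> {0<..<1}" "t \<in> {0..1}"
      using t B(2,3) by (auto simp: less_le)
    obtain v where v: "(snd c \<circ> ?\<gamma> has_vector_derivative v) (at t)" "speed A g ?\<gamma> t = metric_norm c (?\<gamma> t) v"
      using B(4)[OF t c] P(2)[OF t01(2)] by blast
    have "(snd c \<circ> ?\<gamma> has_vector_derivative \<sigma>' t) (at t)"
      using D[OF t01(1)]
      by (rule has_vector_derivative_transform_within_open[of _ _ _ "{0<..<1}"]) (use t01 P(2) in auto)
    then have "v = \<sigma>' t"
      using v(1) vector_derivative_unique_at by blast
    then show ?thesis
      using v(2) C[OF t01(1)] P(2)[OF t01(2)] unfolding metric_norm_def by simp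
  qed
  have "curve_length A g ?\<gamma> \<le> integral {0..1::real} (\<lambda>_. C)"
  proof -
    have "(speed A g ?\<gamma> has_integral curve_length A g ?\<gamma>) {0..1}"
      unfolding curve_length_def using speed_piecewise(1)[OF P(1)] by (rule integrable_integral)
    \<comment> \<open>On \<open>B\<close> the value of \<open>speed\<close> is unspecified and might
      exceed \<open>C\<close>.\<close>
    then have "((\<lambda>t. if t \<in> B then C else speed A g ?\<gamma> t) has_integral curve_length A g ?\<gamma>) {0..1}"
      by (rule has_integral_spike_finite[OF B(1), rotated]) auto
    moreover have "((\<lambda>_. C) has_integral C) {0..1::real}"
      using has_integral_const_real[of C 0 1] by simp
    ultimately show ?thesis
      using sp by (intro has_integral_le[where i = "curve_length A g ?\<gamma>"]) (auto simp: integral_unique)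
  qed
  then show ?thesis
    using dist_le_length[OF P(1)] by simp
qed

text \<open>Joining points by curves matters because the infimum that defines the distance would be a
  junk value over an empty set of curves.\<close>

definition joinable :: "'a \<Rightarrow> 'a \<Rightarrow> bool"
  where "joinable p q \<longleftrightarrow> (\<exists>\<gamma>. piecewise_smooth_curve X A \<gamma> \<and> \<gamma> 0 = p \<and> \<gamma> 1 = q)"

lemma joinable_sym: "joinable p q \<Longrightarrow> joinable q p"
  unfolding joinable_def
proof (elim exE conjE)
  fix \<gamma> assume "piecewise_smooth_curve X A \<gamma>" "\<gamma> 0 = p" "\<gamma> 1 = q"
  then show "\<exists>\<gamma>. piecewise_smooth_curve X A \<gamma> \<and> \<gamma> 0 = q \<and> \<gamma> 1 = p"
    using piecewise_smooth_reverse by (intro exI[of _ "\<lambda>t. \<gamma> (1 - t)"]) simp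
qed

lemma joinable_trans:
  assumes "joinable p q" "joinable q r"
  shows "joinable p r"
proof -
  obtain \<gamma> \<eta> where \<gamma>: "piecewise_smooth_curve X A \<gamma>" "\<gamma> 0 = p" "\<gamma> 1 = q"
    and \<eta>: "piecewise_smooth_curve X A \<eta>" "\<eta> 0 = q" "\<eta> 1 = r"
    using assms unfolding joinable_def by blast
  let ?h = "\<lambda>t. if t \<le> 1/2 then \<gamma> (2 * t) else \<eta> (2 * t - 1)"
  have "piecewise_smooth_curve X A ?h" "?h 0 = p" "?h 1 = r"
    using piecewise_smooth_join[OF \<gamma>(1) \<eta>(1)] \<gamma> \<eta> by simp_all
  then show ?thesis unfolding joinable_def by blast
qed

text \<open>A coordinate ball is convex, so straight segments in coordinates join its centre to all
  its points.\<close>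

lemma joinable_near:
  assumes "p \<in> topspace X"
  obtains U where "openin X U" "p \<in> U" "\<And>q. q \<in> U \<Longrightarrow> joinable p q"
proof -
  obtain c where c: "c \<in> A" "p \<in> fst c" using chart_ex[OF assms] by blast
  let ?y = "snd c p"
  obtain e where e: "e > 0" "ball ?y e \<subseteq> snd c ` fst c"
    using chart_open_image[OF chart[OF c(1)]] c(2) by (meson imageI open_contains_ball)
  let ?U = "{q \<in> fst c. snd c q \<in> ball ?y e}"
  have "openin (subtopology X (fst c)) {q \<in> topspace (subtopology X (fst c)). snd c q \<in> ball ?y e}"
    using chart_continuous[OF chart[OF c(1)]] by (rule openin_continuous_map_preimage) simp
  moreover have "topspace (subtopology X (fst c)) = fst c"
    using chart_subset[OF c(1)] by auto
  ultimately have o: "openin X ?U"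
    using openin_trans_full chart_openin[OF chart[OF c(1)]] by metis
  have "joinable p q" if q: "q \<in> ?U" for q
  proof -
    define \<sigma> where "\<sigma> t = ?y + t *\<^sub>R (snd c q - ?y) + t\<^sup>2 *\<^sub>R 0 + t^3 *\<^sub>R 0" for t :: real
    have "no_isolated {0..1}"
      using no_isolated_openin[of 0 1] by simp
    then have s: "smooth_on {0..1} \<sigma>"
      using smooth_on_cubic[of "{0..1}" ?y "snd c q - ?y" 0 0] unfolding \<sigma>_def by blast
    have "\<sigma> t \<in> ball ?y e" if "t \<in> {0..1}" for t
    proof -
      have "norm (t *\<^sub>R (snd c q - ?y)) \<le> 1 * norm (snd c q - ?y)"
        unfolding norm_scaleR using that by (intro mult_right_mono) auto
      then show ?thesis
        using q unfolding \<sigma>_def by (auto simp: dist_norm norm_minus_commute)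
    qed
    then have "\<sigma> ` {0..1} \<subseteq> snd c ` fst c"
      using e(2) by blast
    note P = chart_curve[OF c(1) s this]
    have "\<sigma> 0 = ?y" "\<sigma> 1 = snd c q" unfolding \<sigma>_def by simp_all
    then show ?thesis
      unfolding joinable_def using P(1) q c chart_inj[OF chart[OF c(1)]]
      by (intro exI[of _ "inv_into (fst c) (snd c) \<circ> \<sigma>"]) (auto simp: inv_into_f_f)
  qed
  then show ?thesis
    using that[OF o] c(2) e(1) by auto
qed

text \<open>By \<open>joinable_near\<close>, the points joinable to \<open>p\<close> and those not
  joinable to it both form open sets; connectedness leaves only the whole space.\<close>

lemma joinable:
  assumes X: "connected_space X" and p: "p \<in> topspace X" "q \<in> topspace X"
  shows "joinable p q"
proof -
  let ?R = "{q \<in> topspace X. joinable p q}"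
  have "openin X ?R"
  proof (subst openin_subopen, intro ballI)
    fix q assume q: "q \<in> ?R"
    then obtain U where "openin X U" "q \<in> U" "\<And>r. r \<in> U \<Longrightarrow> joinable q r"
      using joinable_near[of q] by blast
    then show "\<exists>T. openin X T \<and> q \<in> T \<and> T \<subseteq> ?R"
      using q joinable_trans[of p q] openin_subset by (intro exI[of _ U]) blast
  qed
  moreover have "openin X (topspace X - ?R)"
  proof (subst openin_subopen, intro ballI)
    fix q assume q: "q \<in> topspace X - ?R"
    then obtain U where "openin X U" "q \<in> U" "\<And>r. r \<in> U \<Longrightarrow> joinable q r"
      using joinable_near[of q] by blast
    then show "\<exists>T. openin X T \<and> q \<in> T \<and> T \<subseteq> topspace X - ?R"
      using q joinable_trans[of p _ q] joinable_sym openin_subset by (intro exI[of _ U]) blast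
  qed
  ultimately have "?R = {} \<or> ?R = topspace X"
    using X unfolding connected_space_clopen_in closedin_def by blast
  moreover have "joinable p p"
    using joinable_near[OF p(1)] by blast
  ultimately show ?thesis
    using p by blast
qed

lemma dist_greatest:
  assumes "connected_space X" "p \<in> topspace X" "q \<in> topspace X"
    and "\<And>\<gamma>. piecewise_smooth_curve X A \<gamma> \<Longrightarrow> \<gamma> 0 = p \<Longrightarrow> \<gamma> 1 = q \<Longrightarrow> m \<le> curve_length A g \<gamma>"
  shows "m \<le> d p q"
  unfolding riemannian_dist_def
  by (rule cInf_greatest) (use joinable[OF assms(1-3)] assms(4) in \<open>auto simp: joinable_def\<close>)

lemma dist_nonneg:
  "connected_space X \<Longrightarrow> p \<in> topspace X \<Longrightarrow> q \<in> topspace X \<Longrightarrow> 0 \<le> d p q"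
  by (rule dist_greatest, assumption+) (simp add: piecewise_smooth_curve_def curve_length_nonneg)

text \<open>The calibration principle: the fundamental theorem of calculus along the curve, with
  finitely many exceptional times. The end time \<open>\<tau>\<close> allows a curve to be followed
  just until it leaves \<open>K\<close>.\<close>

lemma curve_variation_le:
  assumes \<gamma>: "piecewise_smooth_curve X A \<gamma>" and c: "c \<in> A" and \<tau>: "\<tau> \<in> {0..1}"
    and K: "\<And>t. t \<in> {0..\<tau>} \<Longrightarrow> \<gamma> t \<in> fst c \<and> snd c (\<gamma> t) \<in> K"
    and F: "\<And>y. y \<in> K \<Longrightarrow> (F has_derivative F' y) (at y)"
    and C: "\<And>y v. y \<in> K \<Longrightarrow> \<bar>F' y v\<bar> \<le> C * sqrt (v \<bullet> (g c y *v v))" "0 \<le> C"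
  shows "\<bar>F (snd c (\<gamma> \<tau>)) - F (snd c (\<gamma> 0))\<bar> \<le> C * curve_length A g \<gamma>"
proof -
  obtain B where B: "finite B" "0 \<in> B" "1 \<in> B" "\<And>t c. t \<in> {0..1} - B \<Longrightarrow> c \<in> A \<Longrightarrow> \<gamma> t \<in> fst c \<Longrightarrow>
      \<exists>v. (snd c \<circ> \<gamma> has_vector_derivative v) (at t) \<and> speed A g \<gamma> t = metric_norm c (\<gamma> t) v"
    by (rule speed_off_finite[OF \<gamma>]) metis
  have p: "pathin X \<gamma>" using \<gamma> unfolding piecewise_smooth_curve_def by blast
  define h where "h t = F (snd c (\<gamma> t))" for t
  have "\<exists>h'. t \<notin> B \<longrightarrow> (h has_vector_derivative h') (at t) \<and> \<bar>h'\<bar> \<le> C * speed A g \<gamma> t" if t: "t \<in> {0..\<tau>}" for t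
  proof (cases "t \<in> B")
    case False
    have t01: "t \<in> {0..1} - B" using t \<tau> False by auto
    obtain v where v: "(snd c \<circ> \<gamma> has_vector_derivative v) (at t)" "speed A g \<gamma> t = metric_norm c (\<gamma> t) v"
      using B(4)[OF t01 c] K[OF t] by blast
    have "(F \<circ> (snd c \<circ> \<gamma>) has_vector_derivative F' (snd c (\<gamma> t)) v) (at t)"
      using vector_derivative_diff_chain_within[OF v(1), of F] F[of "snd c (\<gamma> t)"] K[OF t]
      by (simp add: has_derivative_at_withinI)
    moreover have "F \<circ> (snd c \<circ> \<gamma>) = h" unfolding h_def by auto
    ultimately show ?thesis
      using C(1)[of "snd c (\<gamma> t)" v] K[OF t] v(2) unfolding metric_norm_def by auto
  qed auto
  then obtain h' where h': "\<And>t. t \<in> {0..\<tau>} \<Longrightarrow> t \<notin> B \<Longrightarrow> (h has_vector_derivative h' t) (at t) \<and> \<bar>h' t\<bar> \<le> C * speed A g \<gamma> t"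
    by metis
  have cont: "continuous_on {0..\<tau>} h"
  proof -
    have "continuous_map (top_of_set {0..\<tau>}) X \<gamma>"
      using p \<tau> continuous_map_from_subtopology_mono unfolding pathin_def
      by (metis atLeastatMost_subset_iff atLeastAtMost_iff order_refl)
    then have "continuous_map (top_of_set {0..\<tau>}) (subtopology X (fst c)) \<gamma>"
      using K by (auto simp: continuous_map_in_subtopology)
    then have "continuous_map (top_of_set {0..\<tau>}) euclidean (snd c \<circ> \<gamma>)"
      using chart_continuous[OF chart[OF c]] continuous_map_compose by blast
    then have "continuous_on {0..\<tau>} (snd c \<circ> \<gamma>)" by simp
    moreover have "continuous_on ((snd c \<circ> \<gamma>) ` {0..\<tau>}) F"
      using has_derivative_continuous[OF F] K by (intro continuous_at_imp_continuous_on) auto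
    ultimately have "continuous_on {0..\<tau>} (F \<circ> (snd c \<circ> \<gamma>))"
      by (rule continuous_on_compose)
    then show ?thesis unfolding h_def by (simp add: o_def)
  qed
  have I: "(h' has_integral h \<tau> - h 0) {0..\<tau>}"
    by (rule fundamental_theorem_of_calculus_interior_strong[OF B(1) _ _ cont]) (use \<tau> h' in auto)
  \<comment> \<open>\<open>h'\<close> is arbitrary on \<open>B\<close>; resetting it to 0 there
    makes the bound by the speed hold at every time.\<close>
  have I': "((\<lambda>t. if t \<in> B then 0 else h' t) has_integral h \<tau> - h 0) {0..\<tau>}"
    by (rule has_integral_spike_finite[OF B(1) _ I]) auto
  have s1: "speed A g \<gamma> integrable_on {0..1}" by (rule speed_piecewise(1)[OF \<gamma>])
  have s0: "speed A g \<gamma> integrable_on {0..\<tau>}"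
    by (rule integrable_subinterval_real[OF s1]) (use \<tau> in auto)
  have pos: "0 \<le> speed A g \<gamma> t" if "t \<in> {0..1}" for t
    using speed_nonneg pathin_topspace[OF p that] .
  have "norm (integral {0..\<tau>} (\<lambda>t. if t \<in> B then 0 else h' t)) \<le> integral {0..\<tau>} (\<lambda>t. C * speed A g \<gamma> t)"
  proof (rule integral_norm_bound_integral)
    show "(\<lambda>t. if t \<in> B then 0 else h' t) integrable_on {0..\<tau>}" using I' by blast
    show "(\<lambda>t. C * speed A g \<gamma> t) integrable_on {0..\<tau>}"
      using s0 by (rule integrable_on_mult_right)
    show "norm (if t \<in> B then 0 else h' t) \<le> C * speed A g \<gamma> t" if "t \<in> {0..\<tau>}" for t
      using h'[OF that] pos[of t] that \<tau> C(2) by auto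
  qed
  also have "\<dots> = C * integral {0..\<tau>} (speed A g \<gamma>)" by simp
  also have "\<dots> \<le> C * curve_length A g \<gamma>"
    unfolding curve_length_def
    by (intro mult_left_mono integral_subset_le s0 s1 C(2)) (use \<tau> pos in auto)
  finally show ?thesis
    unfolding integral_unique[OF I'] h_def by simp
qed

text \<open>The exit time is the least time outside the preimage of \<open>W\<close>. At that time
  the curve is still in the chart domain, because the preimage of the compact set \<open>K\<close>
  is closed in the Hausdorff space \<open>X\<close>.\<close>

lemma first_exit:
  assumes p: "pathin X \<gamma>" and c: "c \<in> A"
    and K: "compact K" "K \<subseteq> snd c ` fst c" and O: "open W" "W \<subseteq> K"
    and start: "\<gamma> 0 \<in> fst c" "snd c (\<gamma> 0) \<in> W"
  obtains (stay) "\<And>t. t \<in> {0..1} \<Longrightarrow> \<gamma> t \<in> fst c \<and> snd c (\<gamma> t) \<in> W"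
  | (exit) \<tau> where "\<tau> \<in> {0..1}" "\<And>t. t \<in> {0..\<tau>} \<Longrightarrow> \<gamma> t \<in> fst c \<and> snd c (\<gamma> t) \<in> K"
      "snd c (\<gamma> \<tau>) \<notin> W"
proof -
  let ?i = "inv_into (fst c) (snd c)"
  let ?P = "\<lambda>t. \<gamma> t \<in> fst c \<and> snd c (\<gamma> t) \<in> W"
  have tp: "topspace (subtopology X (fst c)) = fst c"
    using chart_subset[OF c] by auto
  have pc: "continuous_map (top_of_set {0..1}) X \<gamma>" using p unfolding pathin_def .
  have "openin (subtopology X (fst c)) {q \<in> topspace (subtopology X (fst c)). snd c q \<in> W}"
    using chart_continuous[OF chart[OF c]] by (rule openin_continuous_map_preimage) (simp add: O)
  then have "openin X {q \<in> fst c. snd c q \<in> W}"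
    unfolding tp using openin_trans_full chart_openin[OF chart[OF c]] by blast
  from openin_continuous_map_preimage[OF pc this]
  have o: "openin (top_of_set {0..1}) {t \<in> {0..1}. ?P t}" by simp
  have "compactin X (?i ` K)"
    using image_compactin[OF _ chart_inv_continuous[OF chart[OF c]], of K] K
    by (simp add: compactin_subtopology)
  then have "closedin X (?i ` K)"
    by (rule compactin_imp_closedin[OF manifoldD(1)])
  moreover have iK: "?i ` K = {q \<in> fst c. snd c q \<in> K}"
  proof (intro equalityI subsetI)
    fix q assume "q \<in> ?i ` K"
    then show "q \<in> {q \<in> fst c. snd c q \<in> K}"
      using K(2) by (auto simp: f_inv_into_f inv_into_into subset_iff)
  next
    fix q assume "q \<in> {q \<in> fst c. snd c q \<in> K}"
    then show "q \<in> ?i ` K"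
      using inv_into_f_f[OF chart_inj[OF chart[OF c]], of q] by (intro image_eqI[of _ _ "snd c q"]) auto
  qed
  ultimately have "closedin X {q \<in> fst c. snd c q \<in> K}" by simp
  from closedin_continuous_map_preimage[OF pc this]
  have cl: "closedin (top_of_set {0..1}) {t \<in> {0..1}. \<gamma> t \<in> fst c \<and> snd c (\<gamma> t) \<in> K}" by simp
  show ?thesis
  proof (cases "\<forall>t\<in>{0..1}. ?P t")
    case True
    then show ?thesis using stay by blast
  next
    case False
    define N where "N = {t \<in> {0..1}. \<not> ?P t}"
    have "N = {0..1} - {t \<in> {0..1}. ?P t}" unfolding N_def by blast
    then have "closedin (top_of_set {0..1}) N"
      using closedin_diff[OF closedin_topspace o] by simp
    then have "closed N" by (rule closedin_closed_trans) simp
    then have "compact N"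
      unfolding compact_eq_bounded_closed N_def by (auto intro: bounded_subset[of "{0..1}"])
    moreover have "N \<noteq> {}" using False unfolding N_def by blast
    ultimately obtain \<tau> where \<tau>: "\<tau> \<in> N" "\<And>t. t \<in> N \<Longrightarrow> \<tau> \<le> t"
      using compact_attains_inf[of N] by blast
    have before: "?P t" if "0 \<le> t" "t < \<tau>" for t
    proof (rule ccontr)
      assume "\<not> ?P t"
      then have "t \<in> N" using that \<tau>(1) unfolding N_def by auto
      then show False using \<tau>(2)[of t] that by simp
    qed
    have "\<tau> \<noteq> 0" using \<tau>(1) start unfolding N_def by auto
    then have "0 < \<tau>" using \<tau>(1) unfolding N_def by auto
    let ?T = "{t \<in> {0..1}. \<gamma> t \<in> fst c \<and> snd c (\<gamma> t) \<in> K}"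
    have "closed ?T" using cl by (rule closedin_closed_trans) simp
    moreover have "{0<..<\<tau>} \<subseteq> ?T"
      using before O(2) \<tau>(1) unfolding N_def by auto
    \<comment> \<open>The closed set \<open>?T\<close> contains all earlier times, hence the exit
      time as well.\<close>
    ultimately have "closure {0<..<\<tau>} \<subseteq> ?T" by (rule closure_minimal[rotated])
    then have "{0..\<tau>} \<subseteq> ?T" using \<open>0 < \<tau>\<close> by simp
    then have in_K: "\<gamma> t \<in> fst c \<and> snd c (\<gamma> t) \<in> K" if "t \<in> {0..\<tau>}" for t
      using that by blast
    moreover have "snd c (\<gamma> \<tau>) \<notin> W"
      using \<tau>(1) in_K[of \<tau>] \<open>0 < \<tau>\<close> unfolding N_def by auto
    ultimately show ?thesis
      using exit[of \<tau>] \<tau>(1) unfolding N_def by blast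
  qed
qed

end

section \<open>Second order jets\<close>

text \<open>The filter includes the point 0, so \<open>a\<close> is the value of \<open>f\<close>
  there. For a Taylor expansion \<open>c\<^sub>1\<close> and \<open>c\<^sub>3\<close> are halves of
  second partials, while \<open>c\<^sub>2\<close> is the whole mixed one.\<close>

definition jet2 :: "(real^2 \<Rightarrow> real) \<Rightarrow> real \<Rightarrow> real \<Rightarrow> real \<Rightarrow> real \<Rightarrow> real \<Rightarrow> real \<Rightarrow> bool"
  where "jet2 f a b\<^sub>1 b\<^sub>2 c\<^sub>1 c\<^sub>2 c\<^sub>3 \<longleftrightarrow>
    (\<lambda>u. f u - (a + b\<^sub>1 * u$1 + b\<^sub>2 * u$2 + c\<^sub>1 * (u$1)\<^sup>2 + c\<^sub>2 * (u$1 * u$2) + c\<^sub>3 * (u$2)\<^sup>2))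
      \<in> o[nhds 0](\<lambda>u. (norm u)\<^sup>2)"

lemma jet2_cong:
  assumes "jet2 f a b\<^sub>1 b\<^sub>2 c\<^sub>1 c\<^sub>2 c\<^sub>3" "\<And>u. f u = h u"
    "a = a'" "b\<^sub>1 = b\<^sub>1'" "b\<^sub>2 = b\<^sub>2'" "c\<^sub>1 = c\<^sub>1'" "c\<^sub>2 = c\<^sub>2'" "c\<^sub>3 = c\<^sub>3'"
  shows "jet2 h a' b\<^sub>1' b\<^sub>2' c\<^sub>1' c\<^sub>2' c\<^sub>3'"
proof -
  have "f = h" using assms(2) by (rule ext)
  then show ?thesis using assms(1) unfolding assms(3-) by simp
qed

lemma jet2_poly:
  "jet2 (\<lambda>u. a + b\<^sub>1 * u$1 + b\<^sub>2 * u$2 + c\<^sub>1 * (u$1)\<^sup>2 + c\<^sub>2 * (u$1 * u$2) + c\<^sub>3 * (u$2)\<^sup>2) a b\<^sub>1 b\<^sub>2 c\<^sub>1 c\<^sub>2 c\<^sub>3"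
  unfolding jet2_def by simp

lemma jet2_add:
  assumes "jet2 f a b\<^sub>1 b\<^sub>2 c\<^sub>1 c\<^sub>2 c\<^sub>3" "jet2 h a' b\<^sub>1' b\<^sub>2' c\<^sub>1' c\<^sub>2' c\<^sub>3'"
  shows "jet2 (\<lambda>u. f u + h u) (a + a') (b\<^sub>1 + b\<^sub>1') (b\<^sub>2 + b\<^sub>2') (c\<^sub>1 + c\<^sub>1') (c\<^sub>2 + c\<^sub>2') (c\<^sub>3 + c\<^sub>3')"
  using sum_in_smallo(1)[OF assms[unfolded jet2_def]] unfolding jet2_def by (simp add: algebra_simps)

lemma coord_bigo: "(\<lambda>u. u $ i) \<in> O[nhds 0](\<lambda>u::real^2. norm u)"
  by (rule bigoI[of _ 1]) (simp add: component_le_norm_cart)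

lemma norm_to_0: "((\<lambda>u::real^2. norm u) \<longlongrightarrow> 0) (nhds 0)"
  using tendsto_norm_zero[OF filterlim_ident] .

lemma norm_cube_smallo: "(\<lambda>u::real^2. (norm u)^3) \<in> o[nhds 0](\<lambda>u. (norm u)\<^sup>2)"
proof (rule landau_o.smallI)
  fix c :: real assume "c > 0"
  then have "eventually (\<lambda>u::real^2. norm u < c) (nhds 0)"
    using order_tendstoD(2)[OF norm_to_0] by blast
  then show "eventually (\<lambda>u::real^2. norm ((norm u)^3) \<le> c * norm ((norm u)\<^sup>2)) (nhds 0)"
  proof eventually_elim
    case (elim u)
    have "norm u * (norm u)\<^sup>2 \<le> c * (norm u)\<^sup>2"
      using elim by (intro mult_right_mono) auto
    then show ?case by (simp add: power3_eq_cube power2_eq_square mult.assoc)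
  qed
qed

lemma const_bigo: "(\<lambda>u. a) \<in> O[nhds (0::real^2)](\<lambda>u. 1)" for a :: real
  by (rule bigoI[of _ "\<bar>a\<bar>"]) simp

lemma cmult_bigo: "f \<in> O[nhds 0](h) \<Longrightarrow> (\<lambda>u. a * f u) \<in> O[nhds 0](h)"
  for f h :: "real^2 \<Rightarrow> real"
  using landau_o.big.mult[OF const_bigo[of a], of f h] by simp

lemma norm_bigo_1: "(\<lambda>u::real^2. norm u) \<in> O[nhds 0](\<lambda>u. 1)"
proof (rule bigoI[of _ 1])
  show "eventually (\<lambda>u::real^2. norm (norm u) \<le> 1 * norm (1::real)) (nhds 0)"
    using order_tendstoD(2)[OF norm_to_0 zero_less_one] by (rule eventually_mono) auto
qed

lemma cubic_smallo:
  "(\<lambda>u. u$i * u$j * u$k) \<in> o[nhds 0](\<lambda>u::real^2. (norm u)\<^sup>2)"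
proof -
  have "(\<lambda>u. u$i * u$j * u$k) \<in> O[nhds 0](\<lambda>u::real^2. norm u * norm u * norm u)"
    by (intro landau_o.big.mult coord_bigo)
  then show ?thesis
    using norm_cube_smallo landau_o.big_small_trans by (simp add: power3_eq_cube) blast
qed

lemma jet2_bigo:
  assumes "jet2 f a b\<^sub>1 b\<^sub>2 c\<^sub>1 c\<^sub>2 c\<^sub>3"
  shows "f \<in> O[nhds 0](\<lambda>u. 1)" "a = 0 \<Longrightarrow> f \<in> O[nhds 0](\<lambda>u. norm u)"
proof -
  let ?p = "\<lambda>u::real^2. a + b\<^sub>1 * u$1 + b\<^sub>2 * u$2 + c\<^sub>1 * (u$1)\<^sup>2 + c\<^sub>2 * (u$1 * u$2) + c\<^sub>3 * (u$2)\<^sup>2"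
  let ?q = "\<lambda>u::real^2. b\<^sub>1 * u$1 + b\<^sub>2 * u$2 + c\<^sub>1 * (u$1)\<^sup>2 + c\<^sub>2 * (u$1 * u$2) + c\<^sub>3 * (u$2)\<^sup>2"
  have c1: "(\<lambda>u::real^2. u$i) \<in> O[nhds 0](\<lambda>u. 1)" for i
    using coord_bigo norm_bigo_1 landau_o.big_trans by blast
  have c2: "(\<lambda>u::real^2. u$i * u$j) \<in> O[nhds 0](\<lambda>u. norm u)" for i j
    using landau_o.big.mult[OF coord_bigo[of i] c1[of j]] by simp
  have "(\<lambda>u. (norm u)\<^sup>2) \<in> O[nhds 0](\<lambda>u::real^2. norm u)"
    using landau_o.big.mult[OF landau_o.big_refl norm_bigo_1] by (simp add: power2_eq_square)
  then have r: "(\<lambda>u. f u - ?p u) \<in> O[nhds 0](\<lambda>u. norm u)"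
    using assms landau_o.small_big_trans landau_o.small_imp_big unfolding jet2_def by blast
  have q: "?q \<in> O[nhds 0](\<lambda>u. norm u)"
    unfolding power2_eq_square
    by (intro sum_in_bigo cmult_bigo coord_bigo c2)
  have s: "(\<lambda>u. f u - a) \<in> O[nhds 0](\<lambda>u. norm u)"
    using sum_in_bigo(1)[OF r q] by (simp add: algebra_simps)
  then show "a = 0 \<Longrightarrow> f \<in> O[nhds 0](\<lambda>u. norm u)" by simp
  have "(\<lambda>u. f u - a) \<in> O[nhds 0](\<lambda>u. 1)"
    using s norm_bigo_1 landau_o.big_trans by blast
  from sum_in_bigo(1)[OF this const_bigo[of a]] show "f \<in> O[nhds 0](\<lambda>u. 1)" by simp
qed

text \<open>With \<open>?p\<close> and \<open>?q\<close> the two quadratic polynomials,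
  \<open>f * h\<close> is \<open>(f - ?p) * h + ?p * (h - ?q) + ?p * ?q\<close>. The first two
  summands are negligible, and of the last one the terms of degree at most two remain.\<close>

lemma jet2_mult:
  assumes f: "jet2 f a b\<^sub>1 b\<^sub>2 c\<^sub>1 c\<^sub>2 c\<^sub>3" and h: "jet2 h a' b\<^sub>1' b\<^sub>2' c\<^sub>1' c\<^sub>2' c\<^sub>3'"
  shows "jet2 (\<lambda>u. f u * h u) (a * a') (a * b\<^sub>1' + b\<^sub>1 * a') (a * b\<^sub>2' + b\<^sub>2 * a')
    (a * c\<^sub>1' + b\<^sub>1 * b\<^sub>1' + c\<^sub>1 * a') (a * c\<^sub>2' + b\<^sub>1 * b\<^sub>2' + b\<^sub>2 * b\<^sub>1' + c\<^sub>2 * a')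
    (a * c\<^sub>3' + b\<^sub>2 * b\<^sub>2' + c\<^sub>3 * a')"
proof -
  let ?p = "\<lambda>u::real^2. a + b\<^sub>1 * u$1 + b\<^sub>2 * u$2 + c\<^sub>1 * (u$1)\<^sup>2 + c\<^sub>2 * (u$1 * u$2) + c\<^sub>3 * (u$2)\<^sup>2"
  let ?q = "\<lambda>u::real^2. a' + b\<^sub>1' * u$1 + b\<^sub>2' * u$2 + c\<^sub>1' * (u$1)\<^sup>2 + c\<^sub>2' * (u$1 * u$2) + c\<^sub>3' * (u$2)\<^sup>2"
  have 1: "(\<lambda>u. (f u - ?p u) * h u) \<in> o[nhds 0](\<lambda>u. (norm u)\<^sup>2)"
    using landau_o.small_big_mult[OF f[unfolded jet2_def] jet2_bigo(1)[OF h]] by simp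
  have 2: "(\<lambda>u. ?p u * (h u - ?q u)) \<in> o[nhds 0](\<lambda>u. (norm u)\<^sup>2)"
    using landau_o.big_small_mult[OF jet2_bigo(1)[OF jet2_poly] h[unfolded jet2_def]] by simp
  note cub = cubic_smallo
  have lin: "(\<lambda>u::real^2. u$i * u$j * u$k * (x + y * u$1 + z * u$2)) \<in> o[nhds 0](\<lambda>u. (norm u)\<^sup>2)"
    for i j k :: 2 and x y z
    using landau_o.small_big_mult[OF cub jet2_bigo(1)[OF jet2_poly[of x y z 0 0 0]], of i j k] by simp
  \<comment> \<open>The terms of degree 3 and 4 of \<open>?p * ?q\<close>, grouped as cubic
    monomials times linear polynomials so that \<open>lin\<close> applies.\<close>
  have 3: "(\<lambda>u::real^2. u$1 * u$1 * u$1 * ((b\<^sub>1 * c\<^sub>1' + c\<^sub>1 * b\<^sub>1') + c\<^sub>1 * c\<^sub>1' * u$1 + (c\<^sub>1 * c\<^sub>2' + c\<^sub>2 * c\<^sub>1') * u$2)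
      + u$1 * u$1 * u$2 * ((b\<^sub>1 * c\<^sub>2' + c\<^sub>2 * b\<^sub>1' + b\<^sub>2 * c\<^sub>1' + c\<^sub>1 * b\<^sub>2') + 0 * u$1 + (c\<^sub>2 * c\<^sub>2' + c\<^sub>1 * c\<^sub>3' + c\<^sub>3 * c\<^sub>1') * u$2)
      + u$1 * u$2 * u$2 * ((b\<^sub>1 * c\<^sub>3' + c\<^sub>3 * b\<^sub>1' + b\<^sub>2 * c\<^sub>2' + c\<^sub>2 * b\<^sub>2') + 0 * u$1 + (c\<^sub>2 * c\<^sub>3' + c\<^sub>3 * c\<^sub>2') * u$2)
      + u$2 * u$2 * u$2 * ((b\<^sub>2 * c\<^sub>3' + c\<^sub>3 * b\<^sub>2') + 0 * u$1 + c\<^sub>3 * c\<^sub>3' * u$2)) \<in> o[nhds 0](\<lambda>u. (norm u)\<^sup>2)"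
    by (intro sum_in_smallo lin)
  show ?thesis
    unfolding jet2_def
    by (rule arg_cong[of _ _ "\<lambda>f. f \<in> _", THEN iffD1, OF _ sum_in_smallo(1)[OF sum_in_smallo(1)[OF 1 2] 3]])
      (rule ext, simp add: algebra_simps power2_eq_square)
qed

text \<open>The jets of \<open>P\<close> have no constant term, so \<open>norm (P u)\<close> is of
  the order of \<open>norm u\<close> and the error of \<open>f\<close> stays negligible after the
  substitution; the rest is arithmetic of jets.\<close>

lemma jet2_compose:
  assumes f: "jet2 f a b\<^sub>1 b\<^sub>2 c\<^sub>1 c\<^sub>2 c\<^sub>3"
    and p: "jet2 (\<lambda>u. P u $ 1) 0 p\<^sub>1 p\<^sub>2 p\<^sub>3 p\<^sub>4 p\<^sub>5" and q: "jet2 (\<lambda>u. P u $ 2) 0 q\<^sub>1 q\<^sub>2 q\<^sub>3 q\<^sub>4 q\<^sub>5"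
  shows "jet2 (\<lambda>u. f (P u)) a (b\<^sub>1 * p\<^sub>1 + b\<^sub>2 * q\<^sub>1) (b\<^sub>1 * p\<^sub>2 + b\<^sub>2 * q\<^sub>2)
     (b\<^sub>1 * p\<^sub>3 + b\<^sub>2 * q\<^sub>3 + c\<^sub>1 * (p\<^sub>1 * p\<^sub>1) + c\<^sub>2 * (p\<^sub>1 * q\<^sub>1) + c\<^sub>3 * (q\<^sub>1 * q\<^sub>1))
     (b\<^sub>1 * p\<^sub>4 + b\<^sub>2 * q\<^sub>4 + c\<^sub>1 * (2 * p\<^sub>1 * p\<^sub>2) + c\<^sub>2 * (p\<^sub>1 * q\<^sub>2 + p\<^sub>2 * q\<^sub>1) + c\<^sub>3 * (2 * q\<^sub>1 * q\<^sub>2))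
     (b\<^sub>1 * p\<^sub>5 + b\<^sub>2 * q\<^sub>5 + c\<^sub>1 * (p\<^sub>2 * p\<^sub>2) + c\<^sub>2 * (p\<^sub>2 * q\<^sub>2) + c\<^sub>3 * (q\<^sub>2 * q\<^sub>2))"
proof -
  have bo: "(\<lambda>u. norm (P u)) \<in> O[nhds 0](\<lambda>u. norm u)"
  proof -
    have "(\<lambda>u. \<bar>P u $ 1\<bar> + \<bar>P u $ 2\<bar>) \<in> O[nhds 0](\<lambda>u. norm u)"
      using sum_in_bigo(1)[of "\<lambda>u. \<bar>P u $ 1\<bar>" "nhds 0" norm "\<lambda>u. \<bar>P u $ 2\<bar>"]
        jet2_bigo(2)[OF p] jet2_bigo(2)[OF q] by simp
    moreover have "(\<lambda>u. norm (P u)) \<in> O[nhds 0](\<lambda>u. \<bar>P u $ 1\<bar> + \<bar>P u $ 2\<bar>)"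
      using norm_le_l1_cart[of "P _"] by (intro bigoI[of _ 1] always_eventually) (simp add: UNIV_2)
    ultimately show ?thesis using landau_o.big_trans by blast
  qed
  have lim: "filterlim P (nhds 0) (nhds 0)"
  proof -
    obtain c where "eventually (\<lambda>u. norm (norm (P u)) \<le> c * norm (norm u)) (nhds 0)"
      using landau_o.bigE[OF bo] by blast
    then show ?thesis
      by (intro Lim_null_comparison[of P "\<lambda>u. c * norm u"] tendsto_mult_right_zero norm_to_0) simp
  qed
  have "(\<lambda>u. f (P u) - (a + b\<^sub>1 * P u$1 + b\<^sub>2 * P u$2 + c\<^sub>1 * (P u$1)\<^sup>2 + c\<^sub>2 * (P u$1 * P u$2) + c\<^sub>3 * (P u$2)\<^sup>2))
      \<in> o[nhds 0](\<lambda>u. (norm (P u))\<^sup>2)"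
    using landau_o.small.compose[OF f[unfolded jet2_def] lim] by simp
  moreover have "(\<lambda>u. (norm (P u))\<^sup>2) \<in> O[nhds 0](\<lambda>u. (norm u)\<^sup>2)"
    using landau_o.big.mult[OF bo bo] by (simp add: power2_eq_square)
  ultimately have r: "jet2 (\<lambda>u. f (P u) - (a + b\<^sub>1 * P u$1 + b\<^sub>2 * P u$2 + c\<^sub>1 * (P u$1)\<^sup>2 + c\<^sub>2 * (P u$1 * P u$2) + c\<^sub>3 * (P u$2)\<^sup>2)) 0 0 0 0 0 0"
    unfolding jet2_def using landau_o.small_big_trans by simp
  have c: "jet2 (\<lambda>u. x) x 0 0 0 0 0" for x
    using jet2_poly[of x 0 0 0 0 0] by simp
  show ?thesis
    by (rule jet2_cong[OF jet2_add[OF r jet2_add[OF jet2_add[OF jet2_add[OF jet2_add[OF jet2_add[OF c[of a]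
       jet2_mult[OF c[of b\<^sub>1] p]] jet2_mult[OF c[of b\<^sub>2] q]] jet2_mult[OF c[of c\<^sub>1] jet2_mult[OF p p]]]
       jet2_mult[OF c[of c\<^sub>2] jet2_mult[OF p q]]] jet2_mult[OF c[of c\<^sub>3] jet2_mult[OF q q]]]]])
      (simp_all add: algebra_simps power2_eq_square)
qed

section \<open>Taylor expansion from differentiability of the first partials at one point\<close>

lemma partial_derivI:
  "(f has_derivative f') (at x) \<Longrightarrow> partial_deriv i f x = f' (axis i 1)"
  unfolding partial_deriv_def using frechet_derivative_at[of f f' x] by simp

lemma has_derivative_partial:
  fixes f :: "real^2 \<Rightarrow> real"
  assumes "f differentiable at x"
  shows "(f has_derivative (\<lambda>v. v$1 * partial_deriv 1 f x + v$2 * partial_deriv 2 f x)) (at x)"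
proof -
  let ?f' = "frechet_derivative f (at x)"
  have d: "(f has_derivative ?f') (at x)"
    using assms frechet_derivative_works by blast
  have "?f' v = v$1 * partial_deriv 1 f x + v$2 * partial_deriv 2 f x" for v
  proof -
    have "v = v$1 *\<^sub>R axis 1 1 + v$2 *\<^sub>R axis 2 1"
      by (simp add: vec_eq_iff axis_def forall_2)
    then have "?f' v = ?f' (v$1 *\<^sub>R axis 1 1 + v$2 *\<^sub>R axis 2 1)" by simp
    also have "\<dots> = v$1 * partial_deriv 1 f x + v$2 * partial_deriv 2 f x"
      using has_derivative_linear[OF d] unfolding partial_deriv_def by (simp add: linear_add linear_cmul)
    finally show ?thesis .
  qed
  then have "?f' = (\<lambda>v. v$1 * partial_deriv 1 f x + v$2 * partial_deriv 2 f x)" by (rule ext)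
  then show ?thesis using d by metis
qed

text \<open>A weak form that suffices for the second order Taylor expansion at \<open>x\<close>.\<close>

definition twice_differentiable :: "(real^2 \<Rightarrow> real) \<Rightarrow> real^2 \<Rightarrow> bool" where
  "twice_differentiable f x \<longleftrightarrow> (\<exists>\<rho>>0. \<forall>y\<in>ball x \<rho>. f differentiable at y) \<and>
     (\<forall>i. partial_deriv i f differentiable at x)"

lemma twice_differentiable_approx:
  assumes "twice_differentiable f x" "0 < \<epsilon>"
  obtains \<delta> where "\<delta> > 0" "\<And>y. y \<in> ball x \<delta> \<Longrightarrow> f differentiable at y"
    "\<And>h i. norm h < \<delta> \<Longrightarrow> \<bar>partial_deriv i f (x + h) - partial_deriv i f x -
      (h$1 * partial_deriv 1 (partial_deriv i f) x + h$2 * partial_deriv 2 (partial_deriv i f) x)\<bar> \<le> \<epsilon> * norm h"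
proof -
  obtain \<rho> where \<rho>: "\<rho> > 0" "\<forall>y\<in>ball x \<rho>. f differentiable at y"
    using assms(1) unfolding twice_differentiable_def by blast
  have "\<exists>d>0. \<forall>h. norm h < d \<longrightarrow> \<bar>partial_deriv i f (x + h) - partial_deriv i f x -
      (h$1 * partial_deriv 1 (partial_deriv i f) x + h$2 * partial_deriv 2 (partial_deriv i f) x)\<bar> \<le> \<epsilon> * norm h" for i
  proof -
    have "partial_deriv i f differentiable at x"
      using assms(1) unfolding twice_differentiable_def by blast
    from has_derivative_partial[OF this] obtain d where "d > 0" and d: "\<And>y. norm (y - x) < d \<Longrightarrow>
       norm (partial_deriv i f y - partial_deriv i f x - ((y - x)$1 * partial_deriv 1 (partial_deriv i f) x +
         (y - x)$2 * partial_deriv 2 (partial_deriv i f) x)) \<le> \<epsilon> * norm (y - x)"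
      unfolding has_derivative_at_alt using assms(2) by meson
    then show ?thesis using d[of "x + _"] by (intro exI[of _ d]) simp
  qed
  then obtain D where D: "\<And>i. D i > 0" "\<And>i h. norm h < D i \<Longrightarrow> \<bar>partial_deriv i f (x + h) - partial_deriv i f x -
      (h$1 * partial_deriv 1 (partial_deriv i f) x + h$2 * partial_deriv 2 (partial_deriv i f) x)\<bar> \<le> \<epsilon> * norm h"
    by metis
  show ?thesis
  proof (rule that[of "min \<rho> (min (D 1) (D 2))"])
    show "min \<rho> (min (D 1) (D 2)) > 0" using \<rho> D by simp
    show "f differentiable at y" if "y \<in> ball x (min \<rho> (min (D 1) (D 2)))" for y
      using that \<rho>(2) by simp
    show "\<bar>partial_deriv i f (x + h) - partial_deriv i f x -
      (h$1 * partial_deriv 1 (partial_deriv i f) x + h$2 * partial_deriv 2 (partial_deriv i f) x)\<bar> \<le> \<epsilon> * norm h"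
      if "norm h < min \<rho> (min (D 1) (D 2))" for h i
      using D(2)[of h i] that exhaust_2[of i] by auto
  qed
qed

lemma partial_deriv_line:
  fixes f :: "real^2 \<Rightarrow> real"
  assumes "f differentiable at (x + s *\<^sub>R h)"
  shows "((\<lambda>s. f (x + s *\<^sub>R h)) has_real_derivative
      h$1 * partial_deriv 1 f (x + s *\<^sub>R h) + h$2 * partial_deriv 2 f (x + s *\<^sub>R h)) (at s)"
proof -
  have "((\<lambda>s. x + s *\<^sub>R h) has_derivative (\<lambda>t. t *\<^sub>R h)) (at s)"
    by (auto intro!: derivative_eq_intros)
  from has_derivative_compose[OF this has_derivative_partial[OF assms]]
  show ?thesis
    unfolding has_field_derivative_def by (rule has_derivative_eq_rhs) (auto simp: algebra_simps)
qed

text \<open>Young's form of the symmetry, with second partials at \<open>x\<close> alone. The second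
  difference over a square of side \<open>t\<close> is symmetric in the two directions, and the mean
  value theorem in either direction compares it with \<open>t\<^sup>2\<close> times a mixed
  partial.\<close>

lemma mixed_partials:
  assumes f: "twice_differentiable f x"
  shows "partial_deriv 1 (partial_deriv 2 f) x = partial_deriv 2 (partial_deriv 1 f) x"
proof -
  let ?p = "\<lambda>i j. partial_deriv i (partial_deriv j f) x"
  let ?e = "\<lambda>i. axis i 1 :: real^2"
  have "\<bar>?p 1 2 - ?p 2 1\<bar> \<le> 8 * \<epsilon>" if \<epsilon>: "\<epsilon> > 0" for \<epsilon>
  proof -
    obtain \<delta> where \<delta>: "\<delta> > 0" "\<And>y. y \<in> ball x \<delta> \<Longrightarrow> f differentiable at y"
      "\<And>h i. norm h < \<delta> \<Longrightarrow> \<bar>partial_deriv i f (x + h) - partial_deriv i f x -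
        (h$1 * ?p 1 i + h$2 * ?p 2 i)\<bar> \<le> \<epsilon> * norm h"
      by (rule twice_differentiable_approx[OF f \<epsilon>]) (rule that)
    \<comment> \<open>All points of the square are then within \<open>2 * t < \<delta>\<close> of
      \<open>x\<close>.\<close>
    define t where "t = \<delta> / 3"
    have t: "t > 0" "2 * t < \<delta>" using \<delta>(1) unfolding t_def by auto
    define \<Delta> where "\<Delta> = f (x + t *\<^sub>R ?e 1 + t *\<^sub>R ?e 2) - f (x + t *\<^sub>R ?e 1) - f (x + t *\<^sub>R ?e 2) + f x"
    have key: "\<bar>\<Delta> - t\<^sup>2 * ?p j i\<bar> \<le> 4 * \<epsilon> * t\<^sup>2"
      if ij: "{i, j} = {1, 2::2}" and
        \<Delta>: "\<Delta> = f (x + t *\<^sub>R ?e j + t *\<^sub>R ?e i) - f (x + 0 *\<^sub>R ?e j + t *\<^sub>R ?e i) - (f (x + t *\<^sub>R ?e j + 0 *\<^sub>R ?e i) - f (x + 0 *\<^sub>R ?e j + 0 *\<^sub>R ?e i))" for i j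
    proof -
      let ?\<phi> = "\<lambda>s. f (x + t *\<^sub>R ?e j + s *\<^sub>R ?e i) - f (x + s *\<^sub>R ?e i)"
      have nm: "norm (a *\<^sub>R ?e j + b *\<^sub>R ?e i) \<le> \<bar>a\<bar> + \<bar>b\<bar>" for a b
        using norm_triangle_ineq[of "a *\<^sub>R ?e j" "b *\<^sub>R ?e i"] by simp
      have pd: "?e i$1 * partial_deriv 1 f y + ?e i$2 * partial_deriv 2 f y = partial_deriv i f y" for y
        using exhaust_2[of i] by (auto simp: axis_def)
      have der: "(?\<phi> has_real_derivative (partial_deriv i f (x + t *\<^sub>R ?e j + s *\<^sub>R ?e i) - partial_deriv i f (x + s *\<^sub>R ?e i))) (at s)"
        if s: "0 \<le> s" "s \<le> t" for s
      proof -
        have "x + t *\<^sub>R ?e j + s *\<^sub>R ?e i \<in> ball x \<delta>" "x + s *\<^sub>R ?e i \<in> ball x \<delta>"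
          unfolding mem_ball dist_commute[of x] using nm[of t s] nm[of 0 s] s t by (auto simp: dist_norm add.assoc)
        from this[THEN \<delta>(2), THEN partial_deriv_line]
        show ?thesis unfolding pd by (rule DERIV_diff)
      qed
      obtain \<xi> where \<xi>: "0 < \<xi>" "\<xi> < t" "?\<phi> t - ?\<phi> 0 = (t - 0) * (partial_deriv i f (x + t *\<^sub>R ?e j + \<xi> *\<^sub>R ?e i) - partial_deriv i f (x + \<xi> *\<^sub>R ?e i))"
        using MVT2[OF t(1) der] by auto
      have "\<Delta> = ?\<phi> t - ?\<phi> 0" unfolding \<Delta> by (simp add: algebra_simps)
      then have \<Delta>': "\<Delta> = t * (partial_deriv i f (x + (t *\<^sub>R ?e j + \<xi> *\<^sub>R ?e i)) - partial_deriv i f (x + (0 *\<^sub>R ?e j + \<xi> *\<^sub>R ?e i)))"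
        using \<xi>(3) by (simp add: add.assoc)
      \<comment> \<open>Used at \<open>a = t\<close> and \<open>a = 0\<close>: in the difference the
        terms with \<open>?p i i\<close> cancel, and the two errors add up to
        \<open>4 * \<epsilon> * t\<close>.\<close>
      have b: "\<bar>partial_deriv i f (x + (a *\<^sub>R ?e j + \<xi> *\<^sub>R ?e i)) - partial_deriv i f x -
          (a * ?p j i + \<xi> * ?p i i)\<bar> \<le> \<epsilon> * (2 * t)" if "0 \<le> a" "a \<le> t" for a
      proof -
        let ?h = "a *\<^sub>R ?e j + \<xi> *\<^sub>R ?e i"
        have "norm ?h \<le> 2 * t" using nm[of a \<xi>] that \<xi> by simp
        moreover have "?h$1 * ?p 1 i + ?h$2 * ?p 2 i = a * ?p j i + \<xi> * ?p i i"
          using ij by (auto simp: axis_def doubleton_eq_iff)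
        ultimately show ?thesis
          using \<delta>(3)[of ?h i] t(2) mult_left_mono[of "norm ?h" "2 * t" \<epsilon>] \<epsilon> by (smt (verit))
      qed
      have "\<bar>(partial_deriv i f (x + (t *\<^sub>R ?e j + \<xi> *\<^sub>R ?e i)) - partial_deriv i f (x + (0 *\<^sub>R ?e j + \<xi> *\<^sub>R ?e i))) - t * ?p j i\<bar> \<le> \<epsilon> * (4 * t)"
        using b[of t] b[of 0] t(1) by (simp add: abs_le_iff)
      then have "t * \<bar>(partial_deriv i f (x + (t *\<^sub>R ?e j + \<xi> *\<^sub>R ?e i)) - partial_deriv i f (x + (0 *\<^sub>R ?e j + \<xi> *\<^sub>R ?e i))) - t * ?p j i\<bar> \<le> t * (\<epsilon> * (4 * t))"
        using t(1) by (intro mult_left_mono) auto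
      moreover have "\<Delta> - t\<^sup>2 * ?p j i = t * ((partial_deriv i f (x + (t *\<^sub>R ?e j + \<xi> *\<^sub>R ?e i)) - partial_deriv i f (x + (0 *\<^sub>R ?e j + \<xi> *\<^sub>R ?e i))) - t * ?p j i)"
        unfolding \<Delta>' power2_eq_square by (simp only: right_diff_distrib mult.assoc)
      ultimately show ?thesis
        using t(1) by (simp only: abs_mult abs_of_pos power2_eq_square ac_simps)
    qed
    have "\<bar>\<Delta> - t\<^sup>2 * ?p 1 2\<bar> \<le> 4 * \<epsilon> * t\<^sup>2"
      by (rule key) (auto simp: \<Delta>_def)
    moreover have "\<bar>\<Delta> - t\<^sup>2 * ?p 2 1\<bar> \<le> 4 * \<epsilon> * t\<^sup>2"
      by (rule key) (auto simp: \<Delta>_def algebra_simps)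
    ultimately have "\<bar>t\<^sup>2 * ?p 1 2 - t\<^sup>2 * ?p 2 1\<bar> \<le> 8 * \<epsilon> * t\<^sup>2"
      by linarith
    then have "t\<^sup>2 * \<bar>?p 1 2 - ?p 2 1\<bar> \<le> t\<^sup>2 * (8 * \<epsilon>)"
      by (simp only: abs_mult abs_power2 mult.commute flip: right_diff_distrib)
    then show ?thesis using t(1) by simp
  qed
  \<comment> \<open>With this \<epsilon> the difference is bounded by half of itself.\<close>
  from this[of "\<bar>?p 1 2 - ?p 2 1\<bar> / 16"] show ?thesis
    by (cases "\<bar>?p 1 2 - ?p 2 1\<bar> = 0") auto
qed

text \<open>The mean value theorem is applied on a segment to \<open>f\<close> minus a quadratic
  polynomial; the derivative of this function is the error of linearising the first partials, small
  by assumption. The mixed coefficient unites two second partials, hence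
  \<open>mixed_partials\<close>.\<close>

lemma jet2_taylor:
  assumes f: "twice_differentiable f x"
  shows "jet2 (\<lambda>h. f (x + h)) (f x) (partial_deriv 1 f x) (partial_deriv 2 f x)
    (partial_deriv 1 (partial_deriv 1 f) x / 2) (partial_deriv 1 (partial_deriv 2 f) x)
    (partial_deriv 2 (partial_deriv 2 f) x / 2)"
  unfolding jet2_def
proof (rule landau_o.smallI)
  fix c :: real assume "c > 0"
  \<comment> \<open>Half of \<open>c\<close> for each of the two coordinates.\<close>
  then have "c / 2 > 0" by simp
  let ?p = "\<lambda>i j. partial_deriv i (partial_deriv j f) x"
  obtain \<delta> where \<delta>: "\<delta> > 0" "\<And>y. y \<in> ball x \<delta> \<Longrightarrow> f differentiable at y"
      "\<And>h i. norm h < \<delta> \<Longrightarrow> \<bar>partial_deriv i f (x + h) - partial_deriv i f x -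
        (h$1 * ?p 1 i + h$2 * ?p 2 i)\<bar> \<le> c / 2 * norm h"
    by (rule twice_differentiable_approx[OF f \<open>c / 2 > 0\<close>]) (rule that)
  have "eventually (\<lambda>u::real^2. norm u < \<delta>) (nhds 0)"
    using order_tendstoD(2)[OF norm_to_0 \<delta>(1)] .
  then show "eventually (\<lambda>h. norm (f (x + h) - (f x + partial_deriv 1 f x * h$1 + partial_deriv 2 f x * h$2 +
      ?p 1 1 / 2 * (h$1)\<^sup>2 + ?p 1 2 * (h$1 * h$2) + ?p 2 2 / 2 * (h$2)\<^sup>2)) \<le> c * norm ((norm h)\<^sup>2)) (nhds 0)"
  proof eventually_elim
    case (elim h)
    define q where "q = ?p 1 1 * (h$1)\<^sup>2 + 2 * ?p 1 2 * (h$1 * h$2) + ?p 2 2 * (h$2)\<^sup>2"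
    define l where "l = partial_deriv 1 f x * h$1 + partial_deriv 2 f x * h$2"
    \<comment> \<open>The subtracted polynomial has the derivative \<open>l + s * q\<close>, which
      is the linearisation of \<open>?D s\<close>.\<close>
    let ?\<phi> = "\<lambda>s. f (x + s *\<^sub>R h) - (s * l + s\<^sup>2 / 2 * q)"
    let ?D = "\<lambda>s. h$1 * partial_deriv 1 f (x + s *\<^sub>R h) + h$2 * partial_deriv 2 f (x + s *\<^sub>R h)"
    have nm: "norm (s *\<^sub>R h) \<le> norm h" "x + s *\<^sub>R h \<in> ball x \<delta>" if "0 \<le> s" "s \<le> 1" for s
    proof -
      show "norm (s *\<^sub>R h) \<le> norm h"
        using that mult_right_mono[of s 1 "norm h"] by simp
      then show "x + s *\<^sub>R h \<in> ball x \<delta>" using elim by (simp add: dist_norm)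
    qed
    have "(?\<phi> has_real_derivative ?D s - (l + s * q)) (at s)" if "0 \<le> s" "s \<le> 1" for s
      by (rule DERIV_diff[OF partial_deriv_line[OF \<delta>(2)[OF nm(2)[OF that]]]])
        (auto intro!: derivative_eq_intros)
    from MVT2[OF zero_less_one this] obtain s where s: "0 < s" "s < 1" "?\<phi> 1 - ?\<phi> 0 = ?D s - (l + s * q)"
      by auto
    let ?r = "\<lambda>i. partial_deriv i f (x + s *\<^sub>R h) - partial_deriv i f x - ((s *\<^sub>R h)$1 * ?p 1 i + (s *\<^sub>R h)$2 * ?p 2 i)"
    have "\<bar>?r i\<bar> \<le> c / 2 * norm h" for i
    proof -
      have "norm (s *\<^sub>R h) < \<delta>" using nm(1)[of s] elim s by linarith
      from \<delta>(3)[OF this, of i] have "\<bar>?r i\<bar> \<le> c / 2 * norm (s *\<^sub>R h)" .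
      also have "\<dots> \<le> c / 2 * norm h"
        using nm(1)[of s] s \<open>c > 0\<close> by (intro mult_left_mono) auto
      finally show ?thesis .
    qed
    then have "\<bar>h$i * ?r i\<bar> \<le> norm h * (c / 2 * norm h)" for i
      unfolding abs_mult by (intro mult_mono component_le_norm_cart) auto
    moreover have "norm h * (c / 2 * norm h) = c * (norm h)\<^sup>2 / 2"
      by (simp add: power2_eq_square)
    ultimately have "\<bar>h$i * ?r i\<bar> \<le> c * (norm h)\<^sup>2 / 2" for i
      by metis
    from this[of 1] this[of 2] have "\<bar>h$1 * ?r 1 + h$2 * ?r 2\<bar> \<le> c * (norm h)\<^sup>2"
      using abs_triangle_ineq[of "h$1 * ?r 1" "h$2 * ?r 2"] by linarith
    moreover have "h$1 * ?r 1 + h$2 * ?r 2 = ?D s - (l + s * q)"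
      using mixed_partials[OF f] unfolding l_def q_def by (simp add: algebra_simps power2_eq_square)
    ultimately have "\<bar>?\<phi> 1 - ?\<phi> 0\<bar> \<le> c * (norm h)\<^sup>2"
      unfolding s(3) by simp
    then show ?case
      unfolding l_def q_def by (simp add: algebra_simps)
  qed
qed

section \<open>Normal form of the second order jet of a metric\<close>

text \<open>The metric in new coordinates involves first partials of the coordinate change, so its
  second order jet sees that change up to degree 3. \<open>cub\<^sub>1\<close> and
  \<open>cub\<^sub>2\<close> below are the partial derivatives.\<close>

definition cub :: "real \<Rightarrow> real \<Rightarrow> real \<Rightarrow> real \<Rightarrow> real \<Rightarrow> real \<Rightarrow> real \<Rightarrow> real \<Rightarrow> real \<Rightarrow> real^2 \<Rightarrow> real"
  where "cub p q c\<^sub>1 c\<^sub>2 c\<^sub>3 d\<^sub>1 d\<^sub>2 d\<^sub>3 d\<^sub>4 u = p * u$1 + q * u$2 + c\<^sub>1 * (u$1)\<^sup>2 + c\<^sub>2 * (u$1 * u$2) + c\<^sub>3 * (u$2)\<^sup>2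
    + d\<^sub>1 * (u$1)^3 + d\<^sub>2 * (u$1)\<^sup>2 * u$2 + d\<^sub>3 * u$1 * (u$2)\<^sup>2 + d\<^sub>4 * (u$2)^3"

definition cub\<^sub>1 :: "real \<Rightarrow> real \<Rightarrow> real \<Rightarrow> real \<Rightarrow> real \<Rightarrow> real \<Rightarrow> real \<Rightarrow> real \<Rightarrow> real \<Rightarrow> real^2 \<Rightarrow> real"
  where "cub\<^sub>1 p q c\<^sub>1 c\<^sub>2 c\<^sub>3 d\<^sub>1 d\<^sub>2 d\<^sub>3 d\<^sub>4 u = p + 2 * c\<^sub>1 * u$1 + c\<^sub>2 * u$2
    + 3 * d\<^sub>1 * (u$1)\<^sup>2 + 2 * d\<^sub>2 * (u$1 * u$2) + d\<^sub>3 * (u$2)\<^sup>2"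

definition cub\<^sub>2 :: "real \<Rightarrow> real \<Rightarrow> real \<Rightarrow> real \<Rightarrow> real \<Rightarrow> real \<Rightarrow> real \<Rightarrow> real \<Rightarrow> real \<Rightarrow> real^2 \<Rightarrow> real"
  where "cub\<^sub>2 p q c\<^sub>1 c\<^sub>2 c\<^sub>3 d\<^sub>1 d\<^sub>2 d\<^sub>3 d\<^sub>4 u = q + c\<^sub>2 * u$1 + 2 * c\<^sub>3 * u$2
    + d\<^sub>2 * (u$1)\<^sup>2 + 2 * d\<^sub>3 * (u$1 * u$2) + 3 * d\<^sub>4 * (u$2)\<^sup>2"

lemma cub_has_derivative:
  "(cub p q c\<^sub>1 c\<^sub>2 c\<^sub>3 d\<^sub>1 d\<^sub>2 d\<^sub>3 d\<^sub>4 has_derivative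
    (\<lambda>v. cub\<^sub>1 p q c\<^sub>1 c\<^sub>2 c\<^sub>3 d\<^sub>1 d\<^sub>2 d\<^sub>3 d\<^sub>4 u * v$1 + cub\<^sub>2 p q c\<^sub>1 c\<^sub>2 c\<^sub>3 d\<^sub>1 d\<^sub>2 d\<^sub>3 d\<^sub>4 u * v$2)) (at u)"
  unfolding cub_def[abs_def] cub\<^sub>1_def cub\<^sub>2_def
  by (rule has_derivative_eq_rhs,
      (rule derivative_intros bounded_linear.has_derivative[OF bounded_linear_vec_nth])+)
    (rule ext, simp add: algebra_simps power2_eq_square)

lemma cub_jet:
  "jet2 (cub p q c\<^sub>1 c\<^sub>2 c\<^sub>3 d\<^sub>1 d\<^sub>2 d\<^sub>3 d\<^sub>4) 0 p q c\<^sub>1 c\<^sub>2 c\<^sub>3"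
proof -
  have m: "(\<lambda>u. d * (u$i * u$j * u$k)) \<in> o[nhds 0](\<lambda>u::real^2. (norm u)\<^sup>2)" for d i j k
    using landau_o.big_small_mult[OF const_bigo[of d] cubic_smallo[of i j k]] by simp
  have "(\<lambda>u::real^2. d\<^sub>1 * (u$1 * u$1 * u$1) + d\<^sub>2 * (u$1 * u$1 * u$2) + d\<^sub>3 * (u$1 * u$2 * u$2) + d\<^sub>4 * (u$2 * u$2 * u$2))
      \<in> o[nhds 0](\<lambda>u. (norm u)\<^sup>2)"
    by (intro sum_in_smallo m)
  then show ?thesis
    unfolding jet2_def cub_def by (simp add: power2_eq_square power3_eq_cube ac_simps)
qed

lemma cub\<^sub>1_jet: "jet2 (cub\<^sub>1 p q c\<^sub>1 c\<^sub>2 c\<^sub>3 d\<^sub>1 d\<^sub>2 d\<^sub>3 d\<^sub>4) p (2 * c\<^sub>1) c\<^sub>2 (3 * d\<^sub>1) (2 * d\<^sub>2) d\<^sub>3"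
  unfolding cub\<^sub>1_def[abs_def] by (rule jet2_poly)

lemma cub\<^sub>2_jet: "jet2 (cub\<^sub>2 p q c\<^sub>1 c\<^sub>2 c\<^sub>3 d\<^sub>1 d\<^sub>2 d\<^sub>3 d\<^sub>4) q c\<^sub>2 (2 * c\<^sub>3) d\<^sub>2 (2 * d\<^sub>3) (3 * d\<^sub>4)"
  unfolding cub\<^sub>2_def[abs_def] by (rule jet2_poly)

text \<open>Cramer's rule; the matrix will be the metric at the base point.\<close>

lemma solve_2x2:
  fixes E F H m n :: real
  assumes "E * H - F\<^sup>2 \<noteq> 0"
  obtains a b where "E * a + F * b = m" "F * a + H * b = n"
proof -
  let ?D = "E * H - F\<^sup>2"
  have "E * ((H * m - F * n) / ?D) + F * ((E * n - F * m) / ?D) = (?D * m) / ?D"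
       "F * ((H * m - F * n) / ?D) + H * ((E * n - F * m) / ?D) = (?D * n) / ?D"
    unfolding times_divide_eq_right add_divide_distrib[symmetric]
    by (simp_all add: algebra_simps power2_eq_square)
  then show ?thesis
    by (intro that[of "(H * m - F * n) / ?D" "(E * n - F * m) / ?D"]) (use assms in simp_all)
qed

text \<open>The typical summand of a pulled back metric: one metric coefficient times two entries of
  the Jacobian matrix.\<close>

lemma jet2_form:
  assumes "jet2 E a a\<^sub>1 a\<^sub>2 a\<^sub>3 a\<^sub>4 a\<^sub>5" "jet2 p b b\<^sub>1 b\<^sub>2 b\<^sub>3 b\<^sub>4 b\<^sub>5" "jet2 q c c\<^sub>1 c\<^sub>2 c\<^sub>3 c\<^sub>4 c\<^sub>5"
  shows "jet2 (\<lambda>u. E u * p u * q u) (a * b * c)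
    (a\<^sub>1 * b * c + a * b\<^sub>1 * c + a * b * c\<^sub>1) (a\<^sub>2 * b * c + a * b\<^sub>2 * c + a * b * c\<^sub>2)
    (a\<^sub>3 * b * c + a * b\<^sub>3 * c + a * b * c\<^sub>3 + a\<^sub>1 * b\<^sub>1 * c + a\<^sub>1 * b * c\<^sub>1 + a * b\<^sub>1 * c\<^sub>1)
    (a\<^sub>4 * b * c + a * b\<^sub>4 * c + a * b * c\<^sub>4 + (a\<^sub>1 * b\<^sub>2 + a\<^sub>2 * b\<^sub>1) * c + (a\<^sub>1 * c\<^sub>2 + a\<^sub>2 * c\<^sub>1) * b + a * (b\<^sub>1 * c\<^sub>2 + b\<^sub>2 * c\<^sub>1))
    (a\<^sub>5 * b * c + a * b\<^sub>5 * c + a * b * c\<^sub>5 + a\<^sub>2 * b\<^sub>2 * c + a\<^sub>2 * b * c\<^sub>2 + a * b\<^sub>2 * c\<^sub>2)"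
  by (rule jet2_cong[OF jet2_mult[OF jet2_mult[OF assms(1,2)] assms(3)]]) (simp_all add: algebra_simps)

text \<open>The quadratic part of the new coordinates removes the first derivatives of the metric, and the
  cubic part brings the second derivatives into normal form. The cubic coefficients solve an
  overdetermined linear system (8 unknowns, 9 equations) whose compatibility condition is
  \<open>curv\<close>.\<close>

lemma normal_jets:
  fixes E F H :: "real^2 \<Rightarrow> real"
  assumes jE: "jet2 E E\<^sub>0 E\<^sub>1 E\<^sub>2 e\<^sub>1 e\<^sub>2 e\<^sub>3" and jF: "jet2 F F\<^sub>0 F\<^sub>1 F\<^sub>2 f\<^sub>1 f\<^sub>2 f\<^sub>3"
    and jH: "jet2 H H\<^sub>0 H\<^sub>1 H\<^sub>2 h\<^sub>1 h\<^sub>2 h\<^sub>3"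
    and E1: "E\<^sub>1 = 2 * (E\<^sub>0 * \<gamma>1 + F\<^sub>0 * \<delta>1)" and E2: "E\<^sub>2 = 2 * (E\<^sub>0 * \<gamma>2 + F\<^sub>0 * \<delta>2)"
    and H1: "H\<^sub>1 = 2 * (F\<^sub>0 * \<gamma>2 + H\<^sub>0 * \<delta>2)" and H2: "H\<^sub>2 = 2 * (F\<^sub>0 * \<gamma>3 + H\<^sub>0 * \<delta>3)"
    and F1: "F\<^sub>1 = F\<^sub>0 * \<gamma>1 + H\<^sub>0 * \<delta>1 + E\<^sub>0 * \<gamma>2 + F\<^sub>0 * \<delta>2"
    and F2: "F\<^sub>2 = F\<^sub>0 * \<gamma>2 + H\<^sub>0 * \<delta>2 + E\<^sub>0 * \<gamma>3 + F\<^sub>0 * \<delta>3"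
    and D: "E\<^sub>0 * H\<^sub>0 - F\<^sub>0\<^sup>2 = D" "D \<noteq> 0"
    and curv: "- D = f\<^sub>2 - h\<^sub>1 - e\<^sub>3 - (E\<^sub>1 * \<gamma>3 + F\<^sub>1 * \<delta>3 - E\<^sub>2 * \<gamma>2 - F\<^sub>2 * \<delta>2)
      + E\<^sub>0 * (\<gamma>1 * \<gamma>3 + \<gamma>2 * \<delta>3 - \<gamma>2 * \<gamma>2 - \<gamma>3 * \<delta>2)
      + F\<^sub>0 * (\<delta>1 * \<gamma>3 + \<delta>2 * \<delta>3 - \<delta>2 * \<gamma>2 - \<delta>3 * \<delta>2)"
  obtains a\<^sub>1 a\<^sub>2 a\<^sub>3 a\<^sub>4 b\<^sub>1 b\<^sub>2 b\<^sub>3 b\<^sub>4 :: real and P J11 J12 J21 J22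
  where "P = (\<lambda>u. cub 1 0 (- \<gamma>1 / 2) (- \<gamma>2) (- \<gamma>3 / 2) a\<^sub>1 a\<^sub>2 a\<^sub>3 a\<^sub>4 u *\<^sub>R axis 1 1
      + cub 0 1 (- \<delta>1 / 2) (- \<delta>2) (- \<delta>3 / 2) b\<^sub>1 b\<^sub>2 b\<^sub>3 b\<^sub>4 u *\<^sub>R axis (2::2) 1)"
    "J11 = cub\<^sub>1 1 0 (- \<gamma>1 / 2) (- \<gamma>2) (- \<gamma>3 / 2) a\<^sub>1 a\<^sub>2 a\<^sub>3 a\<^sub>4"
    "J12 = cub\<^sub>2 1 0 (- \<gamma>1 / 2) (- \<gamma>2) (- \<gamma>3 / 2) a\<^sub>1 a\<^sub>2 a\<^sub>3 a\<^sub>4"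
    "J21 = cub\<^sub>1 0 1 (- \<delta>1 / 2) (- \<delta>2) (- \<delta>3 / 2) b\<^sub>1 b\<^sub>2 b\<^sub>3 b\<^sub>4"
    "J22 = cub\<^sub>2 0 1 (- \<delta>1 / 2) (- \<delta>2) (- \<delta>3 / 2) b\<^sub>1 b\<^sub>2 b\<^sub>3 b\<^sub>4"
    "jet2 (\<lambda>u. E (P u) * J11 u * J11 u + 2 * (F (P u) * J11 u * J21 u) + H (P u) * J21 u * J21 u) E\<^sub>0 0 0 0 0 (D / 3)"
    "jet2 (\<lambda>u. E (P u) * J11 u * J12 u + F (P u) * J11 u * J22 u + F (P u) * J21 u * J12 u + H (P u) * J21 u * J22 u) F\<^sub>0 0 0 0 (- D / 3) 0"
    "jet2 (\<lambda>u. E (P u) * J12 u * J12 u + 2 * (F (P u) * J12 u * J22 u) + H (P u) * J22 u * J22 u) H\<^sub>0 0 0 (D / 3) 0 0"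
proof -
  \<comment> \<open>Second order coefficients of the pulled back metric before the cubic terms of
    the coordinate change contribute: \<open>S1\<close> to \<open>S3\<close> for the first diagonal
    entry, \<open>T1\<close> to \<open>T3\<close> off the diagonal, \<open>U1\<close> to
    \<open>U3\<close> for the second diagonal entry, in the order of the monomials in
    \<open>jet2\<close>.\<close>
  define S1 where "S1 = e\<^sub>1 - (E\<^sub>1 * \<gamma>1 + E\<^sub>2 * \<delta>1) / 2 - 2 * \<gamma>1 * E\<^sub>1 - 2 * \<delta>1 * F\<^sub>1 + E\<^sub>0 * \<gamma>1\<^sup>2 + 2 * F\<^sub>0 * \<gamma>1 * \<delta>1 + H\<^sub>0 * \<delta>1\<^sup>2"
  define S2 where "S2 = e\<^sub>2 - (E\<^sub>1 * \<gamma>2 + E\<^sub>2 * \<delta>2) - 2 * (\<gamma>1 * E\<^sub>2 + \<gamma>2 * E\<^sub>1) - 2 * (\<delta>1 * F\<^sub>2 + \<delta>2 * F\<^sub>1)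
    + 2 * E\<^sub>0 * \<gamma>1 * \<gamma>2 + 2 * F\<^sub>0 * (\<gamma>1 * \<delta>2 + \<gamma>2 * \<delta>1) + 2 * H\<^sub>0 * \<delta>1 * \<delta>2"
  define S3 where "S3 = e\<^sub>3 - (E\<^sub>1 * \<gamma>3 + E\<^sub>2 * \<delta>3) / 2 - 2 * \<gamma>2 * E\<^sub>2 - 2 * \<delta>2 * F\<^sub>2 + E\<^sub>0 * \<gamma>2\<^sup>2 + 2 * F\<^sub>0 * \<gamma>2 * \<delta>2 + H\<^sub>0 * \<delta>2\<^sup>2"
  define U1 where "U1 = h\<^sub>1 - (H\<^sub>1 * \<gamma>1 + H\<^sub>2 * \<delta>1) / 2 - 2 * \<delta>2 * H\<^sub>1 - 2 * \<gamma>2 * F\<^sub>1 + E\<^sub>0 * \<gamma>2\<^sup>2 + 2 * F\<^sub>0 * \<gamma>2 * \<delta>2 + H\<^sub>0 * \<delta>2\<^sup>2"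
  define U2 where "U2 = h\<^sub>2 - (H\<^sub>1 * \<gamma>2 + H\<^sub>2 * \<delta>2) - 2 * (\<delta>2 * H\<^sub>2 + \<delta>3 * H\<^sub>1) - 2 * (\<gamma>2 * F\<^sub>2 + \<gamma>3 * F\<^sub>1)
    + 2 * E\<^sub>0 * \<gamma>2 * \<gamma>3 + 2 * F\<^sub>0 * (\<gamma>2 * \<delta>3 + \<gamma>3 * \<delta>2) + 2 * H\<^sub>0 * \<delta>2 * \<delta>3"
  define U3 where "U3 = h\<^sub>3 - (H\<^sub>1 * \<gamma>3 + H\<^sub>2 * \<delta>3) / 2 - 2 * \<delta>3 * H\<^sub>2 - 2 * \<gamma>3 * F\<^sub>2 + E\<^sub>0 * \<gamma>3\<^sup>2 + 2 * F\<^sub>0 * \<gamma>3 * \<delta>3 + H\<^sub>0 * \<delta>3\<^sup>2"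
  define T1 where "T1 = f\<^sub>1 - (F\<^sub>1 * \<gamma>1 + F\<^sub>2 * \<delta>1) / 2 - \<gamma>2 * E\<^sub>1 - (\<gamma>1 + \<delta>2) * F\<^sub>1 - \<delta>1 * H\<^sub>1 + E\<^sub>0 * \<gamma>1 * \<gamma>2 + F\<^sub>0 * (\<gamma>1 * \<delta>2 + \<delta>1 * \<gamma>2) + H\<^sub>0 * \<delta>1 * \<delta>2"
  define T2 where "T2 = f\<^sub>2 - (F\<^sub>1 * \<gamma>2 + F\<^sub>2 * \<delta>2) - (\<gamma>2 * E\<^sub>2 + \<gamma>3 * E\<^sub>1) - ((\<gamma>1 + \<delta>2) * F\<^sub>2 + (\<gamma>2 + \<delta>3) * F\<^sub>1) - (\<delta>1 * H\<^sub>2 + \<delta>2 * H\<^sub>1)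
    + E\<^sub>0 * (\<gamma>1 * \<gamma>3 + \<gamma>2 * \<gamma>2) + F\<^sub>0 * (\<gamma>1 * \<delta>3 + \<gamma>2 * \<delta>2 + \<delta>1 * \<gamma>3 + \<delta>2 * \<gamma>2) + H\<^sub>0 * (\<delta>1 * \<delta>3 + \<delta>2 * \<delta>2)"
  define T3 where "T3 = f\<^sub>3 - (F\<^sub>1 * \<gamma>3 + F\<^sub>2 * \<delta>3) / 2 - \<gamma>3 * E\<^sub>2 - (\<gamma>2 + \<delta>3) * F\<^sub>2 - \<delta>2 * H\<^sub>2 + E\<^sub>0 * \<gamma>2 * \<gamma>3 + F\<^sub>0 * (\<gamma>2 * \<delta>3 + \<delta>2 * \<gamma>3) + H\<^sub>0 * \<delta>2 * \<delta>3"
  note first = E1 E2 F1 F2 H1 H2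
  \<comment> \<open>\<open>curv\<close> in terms of these coefficients. It makes the equation for
    the mixed monomial off the diagonal a consequence of those containing \<open>S3\<close> and
    \<open>U1\<close>.\<close>
  have compat: "S3 + U1 - T2 = D"
    using curv unfolding S3_def U1_def T2_def first by (simp add: field_simps power2_eq_square)
  have D0: "E\<^sub>0 * H\<^sub>0 - F\<^sub>0\<^sup>2 \<noteq> 0" using D by simp
  \<comment> \<open>Each pair of cubic coefficients enters only through its product with the matrix
    of the metric, so the system splits into four 2x2 systems. In \<open>c1\<close> and
    \<open>c4\<close> the terms \<open>S2 / 4\<close> and \<open>U2 / 4\<close> account for values
    prescribed for the neighbouring pair.\<close>
  obtain a\<^sub>1 b\<^sub>1 where c1: "E\<^sub>0 * a\<^sub>1 + F\<^sub>0 * b\<^sub>1 = - S1 / 6" "F\<^sub>0 * a\<^sub>1 + H\<^sub>0 * b\<^sub>1 = (- T1 + S2 / 4) / 3"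
    using solve_2x2[OF D0] .
  obtain a\<^sub>2 b\<^sub>2 where c2: "E\<^sub>0 * a\<^sub>2 + F\<^sub>0 * b\<^sub>2 = - S2 / 4" "F\<^sub>0 * a\<^sub>2 + H\<^sub>0 * b\<^sub>2 = (D / 3 - U1) / 2"
    using solve_2x2[OF D0] .
  obtain a\<^sub>3 b\<^sub>3 where c3: "E\<^sub>0 * a\<^sub>3 + F\<^sub>0 * b\<^sub>3 = (D / 3 - S3) / 2" "F\<^sub>0 * a\<^sub>3 + H\<^sub>0 * b\<^sub>3 = - U2 / 4"
    using solve_2x2[OF D0] .
  obtain a\<^sub>4 b\<^sub>4 where c4: "E\<^sub>0 * a\<^sub>4 + F\<^sub>0 * b\<^sub>4 = (- T3 + U2 / 4) / 3" "F\<^sub>0 * a\<^sub>4 + H\<^sub>0 * b\<^sub>4 = - U3 / 6"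
    using solve_2x2[OF D0] .
  let ?A = "\<lambda>K. K 1 0 (- \<gamma>1 / 2) (- \<gamma>2) (- \<gamma>3 / 2) a\<^sub>1 a\<^sub>2 a\<^sub>3 a\<^sub>4"
  let ?B = "\<lambda>K. K 0 1 (- \<delta>1 / 2) (- \<delta>2) (- \<delta>3 / 2) b\<^sub>1 b\<^sub>2 b\<^sub>3 b\<^sub>4"
  \<comment> \<open>The quadratic part is the usual \<open>- \<Gamma> / 2\<close> contracted twice
    with \<open>u\<close>, with \<open>\<gamma>\<close> and \<open>\<delta>\<close> in the role of
    the Christoffel symbols with upper index 1 and 2.\<close>
  define P :: "real^2 \<Rightarrow> real^2" where "P u = ?A cub u *\<^sub>R axis 1 1 + ?B cub u *\<^sub>R axis (2::2) 1" for u
  define J11 J12 J21 J22 where J: "J11 = ?A cub\<^sub>1" "J12 = ?A cub\<^sub>2" "J21 = ?B cub\<^sub>1" "J22 = ?B cub\<^sub>2"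
  have P12: "jet2 (\<lambda>u. P u $ 1) 0 1 0 (- \<gamma>1 / 2) (- \<gamma>2) (- \<gamma>3 / 2)" "jet2 (\<lambda>u. P u $ 2) 0 0 1 (- \<delta>1 / 2) (- \<delta>2) (- \<delta>3 / 2)"
    unfolding P_def by (simp_all add: axis_def cub_jet)
  have jA: "jet2 J11 1 (- \<gamma>1) (- \<gamma>2) (3 * a\<^sub>1) (2 * a\<^sub>2) a\<^sub>3"
    unfolding J by (rule jet2_cong[OF cub\<^sub>1_jet], rule refl) simp_all
  have jB: "jet2 J12 0 (- \<gamma>2) (- \<gamma>3) a\<^sub>2 (2 * a\<^sub>3) (3 * a\<^sub>4)"
    unfolding J by (rule jet2_cong[OF cub\<^sub>2_jet], rule refl) simp_all
  have jC: "jet2 J21 0 (- \<delta>1) (- \<delta>2) (3 * b\<^sub>1) (2 * b\<^sub>2) b\<^sub>3"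
    unfolding J by (rule jet2_cong[OF cub\<^sub>1_jet], rule refl) simp_all
  have jD: "jet2 J22 1 (- \<delta>2) (- \<delta>3) b\<^sub>2 (2 * b\<^sub>3) (3 * b\<^sub>4)"
    unfolding J by (rule jet2_cong[OF cub\<^sub>2_jet], rule refl) simp_all
  have EP: "jet2 (\<lambda>u. E (P u)) E\<^sub>0 E\<^sub>1 E\<^sub>2 (e\<^sub>1 - (E\<^sub>1 * \<gamma>1 + E\<^sub>2 * \<delta>1) / 2) (e\<^sub>2 - (E\<^sub>1 * \<gamma>2 + E\<^sub>2 * \<delta>2)) (e\<^sub>3 - (E\<^sub>1 * \<gamma>3 + E\<^sub>2 * \<delta>3) / 2)"
    by (rule jet2_cong[OF jet2_compose[OF jE P12]]) (simp_all add: field_simps)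
  have FP: "jet2 (\<lambda>u. F (P u)) F\<^sub>0 F\<^sub>1 F\<^sub>2 (f\<^sub>1 - (F\<^sub>1 * \<gamma>1 + F\<^sub>2 * \<delta>1) / 2) (f\<^sub>2 - (F\<^sub>1 * \<gamma>2 + F\<^sub>2 * \<delta>2)) (f\<^sub>3 - (F\<^sub>1 * \<gamma>3 + F\<^sub>2 * \<delta>3) / 2)"
    by (rule jet2_cong[OF jet2_compose[OF jF P12]]) (simp_all add: field_simps)
  have HP: "jet2 (\<lambda>u. H (P u)) H\<^sub>0 H\<^sub>1 H\<^sub>2 (h\<^sub>1 - (H\<^sub>1 * \<gamma>1 + H\<^sub>2 * \<delta>1) / 2) (h\<^sub>2 - (H\<^sub>1 * \<gamma>2 + H\<^sub>2 * \<delta>2)) (h\<^sub>3 - (H\<^sub>1 * \<gamma>3 + H\<^sub>2 * \<delta>3) / 2)"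
    by (rule jet2_cong[OF jet2_compose[OF jH P12]]) (simp_all add: field_simps)
  show ?thesis
  proof (rule that[of P a\<^sub>1 a\<^sub>2 a\<^sub>3 a\<^sub>4 b\<^sub>1 b\<^sub>2 b\<^sub>3 b\<^sub>4 J11 J12 J21 J22])
    have two: "jet2 (\<lambda>u. 2 * f u) (2 * x) (2 * y) (2 * z) (2 * p) (2 * q) (2 * r)" if "jet2 f x y z p q r" for f x y z p q r
      by (rule jet2_cong[OF jet2_add[OF that that]]) simp_all
    have s: "6 * (E\<^sub>0 * a\<^sub>1 + F\<^sub>0 * b\<^sub>1) + S1 = 0" "4 * (E\<^sub>0 * a\<^sub>2 + F\<^sub>0 * b\<^sub>2) + S2 = 0" "2 * (E\<^sub>0 * a\<^sub>3 + F\<^sub>0 * b\<^sub>3) + S3 = D / 3"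
      unfolding c1 c2 c3 by (simp_all add: field_simps)
    show "jet2 (\<lambda>u. E (P u) * J11 u * J11 u + 2 * (F (P u) * J11 u * J21 u) + H (P u) * J21 u * J21 u) E\<^sub>0 0 0 0 0 (D / 3)"
      by (rule jet2_cong[OF jet2_add[OF jet2_add[OF jet2_form[OF EP jA jA] two[OF jet2_form[OF FP jA jC]]] jet2_form[OF HP jC jC]]])
        (use s in \<open>simp_all add: S1_def S2_def S3_def first field_simps power2_eq_square\<close>)
    have t: "T1 + 3 * (F\<^sub>0 * a\<^sub>1 + H\<^sub>0 * b\<^sub>1) + (E\<^sub>0 * a\<^sub>2 + F\<^sub>0 * b\<^sub>2) = 0"
      "T2 + 2 * (F\<^sub>0 * a\<^sub>2 + H\<^sub>0 * b\<^sub>2) + 2 * (E\<^sub>0 * a\<^sub>3 + F\<^sub>0 * b\<^sub>3) = - D / 3"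
      "T3 + (F\<^sub>0 * a\<^sub>3 + H\<^sub>0 * b\<^sub>3) + 3 * (E\<^sub>0 * a\<^sub>4 + F\<^sub>0 * b\<^sub>4) = 0"
      using compat unfolding c1 c2 c3 c4 by (simp_all add: field_simps)
    show "jet2 (\<lambda>u. E (P u) * J11 u * J12 u + F (P u) * J11 u * J22 u + F (P u) * J21 u * J12 u + H (P u) * J21 u * J22 u) F\<^sub>0 0 0 0 (- D / 3) 0"
      by (rule jet2_cong[OF jet2_add[OF jet2_add[OF jet2_add[OF jet2_form[OF EP jA jB] jet2_form[OF FP jA jD]] jet2_form[OF FP jC jB]] jet2_form[OF HP jC jD]]])
        (use t in \<open>simp_all add: T1_def T2_def T3_def first field_simps power2_eq_square\<close>)
    have v: "2 * (F\<^sub>0 * a\<^sub>2 + H\<^sub>0 * b\<^sub>2) + U1 = D / 3" "4 * (F\<^sub>0 * a\<^sub>3 + H\<^sub>0 * b\<^sub>3) + U2 = 0" "6 * (F\<^sub>0 * a\<^sub>4 + H\<^sub>0 * b\<^sub>4) + U3 = 0"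
      unfolding c2 c3 c4 by (simp_all add: field_simps)
    show "jet2 (\<lambda>u. E (P u) * J12 u * J12 u + 2 * (F (P u) * J12 u * J22 u) + H (P u) * J22 u * J22 u) H\<^sub>0 0 0 (D / 3) 0 0"
      by (rule jet2_cong[OF jet2_add[OF jet2_add[OF jet2_form[OF EP jB jB] two[OF jet2_form[OF FP jB jD]]] jet2_form[OF HP jD jD]]])
        (use v in \<open>simp_all add: U1_def U2_def U3_def first field_simps power2_eq_square\<close>)
  qed (simp_all add: P_def[abs_def] J)
qed

section \<open>Curvature and normal coordinates\<close>

lemma differentiable_real_ops:
  fixes f h :: "real^2 \<Rightarrow> real"
  assumes "f differentiable at x" "h differentiable at x"
  shows partial_deriv_add: "partial_deriv i (\<lambda>y. f y + h y) x = partial_deriv i f x + partial_deriv i h x"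
    and partial_deriv_diff: "partial_deriv i (\<lambda>y. f y - h y) x = partial_deriv i f x - partial_deriv i h x"
    and partial_deriv_mult: "partial_deriv i (\<lambda>y. f y * h y) x = f x * partial_deriv i h x + partial_deriv i f x * h x"
proof -
  have f: "(f has_derivative frechet_derivative f (at x)) (at x)" and h: "(h has_derivative frechet_derivative h (at x)) (at x)"
    using assms frechet_derivative_works by blast+
  show "partial_deriv i (\<lambda>y. f y + h y) x = partial_deriv i f x + partial_deriv i h x"
    using partial_derivI[OF has_derivative_add[OF f h], of i] by (simp only: partial_deriv_def)
  show "partial_deriv i (\<lambda>y. f y - h y) x = partial_deriv i f x - partial_deriv i h x"
    using partial_derivI[OF has_derivative_diff[OF f h], of i] by (simp only: partial_deriv_def)
  show "partial_deriv i (\<lambda>y. f y * h y) x = f x * partial_deriv i h x + partial_deriv i f x * h x"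
    using partial_derivI[OF has_derivative_mult[OF f h], of i] by (simp only: partial_deriv_def)
qed

lemma partial_deriv_half:
  fixes f :: "real^2 \<Rightarrow> real"
  assumes "f differentiable at x"
  shows "partial_deriv i (\<lambda>y. f y / 2) x = partial_deriv i f x / 2"
  using partial_deriv_mult[OF differentiable_const assms, of i "1/2"] partial_derivI[OF has_derivative_const[of "1/2::real"], of i x]
  by simp

lemma has_derivative_cong_open:
  assumes "open V" "x \<in> V" "\<And>y. y \<in> V \<Longrightarrow> f y = h y"
  shows "(f has_derivative f') (at x) \<longleftrightarrow> (h has_derivative f') (at x)"
  using has_derivative_transform_within_open[OF _ assms(1,2), of f f' UNIV h]
    has_derivative_transform_within_open[OF _ assms(1,2), of h f' UNIV f] assms(3) by auto

lemma partial_deriv_cong: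
  assumes "open V" "x \<in> V" "\<And>y. y \<in> V \<Longrightarrow> f y = h y"
  shows "partial_deriv i f x = partial_deriv i h x"
  unfolding partial_deriv_def frechet_derivative_def using has_derivative_cong_open[OF assms] by simp

lemma differentiable_cong_open:
  assumes "open V" "x \<in> V" "\<And>y. y \<in> V \<Longrightarrow> f y = h y" "h differentiable at x"
  shows "f differentiable at x"
  using assms(4) has_derivative_cong_open[OF assms(1-3)] unfolding differentiable_def by simp

lemma smooth_component:
  fixes Gm :: "real^2 \<Rightarrow> real^2^2"
  assumes V: "open V" and s: "smooth_on V Gm" and x: "x \<in> V"
  shows "twice_differentiable (\<lambda>y. Gm y $ i $ j) x"
proof -
  have "Ck_on (Suc (Suc 0)) V Gm" using s unfolding smooth_on_def by (rule spec)
  then have d: "Gm differentiable_on V" "\<And>v. (\<lambda>y. frechet_derivative Gm (at y within V) v) differentiable_on V"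
    by simp_all
  have b: "bounded_linear (\<lambda>M::real^2^2. M $ i $ j)"
    using bounded_linear_compose[OF bounded_linear_vec_nth[of j] bounded_linear_vec_nth[of i]] by simp
  have comp: "((\<lambda>y. Gm y $ i $ j) has_derivative (\<lambda>v. frechet_derivative Gm (at y) v $ i $ j)) (at y)" if "y \<in> V" for y
    using bounded_linear.has_derivative[OF b] d(1) that frechet_derivative_works
    unfolding differentiable_on_eq_differentiable_at[OF V] by blast
  have "partial_deriv k (\<lambda>y. Gm y $ i $ j) differentiable at x" for k
  proof (rule differentiable_cong_open[OF V x])
    show "partial_deriv k (\<lambda>y. Gm y $ i $ j) y = frechet_derivative Gm (at y within V) (axis k 1) $ i $ j" if "y \<in> V" for y
      using partial_derivI[OF comp[OF that]] at_within_open[OF that V] by simp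
    have "(\<lambda>y. frechet_derivative Gm (at y within V) (axis k 1)) differentiable at x"
      using d(2) x unfolding differentiable_on_eq_differentiable_at[OF V] by blast
    then show "(\<lambda>y. frechet_derivative Gm (at y within V) (axis k 1) $ i $ j) differentiable at x"
      using bounded_linear.has_derivative[OF b] unfolding differentiable_def by blast
  qed
  moreover obtain \<rho> where "\<rho> > 0" "ball x \<rho> \<subseteq> V"
    using V x open_contains_ball by blast
  moreover from this(2) have "(\<lambda>y. Gm y $ i $ j) differentiable at y" if "y \<in> ball x \<rho>" for y
    using that comp unfolding differentiable_def by blast
  ultimately show ?thesis
    unfolding twice_differentiable_def by blast
qed

lemma twice_differentiableD:
  assumes "twice_differentiable f x"
  shows "f differentiable at x" "partial_deriv i f differentiable at x"
  using assms unfolding twice_differentiable_def by force+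

text \<open>Lowering the index cancels \<open>matrix_inv\<close>. The Christoffel symbols are then
  given by linear equations with the metric as matrix, and no formula for the inverse has to be
  differentiated.\<close>

lemma christoffel_lower:
  fixes Gm :: "real^2 \<Rightarrow> real^2^2"
  assumes "invertible (Gm x)"
  shows "Gm x $ m $ 1 * christoffel Gm 1 i j x + Gm x $ m $ 2 * christoffel Gm 2 i j x =
    (partial_deriv i (\<lambda>y. Gm y $ j $ m) x + partial_deriv j (\<lambda>y. Gm y $ i $ m) x - partial_deriv m (\<lambda>y. Gm y $ i $ j) x) / 2"
proof -
  let ?I = "matrix_inv (Gm x)"
  let ?T = "\<lambda>l. partial_deriv i (\<lambda>y. Gm y $ j $ l) x + partial_deriv j (\<lambda>y. Gm y $ i $ l) x - partial_deriv l (\<lambda>y. Gm y $ i $ j) x"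
  have "Gm x ** ?I = mat 1 \<and> ?I ** Gm x = mat 1"
    unfolding matrix_inv_def by (rule someI_ex) (use assms in \<open>simp add: invertible_def\<close>)
  then have "(Gm x ** ?I) $ m $ l = (mat 1 :: real^2^2) $ m $ l" for l by simp
  then have I: "Gm x $ m $ 1 * ?I $ 1 $ l + Gm x $ m $ 2 * ?I $ 2 $ l = (if m = l then 1 else 0)" for l
    by (simp add: matrix_matrix_mult_def mat_def sum_2)
  have "Gm x $ m $ 1 * christoffel Gm 1 i j x + Gm x $ m $ 2 * christoffel Gm 2 i j x =
      ((Gm x $ m $ 1 * ?I $ 1 $ 1 + Gm x $ m $ 2 * ?I $ 2 $ 1) * ?T 1 + (Gm x $ m $ 1 * ?I $ 1 $ 2 + Gm x $ m $ 2 * ?I $ 2 $ 2) * ?T 2) / 2"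
    unfolding christoffel_def sum_2 by (simp add: algebra_simps)
  also have "\<dots> = ?T m / 2"
    unfolding I using exhaust_2[of m] by auto
  finally show ?thesis .
qed

text \<open>Cramer's rule as a differentiability argument; it will make the Christoffel symbols
  differentiable without touching their definition through \<open>matrix_inv\<close>.\<close>

lemma solution_differentiable:
  fixes E F H c\<^sub>1 c\<^sub>2 p q :: "real^2 \<Rightarrow> real"
  assumes V: "open V" "x \<in> V"
    and eq: "\<And>y. y \<in> V \<Longrightarrow> E y * c\<^sub>1 y + F y * c\<^sub>2 y = p y" "\<And>y. y \<in> V \<Longrightarrow> F y * c\<^sub>1 y + H y * c\<^sub>2 y = q y"
    and D: "\<And>y. y \<in> V \<Longrightarrow> E y * H y - F y * F y \<noteq> 0"
    and d: "E differentiable at x" "F differentiable at x" "H differentiable at x" "p differentiable at x" "q differentiable at x"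
  shows "c\<^sub>1 differentiable at x" "c\<^sub>2 differentiable at x"
proof -
  have "c\<^sub>1 y = (H y * p y - F y * q y) / (E y * H y - F y * F y)" if "y \<in> V" for y
    using D[OF that] eq[OF that, symmetric] by (simp add: field_simps)
  then show "c\<^sub>1 differentiable at x"
    by (rule differentiable_cong_open[OF V]) (use d D[OF V(2)] in \<open>auto intro!: differentiable_divide differentiable_diff differentiable_mult\<close>)
  have "c\<^sub>2 y = (E y * q y - F y * p y) / (E y * H y - F y * F y)" if "y \<in> V" for y
    using D[OF that] eq[OF that, symmetric] by (simp add: field_simps)
  then show "c\<^sub>2 differentiable at x"
    by (rule differentiable_cong_open[OF V]) (use d D[OF V(2)] in \<open>auto intro!: differentiable_divide differentiable_diff differentiable_mult\<close>)
qed

lemma quadratic_form_2: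
  fixes M :: "real^2^2"
  shows "v \<bullet> (M *v v) = M$1$1 * v$1 * v$1 + (M$1$2 + M$2$1) * v$1 * v$2 + M$2$2 * v$2 * v$2"
  by (simp add: inner_vec_def matrix_vector_mult_def sum_2 algebra_simps)

lemma positive_definite_2:
  fixes M :: "real^2^2"
  assumes "\<forall>v. v \<noteq> 0 \<longrightarrow> v \<bullet> (M *v v) > 0" "transpose M = M"
  shows "M$1$1 > 0" "M$2$1 = M$1$2" "M$1$1 * M$2$2 - M$1$2 * M$1$2 > 0"
proof -
  show s: "M$2$1 = M$1$2"
    using arg_cong[OF assms(2), of "\<lambda>N. N $ 1 $ 2"] by (simp add: transpose_def)
  have q: "0 < M$1$1 * a * a + (M$1$2 + M$2$1) * a * b + M$2$2 * b * b" if "a \<noteq> 0 \<or> b \<noteq> 0" for a b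
  proof -
    let ?v = "a *\<^sub>R axis 1 1 + b *\<^sub>R axis 2 1 :: real^2"
    have c: "?v $ 1 = a" "?v $ 2 = b" by (simp_all add: axis_def)
    have "?v \<noteq> 0"
    proof
      assume "?v = 0"
      then have "?v $ 1 = 0" "?v $ 2 = 0" by simp_all
      then show False using that unfolding c by simp
    qed
    then have "0 < ?v \<bullet> (M *v ?v)" using assms(1) by blast
    then show ?thesis unfolding quadratic_form_2 c .
  qed
  show e: "M$1$1 > 0" using q[of 1 0] by simp
  \<comment> \<open>The test vector is orthogonal to the first axis for this form, and its value is
    \<open>M$1$1\<close> times the determinant.\<close>
  have "0 < M$1$1 * (M$1$1 * M$2$2 - M$1$2 * M$1$2)"
    using q[of "- M$1$2" "M$1$1"] e unfolding s by (simp add: algebra_simps)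
  then show "M$1$1 * M$2$2 - M$1$2 * M$1$2 > 0"
    using e by (simp add: zero_less_mult_iff)
qed

text \<open>Shaped as the hypotheses of \<open>normal_jets\<close>. The first six formulas express
  that the metric is parallel. For the last one the index of the curvature tensor is lowered, so
  that derivatives of Christoffel symbols occur only in combinations accessible through
  \<open>christoffel_lower\<close>.\<close>

lemma curvature_at_point:
  fixes Gm :: "real^2 \<Rightarrow> real^2^2"
  assumes V: "open V" "x \<in> V" and s: "smooth_on V Gm"
    and pos: "\<forall>y\<in>V. transpose (Gm y) = Gm y \<and> (\<forall>v. v \<noteq> 0 \<longrightarrow> v \<bullet> (Gm y *v v) > 0)"
  defines "E \<equiv> \<lambda>y. Gm y $ 1 $ 1" and "F \<equiv> \<lambda>y. Gm y $ 1 $ 2" and "H \<equiv> \<lambda>y. Gm y $ 2 $ 2"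
  defines "\<gamma>1 \<equiv> christoffel Gm 1 1 1 x" and "\<gamma>2 \<equiv> christoffel Gm 1 1 2 x" and "\<gamma>3 \<equiv> christoffel Gm 1 2 2 x"
  defines "\<delta>1 \<equiv> christoffel Gm 2 1 1 x" and "\<delta>2 \<equiv> christoffel Gm 2 1 2 x" and "\<delta>3 \<equiv> christoffel Gm 2 2 2 x"
  shows "partial_deriv 1 E x = 2 * (E x * \<gamma>1 + F x * \<delta>1)" "partial_deriv 2 E x = 2 * (E x * \<gamma>2 + F x * \<delta>2)"
    "partial_deriv 1 H x = 2 * (F x * \<gamma>2 + H x * \<delta>2)" "partial_deriv 2 H x = 2 * (F x * \<gamma>3 + H x * \<delta>3)"
    "partial_deriv 1 F x = F x * \<gamma>1 + H x * \<delta>1 + E x * \<gamma>2 + F x * \<delta>2"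
    "partial_deriv 2 F x = F x * \<gamma>2 + H x * \<delta>2 + E x * \<gamma>3 + F x * \<delta>3"
    "gaussian_curvature Gm x * (E x * H x - (F x)\<^sup>2) = partial_deriv 1 (partial_deriv 2 F) x
      - partial_deriv 1 (partial_deriv 1 H) x / 2 - partial_deriv 2 (partial_deriv 2 E) x / 2
      - (partial_deriv 1 E x * \<gamma>3 + partial_deriv 1 F x * \<delta>3 - partial_deriv 2 E x * \<gamma>2 - partial_deriv 2 F x * \<delta>2)
      + E x * (\<gamma>1 * \<gamma>3 + \<gamma>2 * \<delta>3 - \<gamma>2 * \<gamma>2 - \<gamma>3 * \<delta>2)
      + F x * (\<delta>1 * \<gamma>3 + \<delta>2 * \<delta>3 - \<delta>2 * \<gamma>2 - \<delta>3 * \<delta>2)"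
proof -
  have pd: "\<And>y. y \<in> V \<Longrightarrow> transpose (Gm y) = Gm y" "\<And>y. y \<in> V \<Longrightarrow> \<forall>v. v \<noteq> 0 \<longrightarrow> v \<bullet> (Gm y *v v) > 0"
    using pos by blast+
  have sym: "Gm y $ 2 $ 1 = F y" and D: "E y * H y - F y * F y > 0" if "y \<in> V" for y
    using positive_definite_2[OF pd(2)[OF that] pd(1)[OF that]] unfolding E_def F_def H_def by auto
  have psym: "partial_deriv i (\<lambda>y. Gm y $ 2 $ 1) y = partial_deriv i F y" if "y \<in> V" for i y
    by (rule partial_deriv_cong[OF V(1) that sym])
  have inv: "invertible (Gm y)" if "y \<in> V" for y
    using D[OF that] sym[OF that] unfolding invertible_det_nz det_2 E_def F_def H_def by simp
  have low: "Gm y $ m $ 1 * christoffel Gm 1 i j y + Gm y $ m $ 2 * christoffel Gm 2 i j y =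
      (partial_deriv i (\<lambda>y. Gm y $ j $ m) y + partial_deriv j (\<lambda>y. Gm y $ i $ m) y - partial_deriv m (\<lambda>y. Gm y $ i $ j) y) / 2"
    if "y \<in> V" for y m i j
    by (rule christoffel_lower[of Gm, OF inv[OF that]])
  have l1: "E y * christoffel Gm 1 i j y + F y * christoffel Gm 2 i j y =
      (partial_deriv i (\<lambda>y. Gm y $ j $ 1) y + partial_deriv j (\<lambda>y. Gm y $ i $ 1) y - partial_deriv 1 (\<lambda>y. Gm y $ i $ j) y) / 2"
    if "y \<in> V" for y i j
    using low[OF that, of 1 i j] unfolding E_def F_def .
  have l2: "F y * christoffel Gm 1 i j y + H y * christoffel Gm 2 i j y =
      (partial_deriv i (\<lambda>y. Gm y $ j $ 2) y + partial_deriv j (\<lambda>y. Gm y $ i $ 2) y - partial_deriv 2 (\<lambda>y. Gm y $ i $ j) y) / 2"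
    if "y \<in> V" for y i j
    using low[OF that, of 2 i j] sym[OF that] unfolding H_def by simp
  have L: "E y * christoffel Gm 1 1 1 y + F y * christoffel Gm 2 1 1 y = partial_deriv 1 E y / 2"
    "F y * christoffel Gm 1 1 1 y + H y * christoffel Gm 2 1 1 y = partial_deriv 1 F y - partial_deriv 2 E y / 2"
    "E y * christoffel Gm 1 1 2 y + F y * christoffel Gm 2 1 2 y = partial_deriv 2 E y / 2"
    "F y * christoffel Gm 1 1 2 y + H y * christoffel Gm 2 1 2 y = partial_deriv 1 H y / 2"
    "E y * christoffel Gm 1 2 2 y + F y * christoffel Gm 2 2 2 y = partial_deriv 2 F y - partial_deriv 1 H y / 2"
    "F y * christoffel Gm 1 2 2 y + H y * christoffel Gm 2 2 2 y = partial_deriv 2 H y / 2"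
    if y: "y \<in> V" for y
    unfolding l1[OF y] l2[OF y] psym[OF y] by (simp_all add: E_def F_def H_def field_simps)
  note Lx = L[OF V(2), folded \<gamma>1_def \<gamma>2_def \<gamma>3_def \<delta>1_def \<delta>2_def \<delta>3_def]
  show "partial_deriv 1 E x = 2 * (E x * \<gamma>1 + F x * \<delta>1)"
    using Lx(1) by (simp add: algebra_simps)
  show "partial_deriv 2 E x = 2 * (E x * \<gamma>2 + F x * \<delta>2)"
    using Lx(3) by (simp add: algebra_simps)
  show "partial_deriv 1 H x = 2 * (F x * \<gamma>2 + H x * \<delta>2)"
    using Lx(4) by (simp add: algebra_simps)
  show "partial_deriv 2 H x = 2 * (F x * \<gamma>3 + H x * \<delta>3)"
    using Lx(6) by (simp add: algebra_simps)
  show "partial_deriv 1 F x = F x * \<gamma>1 + H x * \<delta>1 + E x * \<gamma>2 + F x * \<delta>2"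
    using Lx(2,3) by (simp add: algebra_simps)
  show "partial_deriv 2 F x = F x * \<gamma>2 + H x * \<delta>2 + E x * \<gamma>3 + F x * \<delta>3"
    using Lx(4,5) by (simp add: algebra_simps)
  have td: "twice_differentiable E x" "twice_differentiable F x" "twice_differentiable H x"
    unfolding E_def F_def H_def by (rule smooth_component[OF V(1) s V(2)])+
  note d = twice_differentiableD(1)[OF td(1)] twice_differentiableD(1)[OF td(2)] twice_differentiableD(1)[OF td(3)]
  note d' = twice_differentiableD(2)[OF td(1)] twice_differentiableD(2)[OF td(2)] twice_differentiableD(2)[OF td(3)]
  have half: "(\<lambda>y. f y / 2) differentiable at x" if "f differentiable at x" for f :: "real^2 \<Rightarrow> real"
    by (rule differentiable_divide[OF that differentiable_const]) simp
  have D': "E y * H y - F y * F y \<noteq> 0" if "y \<in> V" for y using D[OF that] by simp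
  have c12: "christoffel Gm 1 1 2 differentiable at x" "christoffel Gm 2 1 2 differentiable at x"
    by (rule solution_differentiable[OF V _ _ _ d half[OF d'(1)] half[OF d'(3)]], (rule L(3) L(4) D', assumption)+)+
  have c22: "christoffel Gm 1 2 2 differentiable at x" "christoffel Gm 2 2 2 differentiable at x"
    by (rule solution_differentiable[OF V _ _ _ d differentiable_diff[OF d'(2) half[OF d'(3)]] half[OF d'(3)]],
        (rule L(5) L(6) D', assumption)+)+
  \<comment> \<open>Differentiating the lowered identities by the product rule gives the derivatives
    of the Christoffel symbols in exactly the combination that the curvature needs.\<close>
  have eq22: "partial_deriv 1 (\<lambda>y. E y * christoffel Gm 1 2 2 y + F y * christoffel Gm 2 2 2 y) x =
      partial_deriv 1 (\<lambda>y. partial_deriv 2 F y - partial_deriv 1 H y / 2) x"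
    by (rule partial_deriv_cong[OF V]) (rule L(5))
  have eq12: "partial_deriv 2 (\<lambda>y. E y * christoffel Gm 1 1 2 y + F y * christoffel Gm 2 1 2 y) x =
      partial_deriv 2 (\<lambda>y. partial_deriv 2 E y / 2) x"
    by (rule partial_deriv_cong[OF V]) (rule L(3))
  have e22: "E x * partial_deriv 1 (christoffel Gm 1 2 2) x + partial_deriv 1 E x * \<gamma>3
      + (F x * partial_deriv 1 (christoffel Gm 2 2 2) x + partial_deriv 1 F x * \<delta>3)
      = partial_deriv 1 (partial_deriv 2 F) x - partial_deriv 1 (partial_deriv 1 H) x / 2"
    using eq22
    unfolding partial_deriv_add[OF differentiable_mult[OF d(1) c22(1)] differentiable_mult[OF d(2) c22(2)]]
      partial_deriv_mult[OF d(1) c22(1)] partial_deriv_mult[OF d(2) c22(2)]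
      partial_deriv_diff[OF d'(2) half[OF d'(3)]] partial_deriv_half[OF d'(3)]
    by (simp add: \<gamma>3_def \<delta>3_def)
  have e12: "E x * partial_deriv 2 (christoffel Gm 1 1 2) x + partial_deriv 2 E x * \<gamma>2
      + (F x * partial_deriv 2 (christoffel Gm 2 1 2) x + partial_deriv 2 F x * \<delta>2)
      = partial_deriv 2 (partial_deriv 2 E) x / 2"
    using eq12
    unfolding partial_deriv_add[OF differentiable_mult[OF d(1) c12(1)] differentiable_mult[OF d(2) c12(2)]]
      partial_deriv_mult[OF d(1) c12(1)] partial_deriv_mult[OF d(2) c12(2)] partial_deriv_half[OF d'(1)]
    by (simp add: \<gamma>2_def \<delta>2_def)
  have c21: "christoffel Gm k 2 1 x = christoffel Gm k 1 2 x" for k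
    unfolding christoffel_def psym[OF V(2)] by (simp add: F_def add.commute)
  have "det (Gm x) = E x * H x - (F x)\<^sup>2"
    unfolding det_2 sym[OF V(2)] by (simp add: E_def F_def H_def power2_eq_square)
  then have "gaussian_curvature Gm x * (E x * H x - (F x)\<^sup>2) =
      E x * riemann_tensor Gm 1 2 1 2 x + F x * riemann_tensor Gm 2 2 1 2 x"
    using D'[OF V(2)] unfolding gaussian_curvature_def sum_2 by (simp add: E_def F_def power2_eq_square)
  also have "\<dots> = (E x * partial_deriv 1 (christoffel Gm 1 2 2) x + F x * partial_deriv 1 (christoffel Gm 2 2 2) x)
      - (E x * partial_deriv 2 (christoffel Gm 1 1 2) x + F x * partial_deriv 2 (christoffel Gm 2 1 2) x)
      + E x * (\<gamma>1 * \<gamma>3 + \<gamma>2 * \<delta>3 - \<gamma>2 * \<gamma>2 - \<gamma>3 * \<delta>2)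
      + F x * (\<delta>1 * \<gamma>3 + \<delta>2 * \<delta>3 - \<delta>2 * \<gamma>2 - \<delta>3 * \<delta>2)"
    unfolding riemann_tensor_def sum_2 c21 \<gamma>1_def[symmetric] \<gamma>2_def[symmetric] \<gamma>3_def[symmetric]
      \<delta>1_def[symmetric] \<delta>2_def[symmetric] \<delta>3_def[symmetric]
    by (simp add: algebra_simps)
  finally show "gaussian_curvature Gm x * (E x * H x - (F x)\<^sup>2) = partial_deriv 1 (partial_deriv 2 F) x
      - partial_deriv 1 (partial_deriv 1 H) x / 2 - partial_deriv 2 (partial_deriv 2 E) x / 2
      - (partial_deriv 1 E x * \<gamma>3 + partial_deriv 1 F x * \<delta>3 - partial_deriv 2 E x * \<gamma>2 - partial_deriv 2 F x * \<delta>2)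
      + E x * (\<gamma>1 * \<gamma>3 + \<gamma>2 * \<delta>3 - \<gamma>2 * \<gamma>2 - \<gamma>3 * \<delta>2)
      + F x * (\<delta>1 * \<gamma>3 + \<delta>2 * \<delta>3 - \<delta>2 * \<gamma>2 - \<delta>3 * \<delta>2)"
    using e22 e12 by linarith
qed

section \<open>Approximate normal coordinates from an orthonormal frame\<close>

lemma continuous_on_cub:
  "continuous_on UNIV (cub\<^sub>1 p q c\<^sub>1 c\<^sub>2 c\<^sub>3 d\<^sub>1 d\<^sub>2 d\<^sub>3 d\<^sub>4)"
  "continuous_on UNIV (cub\<^sub>2 p q c\<^sub>1 c\<^sub>2 c\<^sub>3 d\<^sub>1 d\<^sub>2 d\<^sub>3 d\<^sub>4)"
  unfolding cub\<^sub>1_def[abs_def] cub\<^sub>2_def[abs_def] by (intro continuous_intros)+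

text \<open>Gram-Schmidt on the two coordinate vectors. The last equation says that the frame has
  area 1, which will turn the coefficient \<open>D / 3\<close> of \<open>normal_jets\<close> into
  1/3.\<close>

lemma orthonormal_frame:
  fixes E F H :: real
  assumes "E > 0" "E * H - F\<^sup>2 > 0"
  obtains l\<^sub>1 l\<^sub>2 l\<^sub>3 where "E * l\<^sub>1\<^sup>2 = 1" "E * l\<^sub>1 * l\<^sub>2 + F * l\<^sub>1 * l\<^sub>3 = 0"
    "E * l\<^sub>2\<^sup>2 + 2 * F * l\<^sub>2 * l\<^sub>3 + H * l\<^sub>3\<^sup>2 = 1" "(E * H - F\<^sup>2) * (l\<^sub>1 * l\<^sub>3)\<^sup>2 = 1"
proof -
  define D where "D = E * H - F\<^sup>2"
  have D: "D > 0" using assms unfolding D_def by simp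
  define x y where "x = 1 / sqrt E" and "y = sqrt E / sqrt D"
  have x2: "x\<^sup>2 = 1 / E" and y2: "y\<^sup>2 = E / D"
    using assms(1) D unfolding x_def y_def by (simp_all add: power_divide)
  have EH: "E * H = D + F\<^sup>2" unfolding D_def by simp
  show ?thesis
  proof (rule that[of x "- F * y / E" y])
    show "E * x\<^sup>2 = 1" unfolding x2 using assms(1) by simp
    show "E * x * (- F * y / E) + F * x * y = 0" using assms(1) by (simp add: field_simps)
    have "E * (- F * y / E)\<^sup>2 + 2 * F * (- F * y / E) * y + H * y\<^sup>2 = (E * H - F\<^sup>2) / E * y\<^sup>2"
      using assms(1) by (simp add: field_simps power2_eq_square)
    also have "\<dots> = 1" unfolding y2 using assms(1) D D_def by simp
    finally show "E * (- F * y / E)\<^sup>2 + 2 * F * (- F * y / E) * y + H * y\<^sup>2 = 1" .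
    show "(E * H - F\<^sup>2) * (x * y)\<^sup>2 = 1"
      unfolding power_mult_distrib x2 y2 using assms(1) D D_def by simp
  qed
qed

lemma jet2_eventually:
  assumes "jet2 f a b\<^sub>1 b\<^sub>2 c\<^sub>1 c\<^sub>2 c\<^sub>3" "0 < \<epsilon>"
  shows "eventually (\<lambda>u. \<bar>f u - (a + b\<^sub>1 * u$1 + b\<^sub>2 * u$2 + c\<^sub>1 * (u$1)\<^sup>2 + c\<^sub>2 * (u$1 * u$2) + c\<^sub>3 * (u$2)\<^sup>2)\<bar> \<le> \<epsilon> * (norm u)\<^sup>2) (nhds 0)"
  using landau_o.smallD[OF assms(1)[unfolded jet2_def] assms(2)] by simp

text \<open>\<open>\<Phi>\<close> is a linear orthonormalisation followed by the cubic map of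
  \<open>normal_jets\<close>. It replaces geodesic normal coordinates and is explicit: radial
  segments become cubic curves, whose smoothness requires no theory of geodesics.\<close>

lemma normal_coordinates:
  fixes Gm :: "real^2 \<Rightarrow> real^2^2"
  assumes V: "open V" "x \<in> V" and s: "smooth_on V Gm"
    and pos: "\<forall>y\<in>V. transpose (Gm y) = Gm y \<and> (\<forall>v. v \<noteq> 0 \<longrightarrow> v \<bullet> (Gm y *v v) > 0)"
    and K: "gaussian_curvature Gm x = -1"
  obtains \<Phi> :: "real^2 \<Rightarrow> real^2" and \<Phi>' :: "real^2 \<Rightarrow> real^2 \<Rightarrow> real^2" where "\<Phi> 0 = x" "\<And>w. (\<Phi> has_derivative \<Phi>' w) (at w)" "\<And>v. continuous_on UNIV (\<lambda>w. \<Phi>' w v)"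
    "\<And>w. \<exists>k\<^sub>1 k\<^sub>2 k\<^sub>3. \<forall>t. \<Phi> (t *\<^sub>R w) = x + t *\<^sub>R k\<^sub>1 + t\<^sup>2 *\<^sub>R k\<^sub>2 + t^3 *\<^sub>R k\<^sub>3"
    "\<And>\<epsilon>. 0 < \<epsilon> \<Longrightarrow> \<exists>\<delta>>0. \<forall>w v. norm w < \<delta> \<longrightarrow>
      \<bar>\<Phi>' w v \<bullet> (Gm (\<Phi> w) *v \<Phi>' w v) - ((norm v)\<^sup>2 + (w$1 * v$2 - w$2 * v$1)\<^sup>2 / 3)\<bar> \<le> \<epsilon> * (norm w)\<^sup>2 * (norm v)\<^sup>2"
proof -
  have pd: "\<And>y. y \<in> V \<Longrightarrow> transpose (Gm y) = Gm y" "\<And>y. y \<in> V \<Longrightarrow> \<forall>v. v \<noteq> 0 \<longrightarrow> v \<bullet> (Gm y *v v) > 0"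
    using pos by blast+
  define E F H where "E = (\<lambda>y. Gm y $ 1 $ 1)" and "F = (\<lambda>y. Gm y $ 1 $ 2)" and "H = (\<lambda>y. Gm y $ 2 $ 2)"
  have at_x: "Gm x $ 1 $ 1 = E x" "Gm x $ 1 $ 2 = F x" "Gm x $ 2 $ 2 = H x"
    unfolding E_def F_def H_def by simp_all
  note curv = curvature_at_point[OF V s pos, folded E_def F_def H_def, unfolded at_x]
  have td: "twice_differentiable E x" "twice_differentiable F x" "twice_differentiable H x"
    unfolding E_def F_def H_def by (rule smooth_component[OF V(1) s V(2)])+
  have E0: "E x > 0" and D: "E x * H x - (F x)\<^sup>2 > 0"
    using positive_definite_2[OF pd(2)[OF V(2)] pd(1)[OF V(2)]] unfolding E_def F_def H_def by (simp_all add: power2_eq_square)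
  define D0 where "D0 = E x * H x - (F x)\<^sup>2"
  have Dn: "D0 \<noteq> 0" using D unfolding D0_def by simp
  have kap: "- D0 = partial_deriv 1 (partial_deriv 2 F) x
      - partial_deriv 1 (partial_deriv 1 H) x / 2 - partial_deriv 2 (partial_deriv 2 E) x / 2
      - (partial_deriv 1 E x * christoffel Gm 1 2 2 x + partial_deriv 1 F x * christoffel Gm 2 2 2 x
        - partial_deriv 2 E x * christoffel Gm 1 1 2 x - partial_deriv 2 F x * christoffel Gm 2 1 2 x)
      + E x * (christoffel Gm 1 1 1 x * christoffel Gm 1 2 2 x + christoffel Gm 1 1 2 x * christoffel Gm 2 2 2 x
        - christoffel Gm 1 1 2 x * christoffel Gm 1 1 2 x - christoffel Gm 1 2 2 x * christoffel Gm 2 1 2 x)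
      + F x * (christoffel Gm 2 1 1 x * christoffel Gm 1 2 2 x + christoffel Gm 2 1 2 x * christoffel Gm 2 2 2 x
        - christoffel Gm 2 1 2 x * christoffel Gm 1 1 2 x - christoffel Gm 2 2 2 x * christoffel Gm 2 1 2 x)"
    using curv(7) unfolding K D0_def by simp
  obtain a\<^sub>1 a\<^sub>2 a\<^sub>3 a\<^sub>4 b\<^sub>1 b\<^sub>2 b\<^sub>3 b\<^sub>4 P J11 J12 J21 J22 c\<^sub>1 c\<^sub>2 c\<^sub>3 d\<^sub>1 d\<^sub>2 d\<^sub>3
    where P': "P = (\<lambda>u. cub 1 0 c\<^sub>1 c\<^sub>2 c\<^sub>3 a\<^sub>1 a\<^sub>2 a\<^sub>3 a\<^sub>4 u *\<^sub>R axis 1 1 + cub 0 1 d\<^sub>1 d\<^sub>2 d\<^sub>3 b\<^sub>1 b\<^sub>2 b\<^sub>3 b\<^sub>4 u *\<^sub>R axis (2::2) 1)"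
    and J: "J11 = cub\<^sub>1 1 0 c\<^sub>1 c\<^sub>2 c\<^sub>3 a\<^sub>1 a\<^sub>2 a\<^sub>3 a\<^sub>4" "J12 = cub\<^sub>2 1 0 c\<^sub>1 c\<^sub>2 c\<^sub>3 a\<^sub>1 a\<^sub>2 a\<^sub>3 a\<^sub>4"
      "J21 = cub\<^sub>1 0 1 d\<^sub>1 d\<^sub>2 d\<^sub>3 b\<^sub>1 b\<^sub>2 b\<^sub>3 b\<^sub>4" "J22 = cub\<^sub>2 0 1 d\<^sub>1 d\<^sub>2 d\<^sub>3 b\<^sub>1 b\<^sub>2 b\<^sub>3 b\<^sub>4"
    and jets: "jet2 (\<lambda>u. E (x + P u) * J11 u * J11 u + 2 * (F (x + P u) * J11 u * J21 u) + H (x + P u) * J21 u * J21 u) (E x) 0 0 0 0 (D0 / 3)"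
    "jet2 (\<lambda>u. E (x + P u) * J11 u * J12 u + F (x + P u) * J11 u * J22 u + F (x + P u) * J21 u * J12 u + H (x + P u) * J21 u * J22 u) (F x) 0 0 0 (- D0 / 3) 0"
    "jet2 (\<lambda>u. E (x + P u) * J12 u * J12 u + 2 * (F (x + P u) * J12 u * J22 u) + H (x + P u) * J22 u * J22 u) (H x) 0 0 (D0 / 3) 0 0"
    by (rule normal_jets[OF jet2_taylor[OF td(1)] jet2_taylor[OF td(2)] jet2_taylor[OF td(3)] curv(1-6) D0_def[symmetric] Dn kap]) (rule that)
  note P = fun_cong[OF P']
  obtain l\<^sub>1 l\<^sub>2 l\<^sub>3 where l: "E x * l\<^sub>1\<^sup>2 = 1" "E x * l\<^sub>1 * l\<^sub>2 + F x * l\<^sub>1 * l\<^sub>3 = 0"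
    "E x * l\<^sub>2\<^sup>2 + 2 * F x * l\<^sub>2 * l\<^sub>3 + H x * l\<^sub>3\<^sup>2 = 1" "D0 * (l\<^sub>1 * l\<^sub>3)\<^sup>2 = 1"
    using orthonormal_frame[OF E0 D] unfolding D0_def by blast
  define L :: "real^2 \<Rightarrow> real^2" where "L w = (l\<^sub>1 * w$1 + l\<^sub>2 * w$2) *\<^sub>R axis 1 1 + (l\<^sub>3 * w$2) *\<^sub>R axis 2 1" for w
  have L1: "L w $ 1 = l\<^sub>1 * w$1 + l\<^sub>2 * w$2" and L2: "L w $ 2 = l\<^sub>3 * w$2" for w
    unfolding L_def by (simp_all add: axis_def)
  have Ld: "(L has_derivative L) (at w)" for w
    unfolding L_def[abs_def]
    by (rule has_derivative_eq_rhs, (rule derivative_intros bounded_linear.has_derivative[OF bounded_linear_vec_nth])+) simp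
  define \<Phi> where "\<Phi> w = x + P (L w)" for w
  define \<Phi>' where "\<Phi>' w v = (J11 (L w) * L v $ 1 + J12 (L w) * L v $ 2) *\<^sub>R axis 1 1 +
      (J21 (L w) * L v $ 1 + J22 (L w) * L v $ 2) *\<^sub>R axis (2::2) (1::real)" for w v
  have Pd: "(P has_derivative (\<lambda>v. (J11 u * v$1 + J12 u * v$2) *\<^sub>R axis 1 1 + (J21 u * v$1 + J22 u * v$2) *\<^sub>R axis 2 1)) (at u)" for u
  proof -
    show ?thesis
      unfolding P' J by (intro has_derivative_add has_derivative_scaleR_left cub_has_derivative)
  qed
  have \<Phi>d: "(\<Phi> has_derivative \<Phi>' w) (at w)" for w
    unfolding \<Phi>_def[abs_def] \<Phi>'_def[abs_def]
    using has_derivative_add[OF has_derivative_const has_derivative_compose[OF Ld Pd]] by simp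
  have lin: "L 0 = 0" unfolding L_def by simp
  have Lc: "continuous_on UNIV L"
    using has_derivative_continuous[OF Ld] by (intro continuous_at_imp_continuous_on) auto
  have \<Phi>0: "\<Phi> 0 = x"
    unfolding \<Phi>_def lin P cub_def by simp
  have \<Phi>c: "continuous_on UNIV (\<lambda>w. \<Phi>' w v)" for v
    unfolding \<Phi>'_def J
    by (intro continuous_intros continuous_on_compose2[OF continuous_on_cub(1) Lc] continuous_on_compose2[OF continuous_on_cub(2) Lc]) auto
  have line: "\<exists>k\<^sub>1 k\<^sub>2 k\<^sub>3. \<forall>t. \<Phi> (t *\<^sub>R w) = x + t *\<^sub>R k\<^sub>1 + t\<^sup>2 *\<^sub>R k\<^sub>2 + t^3 *\<^sub>R k\<^sub>3" for w
  proof -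
    let ?u = "L w"
    have Lt: "L (t *\<^sub>R w) = t *\<^sub>R ?u" for t
      unfolding L_def by (simp add: algebra_simps)
    have c: "cub p q c\<^sub>1 c\<^sub>2 c\<^sub>3 d\<^sub>1 d\<^sub>2 d\<^sub>3 d\<^sub>4 (t *\<^sub>R ?u) = t * (p * ?u$1 + q * ?u$2)
        + t\<^sup>2 * (c\<^sub>1 * (?u$1)\<^sup>2 + c\<^sub>2 * (?u$1 * ?u$2) + c\<^sub>3 * (?u$2)\<^sup>2)
        + t^3 * (d\<^sub>1 * (?u$1)^3 + d\<^sub>2 * (?u$1)\<^sup>2 * ?u$2 + d\<^sub>3 * ?u$1 * (?u$2)\<^sup>2 + d\<^sub>4 * (?u$2)^3)"
      for p q c\<^sub>1 c\<^sub>2 c\<^sub>3 d\<^sub>1 d\<^sub>2 d\<^sub>3 d\<^sub>4 t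
      unfolding cub_def by (simp add: algebra_simps power2_eq_square power3_eq_cube)
    obtain p\<^sub>1 p\<^sub>2 p\<^sub>3 q\<^sub>1 q\<^sub>2 q\<^sub>3 where
      pq: "\<And>t. cub 1 0 c\<^sub>1 c\<^sub>2 c\<^sub>3 a\<^sub>1 a\<^sub>2 a\<^sub>3 a\<^sub>4 (t *\<^sub>R ?u) = t * p\<^sub>1 + t\<^sup>2 * p\<^sub>2 + t^3 * p\<^sub>3"
        "\<And>t. cub 0 1 d\<^sub>1 d\<^sub>2 d\<^sub>3 b\<^sub>1 b\<^sub>2 b\<^sub>3 b\<^sub>4 (t *\<^sub>R ?u) = t * q\<^sub>1 + t\<^sup>2 * q\<^sub>2 + t^3 * q\<^sub>3"
      using c by blast
    show ?thesis
      unfolding \<Phi>_def Lt P pq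
      by (intro exI[of _ "p\<^sub>1 *\<^sub>R axis 1 1 + q\<^sub>1 *\<^sub>R axis 2 1"] exI[of _ "p\<^sub>2 *\<^sub>R axis 1 1 + q\<^sub>2 *\<^sub>R axis 2 1"]
          exI[of _ "p\<^sub>3 *\<^sub>R axis 1 1 + q\<^sub>3 *\<^sub>R axis 2 1"]) (simp add: algebra_simps)
  qed
  have est: "\<exists>\<delta>>0. \<forall>w v. norm w < \<delta> \<longrightarrow>
      \<bar>\<Phi>' w v \<bullet> (Gm (\<Phi> w) *v \<Phi>' w v) - ((norm v)\<^sup>2 + (w$1 * v$2 - w$2 * v$1)\<^sup>2 / 3)\<bar> \<le> \<epsilon> * (norm w)\<^sup>2 * (norm v)\<^sup>2"
    if \<epsilon>: "0 < \<epsilon>" for \<epsilon>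
  proof -
    define M where "M = 1 + \<bar>l\<^sub>1\<bar> + \<bar>l\<^sub>2\<bar> + \<bar>l\<^sub>3\<bar>"
    have M: "M > 0" unfolding M_def by simp
    have LM: "\<bar>L w $ 1\<bar> + \<bar>L w $ 2\<bar> \<le> M * norm w" for w
    proof -
      have "\<bar>L w $ 1\<bar> + \<bar>L w $ 2\<bar> \<le> \<bar>l\<^sub>1\<bar> * \<bar>w$1\<bar> + \<bar>l\<^sub>2\<bar> * \<bar>w$2\<bar> + \<bar>l\<^sub>3\<bar> * \<bar>w$2\<bar>"
        unfolding L1 L2 using abs_triangle_ineq[of "l\<^sub>1 * w$1" "l\<^sub>2 * w$2"] by (simp add: abs_mult)
      also have "\<dots> \<le> \<bar>l\<^sub>1\<bar> * norm w + \<bar>l\<^sub>2\<bar> * norm w + \<bar>l\<^sub>3\<bar> * norm w"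
        by (intro add_mono mult_left_mono component_le_norm_cart) auto
      also have "\<dots> \<le> M * norm w"
        unfolding M_def by (simp add: algebra_simps)
      finally show ?thesis .
    qed
    have Lnorm: "norm (L w) \<le> M * norm w" for w
      using order_trans[OF norm_le_l1_cart[of "L w"] LM[of w, unfolded sum_2[of "\<lambda>i. \<bar>L w $ i\<bar>", symmetric]]] by simp
    \<comment> \<open>The error is quadratic both in \<open>w\<close> and in \<open>v\<close>, and
      \<open>L\<close> enlarges each of them by at most the factor \<open>M\<close>.\<close>
    define e where "e = \<epsilon> / M^4"
    have e: "e > 0" unfolding e_def using \<epsilon> M by simp
    have "eventually (\<lambda>w. \<Phi> w \<in> V) (nhds 0)"
    proof -
      have "continuous_on UNIV \<Phi>"
        using has_derivative_continuous[OF \<Phi>d] by (intro continuous_at_imp_continuous_on) auto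
      then have "open (\<Phi> -` V)" using V(1) by (rule open_vimage[rotated])
      moreover have "0 \<in> \<Phi> -` V" using V(2) \<Phi>0 by simp
      ultimately show ?thesis using eventually_nhds_in_open[of "\<Phi> -` V" 0] by simp
    qed
    moreover have "filterlim L (nhds 0) (nhds 0)"
      using has_derivative_continuous[OF Ld, of 0] lin tendsto_at_iff_tendsto_nhds[of L 0]
      unfolding isCont_def by simp
    note ev = eventually_compose_filterlim[OF _ this]
    note ev[OF jet2_eventually[OF jets(1) e]] ev[OF jet2_eventually[OF jets(2) e]] ev[OF jet2_eventually[OF jets(3) e]]
    ultimately have "eventually (\<lambda>w. \<forall>v. \<bar>\<Phi>' w v \<bullet> (Gm (\<Phi> w) *v \<Phi>' w v) - ((norm v)\<^sup>2 + (w$1 * v$2 - w$2 * v$1)\<^sup>2 / 3)\<bar>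
        \<le> \<epsilon> * (norm w)\<^sup>2 * (norm v)\<^sup>2) (nhds 0)"
    proof eventually_elim
      case (elim w)
      let ?u = "L w" and ?y = "\<Phi> w"
      define r\<^sub>1 where "r\<^sub>1 = E ?y * J11 ?u * J11 ?u + 2 * (F ?y * J11 ?u * J21 ?u) + H ?y * J21 ?u * J21 ?u - (E x + D0 / 3 * (?u$2)\<^sup>2)"
      define r\<^sub>2 where "r\<^sub>2 = E ?y * J11 ?u * J12 ?u + F ?y * J11 ?u * J22 ?u + F ?y * J21 ?u * J12 ?u + H ?y * J21 ?u * J22 ?u - (F x - D0 / 3 * (?u$1 * ?u$2))"
      define r\<^sub>3 where "r\<^sub>3 = E ?y * J12 ?u * J12 ?u + 2 * (F ?y * J12 ?u * J22 ?u) + H ?y * J22 ?u * J22 ?u - (H x + D0 / 3 * (?u$1)\<^sup>2)"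
      have r: "\<bar>r\<^sub>1\<bar> \<le> e * (norm ?u)\<^sup>2" "\<bar>r\<^sub>2\<bar> \<le> e * (norm ?u)\<^sup>2" "\<bar>r\<^sub>3\<bar> \<le> e * (norm ?u)\<^sup>2"
        using elim(2-4) unfolding r\<^sub>1_def r\<^sub>2_def r\<^sub>3_def \<Phi>_def by simp_all
      have y: "?y \<in> V" by (rule elim(1))
      show ?case
      proof
        fix v
        let ?z = "L v"
        have sym: "Gm ?y $ 2 $ 1 = F ?y"
          using positive_definite_2(2)[OF pd(2)[OF y] pd(1)[OF y]] unfolding F_def .
        have c: "\<Phi>' w v $ 1 = J11 ?u * ?z$1 + J12 ?u * ?z$2" "\<Phi>' w v $ 2 = J21 ?u * ?z$1 + J22 ?u * ?z$2"
          unfolding \<Phi>'_def by (simp_all add: axis_def)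
        have q: "\<Phi>' w v \<bullet> (Gm ?y *v \<Phi>' w v) = E ?y * (\<Phi>' w v $ 1)\<^sup>2 + 2 * F ?y * \<Phi>' w v $ 1 * \<Phi>' w v $ 2 + H ?y * (\<Phi>' w v $ 2)\<^sup>2"
          unfolding quadratic_form_2 sym by (simp add: E_def F_def H_def power2_eq_square algebra_simps)
        have split: "\<Phi>' w v \<bullet> (Gm ?y *v \<Phi>' w v) = (E x * (?z$1)\<^sup>2 + 2 * F x * ?z$1 * ?z$2 + H x * (?z$2)\<^sup>2)
            + D0 * (?u$1 * ?z$2 - ?u$2 * ?z$1)\<^sup>2 / 3 + (r\<^sub>1 * (?z$1)\<^sup>2 + 2 * r\<^sub>2 * (?z$1 * ?z$2) + r\<^sub>3 * (?z$2)\<^sup>2)"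
          unfolding q c r\<^sub>1_def r\<^sub>2_def r\<^sub>3_def by (simp add: field_simps power2_eq_square)
        have "E x * (?z$1)\<^sup>2 + 2 * F x * ?z$1 * ?z$2 + H x * (?z$2)\<^sup>2
            = (E x * l\<^sub>1\<^sup>2) * (v$1)\<^sup>2 + 2 * (E x * l\<^sub>1 * l\<^sub>2 + F x * l\<^sub>1 * l\<^sub>3) * v$1 * v$2
              + (E x * l\<^sub>2\<^sup>2 + 2 * F x * l\<^sub>2 * l\<^sub>3 + H x * l\<^sub>3\<^sup>2) * (v$2)\<^sup>2"
          unfolding L1 L2 by (simp add: algebra_simps power2_eq_square)
        also have "\<dots> = (norm v)\<^sup>2"
          unfolding l by (simp add: norm_vec_def L2_set_def sum_2)
        finally have z1: "E x * (?z$1)\<^sup>2 + 2 * F x * ?z$1 * ?z$2 + H x * (?z$2)\<^sup>2 = (norm v)\<^sup>2" .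
        \<comment> \<open>\<open>L\<close> multiplies the area form by its determinant
          \<open>l\<^sub>1 * l\<^sub>3\<close>.\<close>
        have "D0 * (?u$1 * ?z$2 - ?u$2 * ?z$1)\<^sup>2 = (D0 * (l\<^sub>1 * l\<^sub>3)\<^sup>2) * (w$1 * v$2 - w$2 * v$1)\<^sup>2"
          unfolding L1 L2 by (simp add: algebra_simps power2_eq_square)
        then have z2: "D0 * (?u$1 * ?z$2 - ?u$2 * ?z$1)\<^sup>2 = (w$1 * v$2 - w$2 * v$1)\<^sup>2"
          unfolding l by simp
        let ?a = "\<bar>?z$1\<bar>" and ?b = "\<bar>?z$2\<bar>"
        have "\<bar>r\<^sub>1 * (?z$1)\<^sup>2 + 2 * r\<^sub>2 * (?z$1 * ?z$2) + r\<^sub>3 * (?z$2)\<^sup>2\<bar> \<le> \<bar>r\<^sub>1\<bar> * ?a\<^sup>2 + 2 * \<bar>r\<^sub>2\<bar> * (?a * ?b) + \<bar>r\<^sub>3\<bar> * ?b\<^sup>2"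
          using abs_triangle_ineq[of "r\<^sub>1 * (?z$1)\<^sup>2 + 2 * r\<^sub>2 * (?z$1 * ?z$2)" "r\<^sub>3 * (?z$2)\<^sup>2"]
            abs_triangle_ineq[of "r\<^sub>1 * (?z$1)\<^sup>2" "2 * r\<^sub>2 * (?z$1 * ?z$2)"] by (simp add: abs_mult)
        also have "\<dots> \<le> e * (norm ?u)\<^sup>2 * ?a\<^sup>2 + 2 * (e * (norm ?u)\<^sup>2) * (?a * ?b) + e * (norm ?u)\<^sup>2 * ?b\<^sup>2"
          using r by (intro add_mono mult_right_mono mult_left_mono) auto
        also have "\<dots> = e * (norm ?u)\<^sup>2 * (?a + ?b)\<^sup>2"
          by (simp add: algebra_simps power2_eq_square)
        also have "\<dots> \<le> e * (M * norm w)\<^sup>2 * (M * norm v)\<^sup>2"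
          using e LM Lnorm by (intro mult_mono power_mono mult_nonneg_nonneg) auto
        also have "\<dots> = \<epsilon> * (norm w)\<^sup>2 * (norm v)\<^sup>2"
          unfolding e_def using M by (simp add: field_simps power2_eq_square power4_eq_xxxx)
        finally show "\<bar>\<Phi>' w v \<bullet> (Gm ?y *v \<Phi>' w v) - ((norm v)\<^sup>2 + (w$1 * v$2 - w$2 * v$1)\<^sup>2 / 3)\<bar> \<le> \<epsilon> * (norm w)\<^sup>2 * (norm v)\<^sup>2"
          unfolding split z1 z2 by simp
      qed
    qed
    then show ?thesis
      unfolding eventually_nhds_metric by (auto simp: dist_norm)
  qed
  show ?thesis
    by (rule that[OF \<Phi>0 \<Phi>d \<Phi>c line est])
qed

section \<open>Spanning trees and the Steiner ratio\<close>

lemma edge_weight_eq: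
  assumes "\<And>x y. d x y = d y x"
  shows "edge_weight d {x, y} = d x y"
  unfolding edge_weight_def
proof (rule the_equality)
  fix r assume "\<exists>u v. {x, y} = {u, v} \<and> r = d u v"
  then obtain u v where uv: "{x, y} = {u, v}" "r = d u v" by blast
  then show "r = d x y"
    using assms[of x y] unfolding doubleton_eq_iff by metis
qed blast

lemma finite_complete_edges: "finite N \<Longrightarrow> finite (complete_edges N)"
proof -
  assume "finite N"
  moreover have "complete_edges N \<subseteq> (\<lambda>(x, y). {x, y}) ` (N \<times> N)"
    unfolding complete_edges_def by auto
  ultimately show ?thesis using finite_surj[of "N \<times> N"] by blast
qed

text \<open>Used twice: it shows that spanning trees exist, so that \<open>Min\<close> in
  \<open>mst_weight\<close> is meaningful, and centred in the triangle it is the competing Steiner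
  tree. A cycle passes through \<open>c\<close> at most once, so some edge of it would miss
  \<open>c\<close>.\<close>

lemma star_spanning_tree:
  assumes "c \<in> N"
  shows "is_spanning_tree N ((\<lambda>y. {c, y}) ` (N - {c}))"
  unfolding is_spanning_tree_def
proof (intro conjI)
  let ?E = "(\<lambda>y. {c, y}) ` (N - {c})"
  show "?E \<subseteq> complete_edges N"
    using assms unfolding complete_edges_def by auto
  let ?R = "{(u, v). {u, v} \<in> ?E}"
  have to: "(x, c) \<in> ?R\<^sup>*" and fro: "(c, x) \<in> ?R\<^sup>*" if "x \<in> N" for x
  proof -
    show "(x, c) \<in> ?R\<^sup>*"
      by (cases "x = c") (use that in \<open>auto simp: insert_commute intro!: r_into_rtrancl\<close>)
    show "(c, x) \<in> ?R\<^sup>*"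
      by (cases "x = c") (use that in \<open>auto intro!: r_into_rtrancl\<close>)
  qed
  show "graph_connected N ?E"
    unfolding graph_connected_def using rtrancl_trans[OF to fro] by blast
  show "\<nexists>vs. graph_cycle ?E vs"
  proof
    assume "\<exists>vs. graph_cycle ?E vs"
    then obtain vs where len: "3 \<le> length vs" and dist: "distinct vs"
      and e: "\<And>i. i < length vs \<Longrightarrow> {vs ! i, vs ! (Suc i mod length vs)} \<in> ?E"
      unfolding graph_cycle_def by blast
    let ?n = "length vs"
    have c: "vs ! i = c \<or> vs ! (Suc i mod ?n) = c" if "i < ?n" for i
      using e[OF that] by (auto simp: doubleton_eq_iff)
    have neq: "vs ! i \<noteq> vs ! j" if "i < ?n" "j < ?n" "i \<noteq> j" for i j
      using dist that nth_eq_iff_index_eq by blast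
    have c0: "vs ! 0 = c \<or> vs ! 1 = c" and c1: "vs ! 1 = c \<or> vs ! 2 = c"
    proof -
      have "Suc 0 mod ?n = 1" "Suc 1 mod ?n = 2" "0 < ?n" "1 < ?n" using len by auto
      then show "vs ! 0 = c \<or> vs ! 1 = c" "vs ! 1 = c \<or> vs ! 2 = c"
        using c[of 0] c[of 1] by auto
    qed
    show False
    \<comment> \<open>If \<open>vs ! 1\<close> is \<open>c\<close>, the edge leaving
      \<open>vs ! 2\<close> misses \<open>c\<close>; its other end is \<open>vs ! 0\<close> when the
      cycle has length 3. Otherwise both neighbours of \<open>vs ! 1\<close> would be
      \<open>c\<close>.\<close>
    proof (cases "vs ! 1 = c")
      case True
      have "vs ! 2 = c \<or> vs ! (Suc 2 mod ?n) = c"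
        using c[of 2] len by simp
      moreover have "Suc 2 mod ?n < ?n" "Suc 2 mod ?n \<noteq> 1"
        using len by (auto simp: mod_if)
      ultimately show False
        using neq[of 2 1] neq[of "Suc 2 mod ?n" 1] True len by auto
    next
      case False
      have "0 < ?n" "2 < ?n" using len by auto
      then show False using False c0 c1 neq[of 0 2] by auto
    qed
  qed
qed

locale weighted =
  fixes M :: "'a set" and d :: "'a \<Rightarrow> 'a \<Rightarrow> real"
  assumes sym: "d x y = d y x" and nonneg: "x \<in> M \<Longrightarrow> y \<in> M \<Longrightarrow> 0 \<le> d x y"
begin

lemma weight_nonneg: "N \<subseteq> M \<Longrightarrow> E \<subseteq> complete_edges N \<Longrightarrow> 0 \<le> (\<Sum>e\<in>E. edge_weight d e)"
proof (rule sum_nonneg)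
  fix e assume "N \<subseteq> M" "E \<subseteq> complete_edges N" "e \<in> E"
  then obtain x y where "e = {x, y}" "x \<in> M" "y \<in> M"
    unfolding complete_edges_def by blast
  then show "0 \<le> edge_weight d e"
    using edge_weight_eq[of d, OF sym] nonneg by simp
qed

lemma finite_trees: "finite N \<Longrightarrow> finite {E. is_spanning_tree N E}"
  by (rule finite_subset[of _ "Pow (complete_edges N)"])
    (use finite_complete_edges[of N] in \<open>auto simp: is_spanning_tree_def\<close>)

lemma finite_tree_weights: "finite N \<Longrightarrow> finite {\<Sum>e\<in>E. edge_weight d e |E. is_spanning_tree N E}"
  unfolding setcompr_eq_image by (intro finite_imageI finite_trees)

lemma mst_weight_le:
  "finite N \<Longrightarrow> is_spanning_tree N E \<Longrightarrow> mst_weight d N \<le> (\<Sum>e\<in>E. edge_weight d e)"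
  unfolding mst_weight_def by (rule Min_le[OF finite_tree_weights]) blast+

text \<open>The minimum is attained, since the star at any vertex is a spanning tree.\<close>

lemma mst_weight_ge:
  assumes "finite N" "N \<noteq> {}" "\<And>E. is_spanning_tree N E \<Longrightarrow> m \<le> (\<Sum>e\<in>E. edge_weight d e)"
  shows "m \<le> mst_weight d N"
proof -
  obtain c where "c \<in> N" using assms(2) by blast
  then have "{\<Sum>e\<in>E. edge_weight d e |E. is_spanning_tree N E} \<noteq> {}"
    using star_spanning_tree[of c N] by blast
  from Min_in[OF finite_tree_weights[OF assms(1)] this] obtain E where
    "is_spanning_tree N E" "mst_weight d N = (\<Sum>e\<in>E. edge_weight d e)"
    unfolding mst_weight_def by blast
  then show ?thesis using assms(3) by simp
qed

lemma mst_weight_nonneg: "finite N \<Longrightarrow> N \<noteq> {} \<Longrightarrow> N \<subseteq> M \<Longrightarrow> 0 \<le> mst_weight d N"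
  by (rule mst_weight_ge, assumption+) (rule weight_nonneg, assumption, simp add: is_spanning_tree_def)

lemma mst_weight_le_star:
  assumes "finite N" "c \<in> N"
  shows "mst_weight d N \<le> (\<Sum>y\<in>N - {c}. d c y)"
proof -
  have "inj_on (\<lambda>y. {c, y}) (N - {c})"
    by (auto simp: inj_on_def doubleton_eq_iff)
  then have "(\<Sum>e\<in>(\<lambda>y. {c, y}) ` (N - {c}). edge_weight d e) = (\<Sum>y\<in>N - {c}. d c y)"
    using edge_weight_eq[of d, OF sym] by (simp add: sum.reindex)
  then show ?thesis
    using mst_weight_le[OF assms(1) star_spanning_tree[OF assms(2)]] by simp
qed

text \<open>The edges of a connected graph on \<open>N\<close> cover it, and a single edge covers
  only two of the three points; so there are at least two edges.\<close>

lemma mst_weight_3_ge: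
  assumes "card N = 3" "0 \<le> a" "\<And>x y. x \<in> N \<Longrightarrow> y \<in> N \<Longrightarrow> x \<noteq> y \<Longrightarrow> a \<le> d x y"
  shows "2 * a \<le> mst_weight d N"
proof (rule mst_weight_ge)
  show fin: "finite N" using assms(1) card.infinite by fastforce
  show "N \<noteq> {}" using assms(1) by auto
  fix E assume E: "is_spanning_tree N E"
  have sub: "E \<subseteq> complete_edges N" and con: "graph_connected N E"
    using E unfolding is_spanning_tree_def by auto
  have finE: "finite E" using finite_subset[OF sub finite_complete_edges[OF fin]] .
  have cover: "N \<subseteq> \<Union>E"
  proof
    fix x assume x: "x \<in> N"
    have "N \<noteq> {x}" using assms(1) by auto
    then obtain y where y: "y \<in> N" "y \<noteq> x" using x by blast
    have "(x, y) \<in> {(u, v). {u, v} \<in> E}\<^sup>*"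
      using con x y(1) unfolding graph_connected_def by blast
    then obtain z where "{x, z} \<in> E"
      using y(2) by (cases rule: converse_rtranclE) auto
    then show "x \<in> \<Union>E" by blast
  qed
  have two: "card e \<le> 2" if "e \<in> E" for e
    using that sub card_2_iff unfolding complete_edges_def by fastforce
  have "2 \<le> card E"
  proof (rule ccontr)
    assume "\<not> 2 \<le> card E"
    then have "card E = 0 \<or> card E = 1" by linarith
    then show False
    proof
      assume "card E = 0"
      then show False using cover finE assms(1) by auto
    next
      assume "card E = 1"
      then obtain e where e: "E = {e}" by (auto simp: card_1_singleton_iff)
      then have "N \<subseteq> e" using cover by simp
      moreover have "finite e" using sub e unfolding complete_edges_def by auto
      ultimately have "card N \<le> card e" by (rule card_mono[rotated])
      then show False using two[of e] e assms(1) by simp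
    qed
  qed
  then have "2 * a \<le> of_nat (card E) * a"
    using assms(2) by (intro mult_right_mono) auto
  also have "\<dots> \<le> (\<Sum>e\<in>E. edge_weight d e)"
  proof (rule sum_bounded_below)
    fix e assume "e \<in> E"
    then obtain x y where "e = {x, y}" "x \<in> N" "y \<in> N" "x \<noteq> y"
      using sub unfolding complete_edges_def by blast
    then show "a \<le> edge_weight d e"
      using edge_weight_eq[of d, OF sym] assms(3) by simp
  qed
  finally show "2 * a \<le> (\<Sum>e\<in>E. edge_weight d e)" .
qed

text \<open>Nonnegative weights exclude the meaningless value of \<open>Inf\<close> on a set without
  lower bound.\<close>

lemma smt_weight_le:
  assumes "finite N'" "N \<subseteq> N'" "N' \<subseteq> M" "N \<noteq> {}"
  shows "smt_weight M d N \<le> mst_weight d N'"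
  unfolding smt_weight_def
proof (rule cInf_lower)
  show "bdd_below {mst_weight d N' |N'. finite N' \<and> N \<subseteq> N' \<and> N' \<subseteq> M}"
    using mst_weight_nonneg assms(4) by (intro bdd_belowI[of _ 0]) blast
qed (use assms in blast)

lemma smt_weight_nonneg:
  assumes "finite N" "N \<subseteq> M" "N \<noteq> {}"
  shows "0 \<le> smt_weight M d N"
  unfolding smt_weight_def
proof (rule cInf_greatest)
  show "{mst_weight d N' |N'. finite N' \<and> N \<subseteq> N' \<and> N' \<subseteq> M} \<noteq> {}" using assms by blast
  show "0 \<le> x" if "x \<in> {mst_weight d N' |N'. finite N' \<and> N \<subseteq> N' \<and> N' \<subseteq> M}" for x
    using that mst_weight_nonneg assms(3) by blast
qed

lemma steiner_ratio_le:
  assumes "finite N" "N \<subseteq> M" "2 \<le> card N"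
  shows "steiner_ratio M d \<le> smt_weight M d N / mst_weight d N"
  unfolding steiner_ratio_def
proof (rule cInf_lower)
  have "0 \<le> smt_weight M d N / mst_weight d N" if N: "finite N" "N \<subseteq> M" "2 \<le> card N" for N
  proof -
    have "N \<noteq> {}" using N(3) by auto
    then show ?thesis
      using smt_weight_nonneg[OF N(1,2)] mst_weight_nonneg[OF N(1) _ N(2)] by simp
  qed
  then show "bdd_below {smt_weight M d N / mst_weight d N |N. finite N \<and> N \<subseteq> M \<and> 2 \<le> card N}"
    by (intro bdd_belowI[of _ 0]) blast
qed (use assms in blast)

text \<open>The star at \<open>c\<close> has total weight at most \<open>3 * s\<close>, while a tree
  on the three vertices alone contains at least two sides.\<close>

lemma steiner_ratio_triangle:
  assumes P: "{c, p\<^sub>1, p\<^sub>2, p\<^sub>3} \<subseteq> M" and dist: "p\<^sub>1 \<noteq> p\<^sub>2" "p\<^sub>2 \<noteq> p\<^sub>3" "p\<^sub>3 \<noteq> p\<^sub>1"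
    and s: "d c p\<^sub>1 \<le> s" "d c p\<^sub>2 \<le> s" "d c p\<^sub>3 \<le> s"
    and a: "a \<le> d p\<^sub>1 p\<^sub>2" "a \<le> d p\<^sub>2 p\<^sub>3" "a \<le> d p\<^sub>3 p\<^sub>1" "0 < a"
  shows "steiner_ratio M d \<le> 3 * s / (2 * a)"
proof -
  let ?N = "{p\<^sub>1, p\<^sub>2, p\<^sub>3}" and ?N' = "{c, p\<^sub>1, p\<^sub>2, p\<^sub>3}"
  have card: "card ?N = 3" using dist by auto
  have s0: "0 \<le> s" using nonneg[of c p\<^sub>1] P s(1) by auto
  have "a \<le> d x y" if "x \<in> ?N" "y \<in> ?N" "x \<noteq> y" for x y
    using that a sym[of p\<^sub>2 p\<^sub>1] sym[of p\<^sub>3 p\<^sub>2] sym[of p\<^sub>1 p\<^sub>3] by (elim insertE) simp_all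
  from mst_weight_3_ge[OF card _ this] a(4) have m: "2 * a \<le> mst_weight d ?N" by simp
  have "smt_weight M d ?N \<le> mst_weight d ?N'"
    using P by (intro smt_weight_le) auto
  also have "\<dots> \<le> (\<Sum>y\<in>?N' - {c}. d c y)"
    by (rule mst_weight_le_star) auto
  also have "\<dots> \<le> (\<Sum>y\<in>?N' - {c}. s)"
    using s by (intro sum_mono) auto
  \<comment> \<open>If \<open>c\<close> happens to be one of the three points, the left sum has a
    term less; \<open>0 \<le> s\<close> covers this case.\<close>
  also have "\<dots> \<le> (\<Sum>y\<in>?N. s)"
    using s0 by (intro sum_mono2) auto
  also have "\<dots> = 3 * s" using card by simp
  finally have t: "smt_weight M d ?N \<le> 3 * s" .
  have "steiner_ratio M d \<le> smt_weight M d ?N / mst_weight d ?N"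
    using P card by (intro steiner_ratio_le) auto
  also have "\<dots> \<le> 3 * s / (2 * a)"
    using t m a(4) s0 by (intro frac_le) auto
  finally show ?thesis .
qed

end

section \<open>Small equilateral triangles\<close>

text \<open>\<open>\<Phi>\<close> is not added to the atlas, because speed and distance refer to
  \<open>A\<close>. Everything is computed in the given chart \<open>c\<close>, and the local
  inverse \<open>\<psi>\<close> carries functions of the normal coordinates over to it.\<close>

locale normal_chart = riemannian X A g
  for X :: "'a topology" and A :: "('a, 2) chart set" and g :: "('a, 2) metric_components" +
  fixes c :: "('a, 2) chart" and \<Phi> :: "real^2 \<Rightarrow> real^2" and \<Phi>' :: "real^2 \<Rightarrow> real^2 \<Rightarrow> real^2"
    and U :: "(real^2) set" and \<psi> :: "real^2 \<Rightarrow> real^2" and \<psi>' :: "real^2 \<Rightarrow> real^2 \<Rightarrow> real^2"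
  assumes connected: "connected_space X"
    and c: "c \<in> A" and U: "open U" "0 \<in> U" "open (\<Phi> ` U)" "\<Phi> ` U \<subseteq> snd c ` fst c"
    and \<psi>: "\<And>w. w \<in> U \<Longrightarrow> \<psi> (\<Phi> w) = w" "\<And>y. y \<in> \<Phi> ` U \<Longrightarrow> (\<psi> has_derivative \<psi>' y) (at y)"
    and right_inverse: "\<And>w v. w \<in> U \<Longrightarrow> \<Phi>' w (\<psi>' (\<Phi> w) v) = v"
    and \<Phi>: "\<And>w. (\<Phi> has_derivative \<Phi>' w) (at w)"
    and line: "\<And>w. \<exists>k\<^sub>0 k\<^sub>1 k\<^sub>2 k\<^sub>3. \<forall>t. \<Phi> (t *\<^sub>R w) = k\<^sub>0 + t *\<^sub>R k\<^sub>1 + t\<^sup>2 *\<^sub>R k\<^sub>2 + t^3 *\<^sub>R k\<^sub>3"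
    and estimate: "\<And>\<epsilon>. 0 < \<epsilon> \<Longrightarrow> \<exists>\<delta>>0. \<forall>w v. norm w < \<delta> \<longrightarrow>
      \<bar>\<Phi>' w v \<bullet> (g c (\<Phi> w) *v \<Phi>' w v) - ((norm v)\<^sup>2 + (w$1 * v$2 - w$2 * v$1)\<^sup>2 / 3)\<bar> \<le> \<epsilon> * (norm w)\<^sup>2 * (norm v)\<^sup>2"

text \<open>At the origin the estimate says that \<open>\<Phi>' 0\<close> is isometric for the
  metric, hence injective, and the inverse function theorem supplies \<open>\<psi>\<close>.\<close>

lemma normal_chart_exists:
  fixes A :: "('a, 2) chart set"
  assumes R: "riemannian X A g" and con: "connected_space X" and K: "constant_curvature A g (-1)"
  shows "\<exists>c \<Phi> \<Phi>' U \<psi> \<psi>'. normal_chart X A g c \<Phi> \<Phi>' U \<psi> \<psi>'"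
proof -
  interpret riemannian X A g by (rule R)
  obtain p c where c: "c \<in> A" "p \<in> fst c"
    using manifoldD(2) chart_ex by blast
  define V x where "V = snd c ` fst c" and "x = snd c p"
  have V: "open V" "x \<in> V"
    unfolding V_def x_def using chart_open_image[OF chart[OF c(1)]] c(2) by auto
  have s: "smooth_on V (g c)" and pos: "\<forall>y\<in>V. transpose (g c y) = g c y \<and> (\<forall>v. v \<noteq> 0 \<longrightarrow> v \<bullet> (g c y *v v) > 0)"
    using metric c(1) unfolding riemannian_metric_def V_def by blast+
  have k: "gaussian_curvature (g c) x = -1"
    using K c unfolding constant_curvature_def x_def by blast
  obtain \<Phi> :: "real^2 \<Rightarrow> real^2" and \<Phi>' :: "real^2 \<Rightarrow> real^2 \<Rightarrow> real^2" where
    \<Phi>: "\<Phi> 0 = x" "\<And>w. (\<Phi> has_derivative \<Phi>' w) (at w)" "\<And>v. continuous_on UNIV (\<lambda>w. \<Phi>' w v)"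
    "\<And>w. \<exists>k\<^sub>1 k\<^sub>2 k\<^sub>3. \<forall>t. \<Phi> (t *\<^sub>R w) = x + t *\<^sub>R k\<^sub>1 + t\<^sup>2 *\<^sub>R k\<^sub>2 + t^3 *\<^sub>R k\<^sub>3"
    "\<And>\<epsilon>. 0 < \<epsilon> \<Longrightarrow> \<exists>\<delta>>0. \<forall>w v. norm w < \<delta> \<longrightarrow>
      \<bar>\<Phi>' w v \<bullet> (g c (\<Phi> w) *v \<Phi>' w v) - ((norm v)\<^sup>2 + (w$1 * v$2 - w$2 * v$1)\<^sup>2 / 3)\<bar> \<le> \<epsilon> * (norm w)\<^sup>2 * (norm v)\<^sup>2"
    by (rule normal_coordinates[OF V s pos k]) (rule that)
  have bl: "bounded_linear (\<Phi>' w)" for w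
    using \<Phi>(2) by (rule has_derivative_bounded_linear)
  define f' where "f' w = Blinfun (\<Phi>' w)" for w
  have f': "blinfun_apply (f' w) = \<Phi>' w" for w
    unfolding f'_def by (rule bounded_linear_Blinfun_apply[OF bl])
  have "continuous_on UNIV \<Phi>"
    using has_derivative_continuous[OF \<Phi>(2)] by (intro continuous_at_imp_continuous_on) auto
  then have oU: "open (\<Phi> -` V)" using V(1) by (rule open_vimage[rotated])
  have inj: "\<Phi>' 0 v = 0 \<Longrightarrow> v = 0" for v
  proof -
    assume z: "\<Phi>' 0 v = 0"
    obtain \<delta> where "\<delta> > 0" "\<And>w v. norm w < \<delta> \<Longrightarrow>
      \<bar>\<Phi>' w v \<bullet> (g c (\<Phi> w) *v \<Phi>' w v) - ((norm v)\<^sup>2 + (w$1 * v$2 - w$2 * v$1)\<^sup>2 / 3)\<bar> \<le> 1 * (norm w)\<^sup>2 * (norm v)\<^sup>2"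
      using \<Phi>(5)[OF zero_less_one] by blast
    \<comment> \<open>At \<open>w = 0\<close> both the error and the curvature term vanish, so any
      tolerance will do.\<close>
    from this(2)[of 0 v] this(1) show "v = 0" using z by simp
  qed
  have lin: "linear (\<Phi>' 0)" using bl bounded_linear.linear by blast
  then have "inj (\<Phi>' 0)" using inj linear_injective_0[OF lin] by blast
  then obtain h where h: "linear h" "h \<circ> \<Phi>' 0 = id"
    using linear_injective_left_inverse[OF lin] by blast
  have hb: "blinfun_apply (Blinfun h) = h"
    using h(1) by (intro bounded_linear_Blinfun_apply linear_conv_bounded_linear[THEN iffD1])
  have inv: "Blinfun h o\<^sub>L f' 0 = id_blinfun"
    by (rule blinfun_eqI) (use h(2) in \<open>simp add: hb f' fun_eq_iff\<close>)
  have der: "(\<Phi> has_derivative blinfun_apply (f' w)) (at w)" if "w \<in> \<Phi> -` V" for w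
    unfolding f' by (rule \<Phi>(2))
  have cont: "continuous_on (\<Phi> -` V) f'"
    by (rule continuous_on_blinfun_componentwise) (use f' \<Phi>(3) continuous_on_subset in \<open>auto intro: continuous_on_subset\<close>)
  have "0 \<in> \<Phi> -` V" using V(2) \<Phi>(1) by simp
  from inverse_function_theorem[OF oU der cont this inv]
  obtain U W \<psi> \<psi>' where U: "open U" "U \<subseteq> \<Phi> -` V" "0 \<in> U" "open W" "\<Phi> 0 \<in> W" "homeomorphism U W \<Phi> \<psi>"
    "\<And>y. y \<in> W \<Longrightarrow> (\<psi> has_derivative \<psi>' y) (at y)"
    "\<And>y. y \<in> W \<Longrightarrow> \<psi>' y = inv (blinfun_apply (f' (\<psi> y)))"
    "\<And>y. y \<in> W \<Longrightarrow> bij (blinfun_apply (f' (\<psi> y)))"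
    by metis
  have W: "\<Phi> ` U = W" "\<And>w. w \<in> U \<Longrightarrow> \<psi> (\<Phi> w) = w"
    using U(6) unfolding homeomorphism_def by auto
  have "normal_chart X A g c \<Phi> \<Phi>' U \<psi> \<psi>'"
  proof
    show "\<Phi>' w (\<psi>' (\<Phi> w) v) = v" if w: "w \<in> U" for w v
    proof -
      have "\<Phi> w \<in> W" using w W(1) by blast
      from U(8)[OF this] U(9)[OF this] show ?thesis
        unfolding W(2)[OF w] f' using surj_f_inv_f[OF bij_is_surj] by metis
    qed
    show "\<exists>k\<^sub>0 k\<^sub>1 k\<^sub>2 k\<^sub>3. \<forall>t. \<Phi> (t *\<^sub>R w) = k\<^sub>0 + t *\<^sub>R k\<^sub>1 + t\<^sup>2 *\<^sub>R k\<^sub>2 + t^3 *\<^sub>R k\<^sub>3" for w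
      using \<Phi>(4)[of w] by (rule exI)
    show "\<Phi> ` U \<subseteq> snd c ` fst c" using U(2) unfolding V_def by auto
  qed (use con c U W \<Phi> in auto)
  then show ?thesis by blast
qed

text \<open>The left side is the squared differential of \<open>x + x y^2 / 6\<close> at
  \<open>(X, Y)\<close> in the direction \<open>(a, b)\<close>, the right side the model metric plus
  an error of fourth order. The second order multiples of \<open>a\<^sup>2\<close> cancel, and the
  mixed term of second order is absorbed by \<open>b\<^sup>2\<close>, of which the left side
  contains only a fourth order multiple.\<close>

lemma calibration_ineq:
  fixes X Y a b :: real
  assumes s: "X\<^sup>2 + Y\<^sup>2 \<le> 1"
  shows "((1 + Y\<^sup>2 / 6) * a + X * Y / 3 * b)\<^sup>2 \<le> a\<^sup>2 + b\<^sup>2 + (X * b - Y * a)\<^sup>2 / 3 + (X\<^sup>2 + Y\<^sup>2)\<^sup>2 * (a\<^sup>2 + b\<^sup>2)"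
proof -
  let ?s = "X\<^sup>2 + Y\<^sup>2"
  \<comment> \<open>The coefficient of the mixed term in the difference of the sides:
    \<open>2 / 3\<close> from the metric plus \<open>2 / 3 + Y\<^sup>2 / 9\<close> from the squared
    differential.\<close>
  define m where "m = 4 / 3 + Y\<^sup>2 / 9"
  have Y1: "Y\<^sup>2 \<le> 1" and X0: "0 \<le> X\<^sup>2" and Y0: "0 \<le> Y\<^sup>2" using s by (auto intro: order_trans[OF _ s])
  have XY: "4 * (X\<^sup>2 * Y\<^sup>2) \<le> ?s\<^sup>2"
    using zero_le_power2[of "X\<^sup>2 - Y\<^sup>2"] by (simp add: power2_eq_square algebra_simps)
  have Y4: "Y^4 \<le> ?s\<^sup>2"
    using power_mono[of "Y\<^sup>2" ?s 2] by simp
  have s2: "?s\<^sup>2 \<le> 1" using s by (simp add: power_le_one)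
  \<comment> \<open>\<open>13 / 9\<close> is the value of \<open>m\<close> at
    \<open>Y\<^sup>2 = 1\<close>.\<close>
  have m: "m\<^sup>2 \<le> (13/9)\<^sup>2" unfolding m_def using Y1 by (intro power_mono) auto
  have "0 \<le> (b - m * (X * Y) * a)\<^sup>2" by simp
  then have 1: "2 * (m * (X * Y) * a * b) \<le> b\<^sup>2 + m\<^sup>2 * (X\<^sup>2 * Y\<^sup>2) * a\<^sup>2"
    by (simp add: power2_eq_square algebra_simps)
  have "m\<^sup>2 * (X\<^sup>2 * Y\<^sup>2) * a\<^sup>2 \<le> (13/9)\<^sup>2 * (?s\<^sup>2 / 4) * a\<^sup>2"
    using m XY by (intro mult_mono) auto
  then have 2: "m\<^sup>2 * (X\<^sup>2 * Y\<^sup>2) * a\<^sup>2 \<le> 169/324 * (?s\<^sup>2 * a\<^sup>2)"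
    by (simp add: power2_eq_square)
  have 3: "Y^4 * a\<^sup>2 \<le> ?s\<^sup>2 * a\<^sup>2" using Y4 by (intro mult_right_mono) auto
  have 4: "(X\<^sup>2 * Y\<^sup>2) * b\<^sup>2 \<le> 1 * b\<^sup>2" using XY s2 by (intro mult_right_mono) auto
  have 5: "0 \<le> ?s\<^sup>2 * b\<^sup>2" "0 \<le> X\<^sup>2 * b\<^sup>2" "0 \<le> ?s\<^sup>2 * a\<^sup>2" "0 \<le> b\<^sup>2" by auto
  have "a\<^sup>2 + b\<^sup>2 + (X * b - Y * a)\<^sup>2 / 3 + ?s\<^sup>2 * (a\<^sup>2 + b\<^sup>2) - ((1 + Y\<^sup>2 / 6) * a + X * Y / 3 * b)\<^sup>2
      = ?s\<^sup>2 * a\<^sup>2 + ?s\<^sup>2 * b\<^sup>2 + b\<^sup>2 + X\<^sup>2 * b\<^sup>2 / 3 - (X\<^sup>2 * Y\<^sup>2) * b\<^sup>2 / 9 - Y^4 * a\<^sup>2 / 36 - m * (X * Y) * a * b"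
    unfolding m_def by (simp add: power2_eq_square power4_eq_xxxx field_simps)
  also have "\<dots> \<ge> 0" using 1 2 3 4 5 by linarith
  finally show ?thesis by simp
qed

section \<open>Length estimates in approximate normal coordinates\<close>

context normal_chart
begin

text \<open>The metric of the surface pulled back by \<open>\<Phi>\<close>.\<close>

definition Q :: "real^2 \<Rightarrow> real^2 \<Rightarrow> real"
  where "Q w v = \<Phi>' w v \<bullet> (g c (\<Phi> w) *v \<Phi>' w v)"

definition pt :: "real^2 \<Rightarrow> 'a"
  where "pt w = inv_into (fst c) (snd c) (\<Phi> w)"

lemma pt:
  assumes "w \<in> U"
  shows "pt w \<in> fst c" "snd c (pt w) = \<Phi> w" "pt w \<in> topspace X"
proof -
  have "\<Phi> w \<in> snd c ` fst c" using assms U(4) by blast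
  then show "pt w \<in> fst c" "snd c (pt w) = \<Phi> w"
    unfolding pt_def by (simp_all add: inv_into_into f_inv_into_f)
  then show "pt w \<in> topspace X" using chart_subset[OF c] by blast
qed

text \<open>This is \<open>curve_variation_le\<close> for \<open>F\<close> composed with
  \<open>\<psi>\<close>: by \<open>right_inverse\<close>, the metric norm of \<open>v\<close> in the
  chart equals the \<open>Q\<close> norm of \<open>\<psi>' y v\<close>.\<close>

lemma coordinate_variation_le:
  assumes \<gamma>: "piecewise_smooth_curve X A \<gamma>" and \<tau>: "\<tau> \<in> {0..1}" and B: "B \<subseteq> U"
    and K: "\<And>t. t \<in> {0..\<tau>} \<Longrightarrow> \<gamma> t \<in> fst c \<and> snd c (\<gamma> t) \<in> \<Phi> ` B"
    and F: "\<And>w. w \<in> B \<Longrightarrow> (F has_derivative F' w) (at w)"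
    and C: "\<And>w v. w \<in> B \<Longrightarrow> \<bar>F' w v\<bar> \<le> C * sqrt (Q w v)" "0 \<le> C"
  shows "\<bar>F (\<psi> (snd c (\<gamma> \<tau>))) - F (\<psi> (snd c (\<gamma> 0)))\<bar> \<le> C * curve_length A g \<gamma>"
proof (rule curve_variation_le[OF \<gamma> c \<tau> K, where F = "\<lambda>y. F (\<psi> y)" and F' = "\<lambda>y v. F' (\<psi> y) (\<psi>' y v)"])
  fix y assume y: "y \<in> \<Phi> ` B"
  then obtain w where w: "w \<in> B" "y = \<Phi> w" by blast
  have wU: "w \<in> U" using w B by blast
  have \<psi>y: "\<psi> y = w" unfolding w(2) by (rule \<psi>(1)[OF wU])
  show "((\<lambda>y. F (\<psi> y)) has_derivative (\<lambda>v. F' (\<psi> y) (\<psi>' y v))) (at y)"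
    by (rule has_derivative_compose[OF \<psi>(2)]) (use F[OF w(1)] \<psi>y w(2) wU in auto)
  fix v
  show "\<bar>F' (\<psi> y) (\<psi>' y v)\<bar> \<le> C * sqrt (v \<bullet> (g c y *v v))"
    using C(1)[OF w(1), of "\<psi>' y v"] right_inverse[OF wU, of v] \<psi>(1)[OF wU] unfolding Q_def w(2) by simp
qed (use C(2) in auto)

text \<open>\<open>r\<close> is the circumradius of the triangle. The tolerance
  \<open>1 / 1000000\<close> has to stay far below the gain \<open>1 / 24\<close> even after the
  factor 100 caused by working on the ball of radius \<open>10 * r\<close>.\<close>

context
  fixes r :: real
  assumes r: "0 < r" "r \<le> 1 / 100000" and ball: "cball 0 (10 * r) \<subseteq> U"
    and est: "\<And>w v. norm w \<le> 10 * r \<Longrightarrow>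
      \<bar>Q w v - ((norm v)\<^sup>2 + (w$1 * v$2 - w$2 * v$1)\<^sup>2 / 3)\<bar> \<le> 1 / 1000000 * (norm w)\<^sup>2 * (norm v)\<^sup>2"
begin

lemma r2: "r\<^sup>2 \<le> 1 / 10000000000" "0 < r\<^sup>2"
  using power_mono[OF r(2), of 2] r(1) by (simp_all add: power_divide)

lemma norm_in:
  assumes "norm w \<le> 10 * r"
  shows "w \<in> U" "(norm w)\<^sup>2 \<le> 100 * r\<^sup>2" "(norm v)\<^sup>2 \<le> 2 * Q w v"
proof -
  show "w \<in> U" using assms ball by auto
  show w2: "(norm w)\<^sup>2 \<le> 100 * r\<^sup>2"
    using power_mono[OF assms, of 2] by (simp add: power_mult_distrib)
  have "1 / 1000000 * (norm w)\<^sup>2 \<le> 1 / 2" using w2 r2 by simp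
  then have "1 / 1000000 * (norm w)\<^sup>2 * (norm v)\<^sup>2 \<le> 1 / 2 * (norm v)\<^sup>2"
    by (rule mult_right_mono) simp
  moreover have "0 \<le> (w$1 * v$2 - w$2 * v$1)\<^sup>2 / 3" by simp
  ultimately show "(norm v)\<^sup>2 \<le> 2 * Q w v"
    using est[OF assms, of v] by linarith
qed

text \<open>On a radial segment position and velocity are parallel, so the curvature term vanishes
  and only the tolerance remains.\<close>

lemma dist_radius_le:
  assumes e: "norm e = 1"
  shows "d (pt 0) (pt (r *\<^sub>R e)) \<le> r * (1 + r\<^sup>2 / 1000000)"
proof -
  let ?w = "r *\<^sub>R e"
  define \<sigma> where "\<sigma> t = \<Phi> (t *\<^sub>R ?w)" for t :: real
  obtain k\<^sub>0 k\<^sub>1 k\<^sub>2 k\<^sub>3 where k: "\<And>t. \<sigma> t = k\<^sub>0 + t *\<^sub>R k\<^sub>1 + t\<^sup>2 *\<^sub>R k\<^sub>2 + t^3 *\<^sub>R k\<^sub>3"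
    using line[of ?w] unfolding \<sigma>_def by blast
  have "no_isolated {0..1}"
    using no_isolated_openin[of 0 1 "{0..1}"] by simp
  then have s: "smooth_on {0..1} \<sigma>"
    unfolding k[abs_def] by (rule smooth_on_cubic)
  have nw: "norm (t *\<^sub>R ?w) \<le> r" if "t \<in> {0..1}" for t
    using that e r(1) mult_right_mono[of t 1 r] by (simp add: mult_ac)
  have nU: "t *\<^sub>R ?w \<in> U" if "t \<in> {0..1}" for t
    using norm_in(1) nw[OF that] r(1) by simp
  then have im: "\<sigma> ` {0..1} \<subseteq> snd c ` fst c"
    unfolding \<sigma>_def using U(4) by blast
  have "d (inv_into (fst c) (snd c) (\<sigma> 0)) (inv_into (fst c) (snd c) (\<sigma> 1)) \<le> r * (1 + r\<^sup>2 / 1000000)"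
  proof (rule dist_le_chart[OF c s im])
    fix t :: real assume t: "t \<in> {0<..<1}"
    have "((\<lambda>t. t *\<^sub>R ?w) has_vector_derivative ?w) (at t)"
      using has_vector_derivative_scaleR[OF DERIV_ident has_vector_derivative_const, of ?w t UNIV] by simp
    from vector_derivative_diff_chain_within[OF this has_derivative_at_withinI[OF \<Phi>]]
    show "(\<sigma> has_vector_derivative \<Phi>' (t *\<^sub>R ?w) ?w) (at t)"
      unfolding \<sigma>_def[abs_def] o_def .
    have n: "norm (t *\<^sub>R ?w) \<le> r" using nw t by simp
    have "(norm (t *\<^sub>R ?w))\<^sup>2 \<le> r\<^sup>2" using power_mono[OF n, of 2] by simp
    then have "1 / 1000000 * (norm (t *\<^sub>R ?w))\<^sup>2 * (norm ?w)\<^sup>2 \<le> 1 / 1000000 * r\<^sup>2 * r\<^sup>2"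
      using e r(1) by (intro mult_mono) auto
    moreover have "\<bar>Q (t *\<^sub>R ?w) ?w - ((norm ?w)\<^sup>2 + ((t *\<^sub>R ?w)$1 * ?w$2 - (t *\<^sub>R ?w)$2 * ?w$1)\<^sup>2 / 3)\<bar>
        \<le> 1 / 1000000 * (norm (t *\<^sub>R ?w))\<^sup>2 * (norm ?w)\<^sup>2"
      using n r(1) by (intro est) simp
    moreover have "((t *\<^sub>R ?w)$1 * ?w$2 - (t *\<^sub>R ?w)$2 * ?w$1)\<^sup>2 = 0" by simp
    moreover have "(norm ?w)\<^sup>2 = r\<^sup>2" using e r(1) by simp
    ultimately have "Q (t *\<^sub>R ?w) ?w \<le> r\<^sup>2 + 1 / 1000000 * r\<^sup>2 * r\<^sup>2" by linarith
    also have "\<dots> \<le> (r * (1 + r\<^sup>2 / 1000000))\<^sup>2"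
      using r(1) by (simp add: power2_eq_square field_simps add_nonneg_nonneg)
    finally have "sqrt (Q (t *\<^sub>R ?w) ?w) \<le> r * (1 + r\<^sup>2 / 1000000)"
      using r(1) by (intro real_le_lsqrt) auto
    then show "sqrt (\<Phi>' (t *\<^sub>R ?w) ?w \<bullet> (g c (\<sigma> t) *v \<Phi>' (t *\<^sub>R ?w) ?w)) \<le> r * (1 + r\<^sup>2 / 1000000)"
      unfolding Q_def \<sigma>_def .
  qed
  then show ?thesis unfolding \<sigma>_def pt_def by simp
qed

lemma inner_2: "x \<bullet> y = x$1 * y$1 + x$2 * y$2" for x y :: "real^2"
  by (simp add: inner_vec_def sum_2)

lemma norm_2: "(norm x)\<^sup>2 = (x$1)\<^sup>2 + (x$2)\<^sup>2" for x :: "real^2"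
  unfolding power2_norm_eq_inner inner_2 by (simp add: power2_eq_square)

text \<open>The calibration \<open>F\<close> in the proof is the cubic Taylor polynomial of the hyperbolic distance to the
  perpendicular bisector of the side: \<open>sinh F = sinh \<rho> cos \<theta>\<close> in polar coordinates. A curve that leaves
  the ball of radius \<open>10 r\<close> is too long anyway.\<close>

lemma dist_vertices_ge:
  assumes a: "a\<^sub>1\<^sup>2 + a\<^sub>2\<^sup>2 = 1"
    and p: "p = r *\<^sub>R vector [- sqrt 3 / 2 * a\<^sub>1 - a\<^sub>2 / 2, - sqrt 3 / 2 * a\<^sub>2 + a\<^sub>1 / 2]"
    and q: "q = r *\<^sub>R vector [sqrt 3 / 2 * a\<^sub>1 - a\<^sub>2 / 2, sqrt 3 / 2 * a\<^sub>2 + a\<^sub>1 / 2]"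
  shows "sqrt 3 * r * (1 + r\<^sup>2 / 25) \<le> d (pt p) (pt q)"
proof -
  \<comment> \<open>Coordinates along and across the side, whose direction is
    \<open>(a\<^sub>1, a\<^sub>2)\<close>. This rotation preserves the norm and the area form, hence
    the model metric, so that one computation serves all three sides.\<close>
  define x y :: "real^2 \<Rightarrow> real" where "x w = a\<^sub>1 * w$1 + a\<^sub>2 * w$2" and "y w = a\<^sub>1 * w$2 - a\<^sub>2 * w$1" for w
  have frame: "(norm w)\<^sup>2 = (x w)\<^sup>2 + (y w)\<^sup>2" for w
  proof -
    have "(x w)\<^sup>2 + (y w)\<^sup>2 = (a\<^sub>1\<^sup>2 + a\<^sub>2\<^sup>2) * ((w$1)\<^sup>2 + (w$2)\<^sup>2)"
      unfolding x_def y_def by (simp add: power2_eq_square algebra_simps)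
    then show ?thesis unfolding a norm_2 by simp
  qed
  have cross: "w$1 * v$2 - w$2 * v$1 = x w * y v - y w * x v" for w v
  proof -
    have "x w * y v - y w * x v = (a\<^sub>1\<^sup>2 + a\<^sub>2\<^sup>2) * (w$1 * v$2 - w$2 * v$1)"
      unfolding x_def y_def by (simp add: power2_eq_square algebra_simps)
    then show ?thesis unfolding a by simp
  qed
  have xp: "x p = - (sqrt 3 / 2 * r)" "y p = r / 2" "x q = sqrt 3 / 2 * r" "y q = r / 2"
  proof -
    have *: "a\<^sub>1 * a\<^sub>1 + a\<^sub>2 * a\<^sub>2 = 1" using a by (simp add: power2_eq_square)
    have "x p = - (sqrt 3 / 2 * r) * (a\<^sub>1 * a\<^sub>1 + a\<^sub>2 * a\<^sub>2)" "y p = r / 2 * (a\<^sub>1 * a\<^sub>1 + a\<^sub>2 * a\<^sub>2)"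
      "x q = sqrt 3 / 2 * r * (a\<^sub>1 * a\<^sub>1 + a\<^sub>2 * a\<^sub>2)" "y q = r / 2 * (a\<^sub>1 * a\<^sub>1 + a\<^sub>2 * a\<^sub>2)"
      unfolding p q x_def y_def by (simp_all add: vector_2 algebra_simps)
    then show "x p = - (sqrt 3 / 2 * r)" "y p = r / 2" "x q = sqrt 3 / 2 * r" "y q = r / 2"
      unfolding * by simp_all
  qed
  have np: "norm p = r" "norm q = r"
  proof -
    have "(norm p)\<^sup>2 = r\<^sup>2" "(norm q)\<^sup>2 = r\<^sup>2"
      unfolding frame xp by (simp_all add: power_mult_distrib power_divide)
    then show "norm p = r" "norm q = r" using r(1) by (simp_all add: power2_eq_iff_nonneg)
  qed
  have pq: "p \<in> U" "q \<in> U" using norm_in(1) np r(1) by simp_all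
  let ?m = "sqrt 3 * r * (1 + r\<^sup>2 / 25)"
  have m_le: "?m \<le> 4 * r"
  proof -
    have "sqrt 3 \<le> 2" by (rule real_le_lsqrt) auto
    then have "sqrt 3 * r * (1 + r\<^sup>2 / 25) \<le> 2 * r * 2"
      using r(1) r2 by (intro mult_mono) auto
    then show ?thesis by simp
  qed
  let ?B = "cball (0::real^2) (10 * r)" and ?O = "ball (0::real^2) (10 * r)"
  have nB: "norm w \<le> 10 * r" if "w \<in> ?B" for w using that by simp
  have cont: "continuous_on UNIV \<Phi>"
    using has_derivative_continuous[OF \<Phi>] by (intro continuous_at_imp_continuous_on) auto
  have K: "compact (\<Phi> ` ?B)"
    using compact_continuous_image[OF continuous_on_subset[OF cont]] by simp
  have BU: "?B \<subseteq> U" "?O \<subseteq> U" using ball by auto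
  have Ksub: "\<Phi> ` ?B \<subseteq> snd c ` fst c" using U(4) BU by blast
  have O: "open (\<Phi> ` ?O)"
  proof -
    have "continuous_on (\<Phi> ` U) \<psi>"
      using has_derivative_continuous[OF \<psi>(2)] by (intro continuous_at_imp_continuous_on) auto
    then have "open (\<Phi> ` U \<inter> \<psi> -` ?O)"
      using U(3) by (rule continuous_open_preimage) simp
    moreover have "\<Phi> ` U \<inter> \<psi> -` ?O = \<Phi> ` ?O"
      using BU(2) \<psi>(1) by force
    ultimately show ?thesis by simp
  qed
  show ?thesis
  proof (rule dist_greatest[OF connected pt(3)[OF pq(1)] pt(3)[OF pq(2)]])
    fix \<gamma> assume \<gamma>: "piecewise_smooth_curve X A \<gamma>" "\<gamma> 0 = pt p" "\<gamma> 1 = pt q"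
    have path: "pathin X \<gamma>" using \<gamma>(1) unfolding piecewise_smooth_curve_def by blast
    have start: "\<gamma> 0 \<in> fst c" "snd c (\<gamma> 0) = \<Phi> p" "snd c (\<gamma> 1) = \<Phi> q"
      unfolding \<gamma> using pt[OF pq(1)] pt[OF pq(2)] by auto
    have start': "snd c (\<gamma> 0) \<in> \<Phi> ` ?O" unfolding start(2) using np r(1) by auto
    have OK: "\<Phi> ` ?O \<subseteq> \<Phi> ` ?B" by auto
    show "?m \<le> curve_length A g \<gamma>"
    proof (cases rule: first_exit[OF path c K Ksub O OK start(1) start'])
      case stay: 1
      define F where "F w = x w + x w * (y w)\<^sup>2 / 6" for w
      let ?F' = "\<lambda>w v. (1 + (y w)\<^sup>2 / 6) * x v + x w * y w / 3 * y v"
      have dx: "(x has_derivative x) (at w)" and dy: "(y has_derivative y) (at w)" for w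
        unfolding x_def[abs_def] y_def[abs_def]
        by (intro derivative_intros has_derivative_mult_right bounded_linear.has_derivative[OF bounded_linear_vec_nth] has_derivative_ident)+
      have dF: "(F has_derivative ?F' w) (at w)" for w
      proof -
        have "(F has_derivative (\<lambda>v. x v + (x w * (2 * y v * y w) + x v * (y w)\<^sup>2) / 6)) (at w)"
          unfolding F_def[abs_def] power2_eq_square
          by (rule has_derivative_eq_rhs,
              rule has_derivative_add[OF dx has_derivative_divide[OF has_derivative_mult[OF dx has_derivative_mult[OF dy dy]]]])
            (auto simp: algebra_simps)
        then show ?thesis
          by (rule has_derivative_eq_rhs) (auto simp: field_simps power2_eq_square)
      qed
      have bound: "\<bar>?F' w v\<bar> \<le> (1 + r\<^sup>2 / 1000) * sqrt (Q w v)" if w: "w \<in> ?B" for w v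
      proof -
        note n = norm_in(2)[OF nB[OF w]] norm_in(3)[OF nB[OF w], of v]
        have Q0: "0 \<le> Q w v" using n(2) zero_le_power2[of "norm v"] by linarith
        have n1: "(norm w)\<^sup>2 \<le> 1" using n(1) r2 by linarith
        have "(?F' w v)\<^sup>2 \<le> (x v)\<^sup>2 + (y v)\<^sup>2 + (x w * y v - y w * x v)\<^sup>2 / 3 + ((x w)\<^sup>2 + (y w)\<^sup>2)\<^sup>2 * ((x v)\<^sup>2 + (y v)\<^sup>2)"
          using n1 unfolding frame by (rule calibration_ineq)
        then have "(?F' w v)\<^sup>2 \<le> (norm v)\<^sup>2 + (w$1 * v$2 - w$2 * v$1)\<^sup>2 / 3 + ((norm w)\<^sup>2)\<^sup>2 * (norm v)\<^sup>2"
          unfolding frame cross .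
        also have "\<dots> \<le> Q w v + 1 / 1000000 * (norm w)\<^sup>2 * (norm v)\<^sup>2 + ((norm w)\<^sup>2)\<^sup>2 * (norm v)\<^sup>2"
          using est[OF nB[OF w], of v] by linarith
        also have "\<dots> = Q w v + (1 / 1000000 + (norm w)\<^sup>2) * ((norm w)\<^sup>2 * (norm v)\<^sup>2)"
          by (simp add: algebra_simps power2_eq_square)
        \<comment> \<open>The total error, \<open>4 / 10000 * r\<^sup>2\<close> times
          \<open>Q w v\<close>, fits below the \<open>2 / 1000 * r\<^sup>2\<close> available in
          \<open>(1 + r\<^sup>2 / 1000)\<^sup>2\<close>.\<close>
        also have "\<dots> \<le> Q w v + 2 / 1000000 * ((100 * r\<^sup>2) * (2 * Q w v))"
        proof -
          have "(norm w)\<^sup>2 \<le> 1 / 1000000" using n(1) r2 by simp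
          then show ?thesis
            using n by (intro add_left_mono mult_mono) auto
        qed
        also have "\<dots> \<le> (1 + r\<^sup>2 / 1000)\<^sup>2 * Q w v"
        proof -
          have "1 + 4 / 10000 * r\<^sup>2 \<le> (1 + r\<^sup>2 / 1000)\<^sup>2"
            using r(1) by (simp add: power2_eq_square algebra_simps add_nonneg_nonneg)
          from mult_right_mono[OF this Q0] show ?thesis by (simp add: algebra_simps)
        qed
        also have "\<dots> = ((1 + r\<^sup>2 / 1000) * sqrt (Q w v))\<^sup>2"
          using Q0 by (simp add: power_mult_distrib)
        finally show ?thesis
          by (rule abs_le_square_iff[THEN iffD2, THEN order_trans]) (use Q0 in simp)
      qed
      have "\<bar>F (\<psi> (snd c (\<gamma> 1))) - F (\<psi> (snd c (\<gamma> 0)))\<bar> \<le> (1 + r\<^sup>2 / 1000) * curve_length A g \<gamma>"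
      proof (rule coordinate_variation_le[OF \<gamma>(1) _ BU(1) _ dF bound])
        show "\<gamma> t \<in> fst c \<and> snd c (\<gamma> t) \<in> \<Phi> ` ?B" if "t \<in> {0..1}" for t
          using stay[OF that] OK by blast
      qed auto
      \<comment> \<open>\<open>y\<close> is \<open>r / 2\<close> at both ends, so the cubic term
        contributes the factor \<open>(r / 2)\<^sup>2 / 6 = r\<^sup>2 / 24\<close>.\<close>
      moreover have "F q - F p = sqrt 3 * r * (1 + r\<^sup>2 / 24)"
        unfolding F_def xp by (simp add: field_simps power2_eq_square)
      ultimately have "sqrt 3 * r * (1 + r\<^sup>2 / 24) \<le> (1 + r\<^sup>2 / 1000) * curve_length A g \<gamma>"
        unfolding start \<psi>(1)[OF pq(1)] \<psi>(1)[OF pq(2)] by linarith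
      \<comment> \<open>The drop from 1/24 to 1/25, that is 1/600, pays for the factor
        \<open>1 + r\<^sup>2 / 1000\<close>.\<close>
      moreover have "(1 + r\<^sup>2 / 1000) * ?m \<le> sqrt 3 * r * (1 + r\<^sup>2 / 24)"
      proof -
        have "r\<^sup>2 * r\<^sup>2 \<le> 1 * r\<^sup>2" using r2 by (intro mult_right_mono) auto
        moreover have "(1 + r\<^sup>2 / 1000) * (1 + r\<^sup>2 / 25) = 1 + r\<^sup>2 / 25 + r\<^sup>2 / 1000 + r\<^sup>2 * r\<^sup>2 / 25000"
          by (simp add: field_simps)
        ultimately have "(1 + r\<^sup>2 / 1000) * (1 + r\<^sup>2 / 25) \<le> 1 + r\<^sup>2 / 24"
          using r2(2) by linarith
        from mult_left_mono[OF this, of "sqrt 3 * r"] show ?thesis using r(1) by (simp add: mult_ac)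
      qed
      ultimately have "(1 + r\<^sup>2 / 1000) * ?m \<le> (1 + r\<^sup>2 / 1000) * curve_length A g \<gamma>" by linarith
      moreover have "0 < 1 + r\<^sup>2 / 1000" using r2(2) by linarith
      ultimately show ?thesis by (rule mult_left_le_imp_le)
    next
      case (2 \<tau>)
      obtain w where w: "w \<in> ?B" "snd c (\<gamma> \<tau>) = \<Phi> w"
        using 2(2)[of \<tau>] 2(1) by auto
      have nw: "norm w = 10 * r"
        using 2(3) w by (auto simp: image_iff less_le)
      \<comment> \<open>The linear function in the direction of the exit point rises from at most
        \<open>r\<close> to \<open>10 * r\<close>. Its differential is at most twice the metric
        norm, so the curve is longer than \<open>4 * r\<close>.\<close>
      define e where "e = (1 / (10 * r)) *\<^sub>R w"
      have ne: "norm e = 1" unfolding e_def using nw r(1) by simp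
      have "\<bar>\<psi> (snd c (\<gamma> \<tau>)) \<bullet> e - \<psi> (snd c (\<gamma> 0)) \<bullet> e\<bar> \<le> 2 * curve_length A g \<gamma>"
      proof (rule coordinate_variation_le[OF \<gamma>(1) 2(1) BU(1) 2(2), where F' = "\<lambda>w v. v \<bullet> e"])
        show "((\<lambda>w. w \<bullet> e) has_derivative (\<lambda>v. v \<bullet> e)) (at w)" for w
          by (auto intro!: derivative_eq_intros)
        fix w v assume "w \<in> ?B"
        from norm_in(3)[OF nB[OF this], of v] have Q: "(norm v)\<^sup>2 \<le> 4 * Q w v"
          using zero_le_power2[of "norm v"] by linarith
        have "\<bar>v \<bullet> e\<bar> \<le> norm v" using Cauchy_Schwarz_ineq2[of v e] ne by simp
        also have "\<dots> \<le> sqrt (4 * Q w v)" using Q by (rule real_le_rsqrt)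
        also have "\<dots> = 2 * sqrt (Q w v)" by (simp add: real_sqrt_mult)
        finally show "\<bar>v \<bullet> e\<bar> \<le> 2 * sqrt (Q w v)" .
      qed auto
      moreover have "\<psi> (snd c (\<gamma> \<tau>)) = w" "\<psi> (snd c (\<gamma> 0)) = p"
        unfolding w(2) start(2) using \<psi>(1) pq(1) w(1) BU by auto
      moreover have "w \<bullet> e = 10 * r"
        unfolding e_def using nw r(1) by (simp add: power2_eq_square flip: power2_norm_eq_inner)
      moreover have "\<bar>p \<bullet> e\<bar> \<le> r" using Cauchy_Schwarz_ineq2[of p e] ne np by simp
      ultimately have "9 * r \<le> 2 * curve_length A g \<gamma>" by (simp add: abs_le_iff)
      then show ?thesis using m_le r(1) by linarith
    qed
  qed
qed

end

lemma steiner_ratio_less: "steiner_ratio (topspace X) d < sqrt 3 / 2"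
proof -
  obtain \<delta> where \<delta>: "\<delta> > 0" "\<And>w v. norm w < \<delta> \<Longrightarrow>
      \<bar>Q w v - ((norm v)\<^sup>2 + (w$1 * v$2 - w$2 * v$1)\<^sup>2 / 3)\<bar> \<le> 1 / 1000000 * (norm w)\<^sup>2 * (norm v)\<^sup>2"
    using estimate[of "1 / 1000000"] unfolding Q_def by auto
  obtain \<rho> where \<rho>: "\<rho> > 0" "cball 0 \<rho> \<subseteq> U"
    using U(1,2) open_contains_cball by blast
  \<comment> \<open>The 20 leaves room for the strict inequality \<open>10 * r < \<delta>\<close>,
    which the estimate requires on the closed ball.\<close>
  define r where "r = min (1 / 100000) (min (\<rho> / 10) (\<delta> / 20))"
  have r: "0 < r" "r \<le> 1 / 100000" "10 * r \<le> \<rho>" "10 * r < \<delta>"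
    unfolding r_def using \<delta>(1) \<rho>(1) by (auto simp: min_def)
  have ball: "cball 0 (10 * r) \<subseteq> U" using r(3) \<rho>(2) by auto
  have est: "\<bar>Q w v - ((norm v)\<^sup>2 + (w$1 * v$2 - w$2 * v$1)\<^sup>2 / 3)\<bar> \<le> 1 / 1000000 * (norm w)\<^sup>2 * (norm v)\<^sup>2"
    if "norm w \<le> 10 * r" for w v
    using \<delta>(2) that r(4) by simp
  let ?e\<^sub>1 = "vector [- sqrt 3 / 2, 1 / 2] :: real^2" and ?e\<^sub>2 = "vector [sqrt 3 / 2, 1 / 2] :: real^2"
    and ?e\<^sub>3 = "vector [0, -1] :: real^2"
  let ?s = "r * (1 + r\<^sup>2 / 1000000)" and ?a = "sqrt 3 * r * (1 + r\<^sup>2 / 25)"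
  note upper = dist_radius_le[OF r(1,2) ball est] and lower = dist_vertices_ge[OF r(1,2) ball est]
  have n: "norm ?e\<^sub>1 = 1" "norm ?e\<^sub>2 = 1" "norm ?e\<^sub>3 = 1"
    by (simp_all add: norm_vec_def L2_set_def sum_2 vector_2 power_divide)
  have inU: "r *\<^sub>R e \<in> U" if "norm e = 1" for e
    using that ball r(1) by auto
  have eq: "e = e'" if "pt (r *\<^sub>R e) = pt (r *\<^sub>R e')" "norm e = 1" "norm e' = 1" for e e'
  proof -
    have "\<Phi> (r *\<^sub>R e) = \<Phi> (r *\<^sub>R e')"
      using pt(2)[OF inU[OF that(2)]] pt(2)[OF inU[OF that(3)]] that(1) by simp
    then have "r *\<^sub>R e = r *\<^sub>R e'"
      using \<psi>(1)[OF inU[OF that(2)]] \<psi>(1)[OF inU[OF that(3)]] by metis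
    then show ?thesis using r(1) by simp
  qed
  interpret W: weighted "topspace X" d
    by unfold_locales (auto intro: dist_sym dist_nonneg[OF connected])
  have "steiner_ratio (topspace X) d \<le> 3 * ?s / (2 * ?a)"
  proof (rule W.steiner_ratio_triangle[of "pt 0" "pt (r *\<^sub>R ?e\<^sub>1)" "pt (r *\<^sub>R ?e\<^sub>2)" "pt (r *\<^sub>R ?e\<^sub>3)"])
    show "{pt 0, pt (r *\<^sub>R ?e\<^sub>1), pt (r *\<^sub>R ?e\<^sub>2), pt (r *\<^sub>R ?e\<^sub>3)} \<subseteq> topspace X"
      using pt(3) U(2) inU n by simp
    show "pt (r *\<^sub>R ?e\<^sub>1) \<noteq> pt (r *\<^sub>R ?e\<^sub>2)" "pt (r *\<^sub>R ?e\<^sub>2) \<noteq> pt (r *\<^sub>R ?e\<^sub>3)" "pt (r *\<^sub>R ?e\<^sub>3) \<noteq> pt (r *\<^sub>R ?e\<^sub>1)"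
      using eq[OF _ n(1,2)] eq[OF _ n(2,3)] eq[OF _ n(3,1)] by (auto simp: vec_eq_iff forall_2 vector_2)
    show "d (pt 0) (pt (r *\<^sub>R ?e\<^sub>1)) \<le> ?s" "d (pt 0) (pt (r *\<^sub>R ?e\<^sub>2)) \<le> ?s" "d (pt 0) (pt (r *\<^sub>R ?e\<^sub>3)) \<le> ?s"
      using upper n by blast+
    \<comment> \<open>The parameters given to \<open>lower\<close> here and below are the unit
      vector from the first vertex of the side to the second, in cyclic order.\<close>
    show "?a \<le> d (pt (r *\<^sub>R ?e\<^sub>1)) (pt (r *\<^sub>R ?e\<^sub>2))"
      by (rule lower[of 1 0]) simp_all
    show "?a \<le> d (pt (r *\<^sub>R ?e\<^sub>2)) (pt (r *\<^sub>R ?e\<^sub>3))"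
      by (rule lower[of "-1/2" "- sqrt 3 / 2"]) (simp_all add: power_divide)
    show "?a \<le> d (pt (r *\<^sub>R ?e\<^sub>3)) (pt (r *\<^sub>R ?e\<^sub>1))"
      by (rule lower[of "-1/2" "sqrt 3 / 2"]) (simp_all add: power_divide)
    show "0 < ?a" using r(1) by (simp add: add_pos_nonneg)
  qed
  also have "\<dots> < sqrt 3 / 2"
  proof -
    \<comment> \<open>Without the factors containing \<open>r\<^sup>2\<close> both sides would equal
      \<open>3 * r\<close>, the Euclidean case; comparing \<open>1 / 1000000\<close> with
      \<open>1 / 25\<close> makes the inequality strict.\<close>
    have "3 * ?s < sqrt 3 / 2 * (2 * ?a)"
    proof -
      have square: "s / 2 * (2 * (s * r * k)) = s * s * (r * k)" for s k :: real
        by (simp add: algebra_simps)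
      have "sqrt 3 / 2 * (2 * ?a) = 3 * (r * (1 + r\<^sup>2 / 25))"
        unfolding square by simp
      moreover have "r * (1 + r\<^sup>2 / 1000000) < r * (1 + r\<^sup>2 / 25)"
        using r(1) by (intro mult_strict_left_mono) auto
      ultimately show ?thesis by linarith
    qed
    moreover have "0 < 2 * ?a" using r(1) by (simp add: add_pos_nonneg)
    ultimately show ?thesis by (simp only: pos_divide_less_eq)
  qed
  finally show ?thesis .
qed

end

theorem theorem1p4:
  fixes X :: "'a topology"
    and A :: "('a, 2) chart set"
    and g :: "('a, 2) metric_components"
  assumes "smooth_manifold X A"
    and "connected_space X"
    and "riemannian_metric A g"
    and "constant_curvature A g (-1)"
  shows "steiner_ratio (topspace X) (riemannian_dist X A g) < sqrt 3 / 2"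
proof -
  have "riemannian X A g" using assms(1,3) by unfold_locales
  from normal_chart_exists[OF this assms(2,4)] show ?thesis
    using normal_chart.steiner_ratio_less by blast
qed

end
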